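(* Let $d\ge1$, let $I\in\{I_{T^2},I_\emptyset,I_{S^2}\}$, and let $D$ be an $I$-real primitive $PGL_2(\mathbb{C})$-phase tropical diagram of degree $d$ (as defined in the context). Then $\overline{D^I}$ is a (possibly empty) topological surface, i.e. a topological 2-manifold.
   Context: Notation. $\mathbb{C}\mathbb{P}^3=\mathbb{P}(\mathrm{Mat}_{2\times2}(\mathbb{C}))$; $[A]_{\mathbb{C}^*}$ is the class of $A\ne0$ modulo $\mathbb{C}^*$ and $[A]_{\mathbb{R}^*}$ its class modulo $\mathbb{R}^*$. $PGL_2(\mathbb{C})=PSL_2(\mathbb{C})=\{\det\neq0\}\subset\mathbb{C}\mathbb{P}^3$, and $Q=\{\det=0\}\subset\mathbb{C}\mathbb{P}^3$ is the quadric, $Q\cong\mathbb{C}\mathbb{P}^1\times\mathbb{C}\mathbb{P}^1$. $A^*$ is the conjugate transpose, $A^{adj}$ the adjugate. Let $\mathcal{S}=\{[B]_{\mathbb{R}^*}: B\neq0,\ \det B=0\}$, a circle bundle over $Q$ via $[B]_{\mathbb{R}^*}\mapsto[B]_{\mathbb{C}^*}$, with fiber $\{[cB]_{\mathbb{R}^*}: c\in U(1)\}$ over $[B]_{\mathbb{C}^*}$; for $C\subset Q$, $\mathcal{S}|_C$ is the restriction of $\mathcal{S}$ to $C$. The map $$\psi:(0,\infty)\times\mathcal{S}\to PSL_2(\mathbb{C})\setminus PSU(2),\qquad \psi(\alpha,[B]_{\mathbb{R}^*})=[e^{\alpha}B+e^{-\alpha}(B^* )^{adj}]_{\mathbb{C}^*}$$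 is a diffeomorphism, and subsets of $(0,\infty)\times\mathcal{S}$ are regarded as subsets of $PSL_2(\mathbb{C})$ via $\psi$. Let $\varkappa^\circ:PSL_2(\mathbb{C})\to PSU(2)$ be the unitary part in the polar decomposition: $\varkappa^\circ[A]_{\mathbb{C}^*}=[A+(A^* )^{adj}]_{\mathbb{R}^*}$ for a representative $A$ with $\det A=1$. Primitive diagrams of degree $d$. Write $d=2k$ or $d=2k+1$. The data are real numbers $0<\gamma_1<\dots<\gamma_k<\gamma_{k+1}:=+\infty$ (critical levels) and, for every integer $0\le m\le d$ with $m\equiv d\pmod 2$, a complex polynomial $f_m$ in the entries of $2\times2$ matrices, homogeneous of degree $m$. Let $C_m\subset Q$ be the curve cut out by $f_m$ (of bidegree $(m,m)$; if $d$ is even, $f_0$ is a nonzero constant and $C_0=\emptyset$). Primitivity means that every $C_m$ is smooth and that $C_m$ and $C_{m+2}$ are transverse for all $m$. Put $\epsilon=0$ if $d$ is even and $\epsilon=1$ if $d$ is odd, and $m_j=2j+\epsilon$ for $0\le j\le k$. For $1\le j\le k$ define the section $\sigma_j$ of $\mathcal{S}$ over $Q\setminus(C_{m_{j-1}}\cup C_{m_j})$ by $$\sigma_j([B]_{\mathbb{C}^*})=\left[\sqrt{\tfrac{f_{m_{j-1}}(B)}{f_{m_j}(B)}}\;B\right]_{\mathbb{R}^*},$$ which does not depend on the choice of square root or of representative $B$. If $d$ is even let $$D_0=\Big(\bigsqcup_{j=1}^k(\gamma_j,\gamma_{j+1})\times\mathcal{S}|_{C_{m_j}}\Big)\sqcup\Big(\bigsqcup_{j=1}^k\{\gamma_j\}\times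 \mathrm{Im}(\sigma_j)\Big).$$ If $d$ is odd let $D_0$ be the union of the same set with $(0,\gamma_1)\times\mathcal{S}|_{C_1}$ and with the coamoeba $\varkappa^\circ(\{f_1=0\}\cap PSL_2(\mathbb{C}))\subset PSU(2)$ of the plane $f_1=0$. The primitive $PGL_2(\mathbb{C})$-phase tropical diagram $D$ with these data is the closure of $D_0$ in $\mathbb{C}\mathbb{P}^3$. Real structures. Three anti-holomorphic involutions of $\mathbb{C}\mathbb{P}^3$ preserving $PGL_2(\mathbb{C})$, with antilinear lifts to $\mathrm{Mat}_{2\times2}(\mathbb{C})$: $I_{T^2}[A]=[\overline{A}]$ with lift $\tilde I(A)=\overline A$ (entrywise conjugation); $I_\emptyset[A]=[(A^* )^{-1}]=[(A^* )^{adj}]$ with lift $\tilde I(A)=(A^* )^{adj}$; $I_{S^2}[A]=[A^*]$ with lift $\tilde I(A)=A^*$. For such $I$, the diagram $D$ is called $I$-real if each $f_m$ in the data is invariant under $I$, i.e. $\overline{f_m(\tilde I(A))}=f_m(A)$ for all $A$. In this case $D^I=\{p\in D: I(p)=p\}$, and $\overline{D^I}$ is its closure in the fixed locus of $I$ in $\mathbb{C}\mathbb{P}^3$, which is a copy of $\mathbb{R}\mathbb{P}^3$. *)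

theory Defs
  imports "HOL-Analysis.Analysis"
begin

section \<open>Matrices, projective classes and the topology of complex projective 3-space\<close>

type_synonym M2 = "complex^2^2"

definition cscale :: "complex \<Rightarrow> M2 \<Rightarrow> M2" where
  "cscale c A = map_matrix (\<lambda>x. c * x) A"

definition entry_conj :: "M2 \<Rightarrow> M2" where
  "entry_conj A = map_matrix cnj A"

definition conj_transpose :: "M2 \<Rightarrow> M2" where
  "conj_transpose A = map_matrix cnj (transpose A)"

definition adjugate :: "M2 \<Rightarrow> M2" where
  "adjugate A = vector [vector [A$2$2, - (A$1$2)], vector [- (A$2$1), A$1$1]]"

definition conj_transpose_adj :: "M2 \<Rightarrow> M2" where
  "conj_transpose_adj A = adjugate (conj_transpose A)"

lemma cscale_nth [simp]: "cscale c A $ i $ j = c * A $ i $ j"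
  by (simp add: cscale_def map_matrix_def)

lemma cscale_1 [simp]: "cscale 1 A = A"
  by (simp add: vec_eq_iff)

lemma cscale_cscale [simp]: "cscale a (cscale b A) = cscale (a * b) A"
  by (simp add: vec_eq_iff)

lemma cscale_eq_0 [simp]: "cscale c A = 0 \<longleftrightarrow> c = 0 \<or> A = 0"
  by (auto simp: vec_eq_iff)

lemma cscale_add: "cscale c (A + B) = cscale c A + cscale c B"
  by (simp add: vec_eq_iff algebra_simps)

lemma cscale_of_real: "cscale (of_real r) A = r *\<^sub>R A"
  by (simp add: vec_eq_iff scaleR_conv_of_real[where 'a = complex])

lemma det_cscale: "det (cscale c A) = c\<^sup>2 * det A"
  by (simp add: det_2 power2_eq_square algebra_simps)

lemma antilinear_entry_conj: "entry_conj (cscale c A) = cscale (cnj c) (entry_conj A)"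
  by (simp add: entry_conj_def map_matrix_def vec_eq_iff)

lemma antilinear_conj_transpose:
  "conj_transpose (cscale c A) = cscale (cnj c) (conj_transpose A)"
  by (simp add: conj_transpose_def map_matrix_def transpose_def vec_eq_iff)

lemma antilinear_conj_transpose_adj:
  "conj_transpose_adj (cscale c A) = cscale (cnj c) (conj_transpose_adj A)"
  by (simp add: conj_transpose_adj_def antilinear_conj_transpose adjugate_def
      vec_eq_iff forall_2)

text \<open>Points of \<open>cp3\<close> are the classes of nonzero matrices modulo nonzero complex scalars,
  points of \<open>rp7\<close> those modulo nonzero real scalars.  The value of \<open>cclass\<close> and
  \<open>rclass\<close> at the zero matrix is irrelevant.\<close>

quotient_type cp3 = M2 / partial: "\<lambda>A B. A \<noteq> 0 \<and> (\<exists>c. c \<noteq> 0 \<and> B = cscale c A)"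
  morphisms rep_cp3 cclass
proof (rule part_equivpI)
  show "\<exists>A::M2. A \<noteq> 0 \<and> (\<exists>c. c \<noteq> 0 \<and> A = cscale c A)"
    by (rule exI[of _ "mat 1"], auto intro!: exI[of _ "1::complex"] simp: vec_eq_iff mat_def)
  show "symp (\<lambda>A B. A \<noteq> 0 \<and> (\<exists>c. c \<noteq> 0 \<and> B = cscale c A))"
  proof (rule sympI, elim conjE exE)
    fix A B :: M2 and c assume "A \<noteq> 0" "c \<noteq> 0" "B = cscale c A"
    then show "B \<noteq> 0 \<and> (\<exists>c. c \<noteq> 0 \<and> A = cscale c B)"
      by (auto intro!: exI[of _ "inverse c"])
  qed
  show "transp (\<lambda>A B. A \<noteq> 0 \<and> (\<exists>c. c \<noteq> 0 \<and> B = cscale c A))"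
    by (rule transpI) (metis cscale_cscale mult_eq_0_iff)
qed

quotient_type rp7 = M2 / partial: "\<lambda>A B. A \<noteq> 0 \<and> (\<exists>r::real. r \<noteq> 0 \<and> B = r *\<^sub>R A)"
  morphisms rep_rp7 rclass
proof (rule part_equivpI)
  show "\<exists>A::M2. A \<noteq> 0 \<and> (\<exists>r::real. r \<noteq> 0 \<and> A = r *\<^sub>R A)"
    by (rule exI[of _ "mat 1"], auto intro!: exI[of _ "1::real"] simp: vec_eq_iff mat_def)
  show "symp (\<lambda>A B::M2. A \<noteq> 0 \<and> (\<exists>r::real. r \<noteq> 0 \<and> B = r *\<^sub>R A))"
  proof (rule sympI, elim conjE exE)
    fix A B :: M2 and r :: real assume "A \<noteq> 0" "r \<noteq> 0" "B = r *\<^sub>R A"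
    then show "B \<noteq> 0 \<and> (\<exists>r. r \<noteq> 0 \<and> A = r *\<^sub>R B)"
      by (auto intro!: exI[of _ "inverse r"])
  qed
  show "transp (\<lambda>A B::M2. A \<noteq> 0 \<and> (\<exists>r::real. r \<noteq> 0 \<and> B = r *\<^sub>R A))"
    by (rule transpI) (metis scaleR_scaleR mult_eq_0_iff)
qed

lemma cclass_eq_iff:
  assumes "A \<noteq> 0" "B \<noteq> 0"
  shows "cclass A = cclass B \<longleftrightarrow> (\<exists>c. c \<noteq> 0 \<and> B = cscale c A)"
proof -
  have refl: "\<exists>c. c \<noteq> 0 \<and> X = cscale c X" for X :: M2
    by (rule exI[of _ 1]) simp
  show ?thesis
    using Quotient3_rel[OF Quotient3_cp3, of A B] assms refl by auto
qed

lemma rclass_eq_iff: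
  assumes "A \<noteq> 0" "B \<noteq> 0"
  shows "rclass A = rclass B \<longleftrightarrow> (\<exists>r. r \<noteq> 0 \<and> B = r *\<^sub>R A)"
proof -
  have refl: "\<exists>r::real. r \<noteq> 0 \<and> X = r *\<^sub>R X" for X :: M2
    by (rule exI[of _ 1]) simp
  show ?thesis
    using Quotient3_rel[OF Quotient3_rp7, of A B] assms refl by auto
qed

lemma cclass_rep [simp]: "cclass (rep_cp3 p) = p"
  by (rule Quotient3_abs_rep[OF Quotient3_cp3])

lemma rclass_rep [simp]: "rclass (rep_rp7 s) = s"
  by (rule Quotient3_abs_rep[OF Quotient3_rp7])

lemma rep_cp3_nonzero [simp]: "rep_cp3 p \<noteq> 0"
  using Quotient3_rep_reflp[OF Quotient3_cp3, of p] by blast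

lemma rep_rp7_nonzero [simp]: "rep_rp7 s \<noteq> 0"
  using Quotient3_rep_reflp[OF Quotient3_rp7, of s] by blast

lemma rep_cclass:
  assumes "A \<noteq> 0"
  obtains c where "c \<noteq> 0" "rep_cp3 (cclass A) = cscale c A"
  using cclass_eq_iff[of A "rep_cp3 (cclass A)"] assms by auto

lemma rep_rclass:
  assumes "A \<noteq> 0"
  obtains r where "r \<noteq> 0" "rep_rp7 (rclass A) = r *\<^sub>R A"
  using rclass_eq_iff[of A "rep_rp7 (rclass A)"] assms by auto

text \<open>The quotient topology.\<close>

instantiation cp3 :: topological_space
begin

definition open_cp3 :: "cp3 set \<Rightarrow> bool" where
  "open_cp3 U \<longleftrightarrow> open {A. A \<noteq> 0 \<and> cclass A \<in> U}"

instance
proof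
  have "{A::M2. A \<noteq> 0 \<and> cclass A \<in> UNIV} = - {0}"
    by auto
  then show "open (UNIV :: cp3 set)"
    by (simp add: open_cp3_def open_Compl)
  fix S T :: "cp3 set" assume "open S" "open T"
  moreover have "{A. A \<noteq> 0 \<and> cclass A \<in> S \<inter> T}
      = {A. A \<noteq> 0 \<and> cclass A \<in> S} \<inter> {A. A \<noteq> 0 \<and> cclass A \<in> T}"
    by auto
  ultimately show "open (S \<inter> T)"
    by (simp only: open_cp3_def open_Int)
next
  fix K :: "cp3 set set" assume "\<forall>S\<in>K. open S"
  moreover have "{A. A \<noteq> 0 \<and> cclass A \<in> \<Union>K} = (\<Union>S\<in>K. {A. A \<noteq> 0 \<and> cclass A \<in> S})"
    by auto
  ultimately show "open (\<Union>K)"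
    by (simp add: open_cp3_def open_UN)
qed

end

section \<open>The quadric, its circle bundle and the curves on it\<close>

definition PSL2 :: "cp3 set" where
  "PSL2 = {cclass A |A. A \<noteq> 0 \<and> det A \<noteq> 0}"

definition quadric :: "cp3 set" where
  "quadric = {cclass B |B. B \<noteq> 0 \<and> det B = 0}"

definition plane_section :: "(M2 \<Rightarrow> complex) \<Rightarrow> cp3 set" where
  "plane_section f = {cclass A |A. A \<noteq> 0 \<and> f A = 0}"

definition curve :: "(M2 \<Rightarrow> complex) \<Rightarrow> cp3 set" where
  "curve f = {cclass B |B. B \<noteq> 0 \<and> det B = 0 \<and> f B = 0}"

definition circle_bundle :: "rp7 set" where
  "circle_bundle = {rclass B |B. B \<noteq> 0 \<and> det B = 0}"

definition bundle_proj :: "rp7 \<Rightarrow> cp3" where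
  "bundle_proj s = cclass (rep_rp7 s)"

definition bundle_over :: "cp3 set \<Rightarrow> rp7 set" where
  "bundle_over C = {s \<in> circle_bundle. bundle_proj s \<in> C}"

lemma bundle_proj_rclass: "B \<noteq> 0 \<Longrightarrow> bundle_proj (rclass B) = cclass B"
  by (rule rep_rclass[of B])
    (auto simp: bundle_proj_def cscale_of_real[symmetric] cclass_eq_iff
      intro!: exI[of _ "inverse (complex_of_real _)"])

text \<open>Homogeneous polynomials of degree \<open>m\<close> in the four matrix entries, as functions; the
  monomials are indexed by their matrices of exponents.\<close>

definition exponents :: "nat \<Rightarrow> (nat^2^2) set" where
  "exponents m = {e. (\<Sum>i\<in>UNIV. \<Sum>j\<in>UNIV. e$i$j) = m}"

definition homogeneous_poly :: "nat \<Rightarrow> (M2 \<Rightarrow> complex) \<Rightarrow> bool" where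
  "homogeneous_poly m f \<longleftrightarrow>
     (\<exists>a. \<forall>A. f A = (\<Sum>e\<in>exponents m. a e * (\<Prod>i\<in>UNIV. \<Prod>j\<in>UNIV. (A$i$j) ^ (e$i$j))))"

lemma finite_exponents: "finite (exponents m)"
proof (rule finite_subset)
  let ?g = "\<lambda>(a, b, c, d). vector [vector [a, b], vector [c, d]] :: nat^2^2"
  show "exponents m \<subseteq> ?g ` ({..m} \<times> {..m} \<times> {..m} \<times> {..m})"
  proof
    fix e assume "e \<in> exponents m"
    then have "e$1$1 + e$1$2 + (e$2$1 + e$2$2) = m"
      by (simp add: exponents_def sum_2)
    moreover have "e = ?g (e$1$1, e$1$2, e$2$1, e$2$2)"
      by (simp add: vec_eq_iff forall_2)
    ultimately show "e \<in> ?g ` ({..m} \<times> {..m} \<times> {..m} \<times> {..m})"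
      by (intro image_eqI[of _ _ "(e$1$1, e$1$2, e$2$1, e$2$2)"]) auto
  qed
qed simp

lemma homogeneous_poly_cscale:
  assumes "homogeneous_poly m f"
  shows "f (cscale c A) = c ^ m * f A"
proof -
  obtain a where a: "\<And>A. f A = (\<Sum>e\<in>exponents m. a e * (\<Prod>i\<in>UNIV. \<Prod>j\<in>UNIV. (A$i$j) ^ (e$i$j)))"
    using assms unfolding homogeneous_poly_def by blast
  show ?thesis
    unfolding a sum_distrib_left
  proof (rule sum.cong[OF refl])
    fix e assume "e \<in> exponents m"
    then have m: "m = e$1$1 + e$1$2 + (e$2$1 + e$2$2)"
      by (simp add: exponents_def sum_2)
    have prod2: "(\<Prod>i\<in>UNIV. h i) = h 1 * h 2" for h :: "2 \<Rightarrow> complex"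
      by (simp add: UNIV_2)
    show "a e * (\<Prod>i\<in>UNIV. \<Prod>j\<in>UNIV. (cscale c A $i$j) ^ (e$i$j))
        = c ^ m * (a e * (\<Prod>i\<in>UNIV. \<Prod>j\<in>UNIV. (A$i$j) ^ (e$i$j)))"
      by (simp add: prod2 m power_mult_distrib power_add mult_ac)
  qed
qed

text \<open>Tangent spaces are taken on the affine cones in the space of matrices, at a nonzero
  representative \<open>B\<close>; dividing by the line through \<open>B\<close>, which they contain, gives the
  tangent spaces of the projective varieties.  The Frechet derivatives of the polynomials
  involved are complex linear.\<close>

definition tangent_quadric :: "M2 \<Rightarrow> M2 set" where
  "tangent_quadric B = {X. frechet_derivative det (at B) X = 0}"

definition tangent_curve :: "(M2 \<Rightarrow> complex) \<Rightarrow> M2 \<Rightarrow> M2 set" where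
  "tangent_curve f B = {X \<in> tangent_quadric B. frechet_derivative f (at B) X = 0}"

text \<open>Smoothness of the curve as the divisor cut out by \<open>f\<close> on the quadric: the differential of
  \<open>f\<close> restricted to the quadric vanishes at no point of the curve.  In particular \<open>f\<close> does not
  vanish identically on the quadric and multiple components are excluded.\<close>

definition smooth_curve :: "(M2 \<Rightarrow> complex) \<Rightarrow> bool" where
  "smooth_curve f \<longleftrightarrow>
     (\<forall>B. B \<noteq> 0 \<and> det B = 0 \<and> f B = 0 \<longrightarrow>
        (\<exists>X\<in>tangent_quadric B. frechet_derivative f (at B) X \<noteq> 0))"

definition transverse_curves :: "(M2 \<Rightarrow> complex) \<Rightarrow> (M2 \<Rightarrow> complex) \<Rightarrow> bool" where
  "transverse_curves f g \<longleftrightarrow>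
     (\<forall>B. B \<noteq> 0 \<and> det B = 0 \<and> f B = 0 \<and> g B = 0 \<longrightarrow>
        {X + Y |X Y. X \<in> tangent_curve f B \<and> Y \<in> tangent_curve g B} = tangent_quadric B)"

section \<open>The maps \<open>\<psi>\<close>, \<open>\<sigma>\<close> and \<open>\<kappa>\<close>\<close>

text \<open>Maps on classes are defined through chosen representatives; the lemmas following the
  definitions show that the choice does not matter.\<close>

definition psi :: "real \<times> rp7 \<Rightarrow> cp3" where
  "psi = (\<lambda>(\<alpha>, s). let B = rep_rp7 s in
     cclass (exp \<alpha> *\<^sub>R B + exp (- \<alpha>) *\<^sub>R conj_transpose_adj B))"

definition sigma :: "(M2 \<Rightarrow> complex) \<Rightarrow> (M2 \<Rightarrow> complex) \<Rightarrow> cp3 \<Rightarrow> rp7" where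
  "sigma f g p = (let B = rep_cp3 p in rclass (cscale (csqrt (f B / g B)) B))"

text \<open>The unitary part \<open>kappa p\<close> is regarded as a point of complex projective space, via the
  inclusion of \<open>PSU(2)\<close>.\<close>

definition kappa :: "cp3 \<Rightarrow> cp3" where
  "kappa p = (let A = (SOME A. det A = 1 \<and> cclass A = p) in cclass (A + conj_transpose_adj A))"

lemma conj_transpose_adj_involution: "conj_transpose_adj (conj_transpose_adj A) = A"
  by (simp add: conj_transpose_adj_def conj_transpose_def adjugate_def map_matrix_def
      transpose_def vec_eq_iff forall_2)

lemma conj_transpose_adj_eq_0 [simp]: "conj_transpose_adj A = 0 \<longleftrightarrow> A = 0"
  by (auto simp: conj_transpose_adj_def conj_transpose_def adjugate_def map_matrix_def
      transpose_def vec_eq_iff forall_2)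

lemma psi_arg_nonzero:
  assumes "0 < \<alpha>" "B \<noteq> 0"
  shows "exp \<alpha> *\<^sub>R B + exp (- \<alpha>) *\<^sub>R conj_transpose_adj B \<noteq> 0" (is "?A \<noteq> 0")
proof
  have adj_lin: "conj_transpose_adj (a *\<^sub>R X) = a *\<^sub>R conj_transpose_adj X" for a :: real and X
    using antilinear_conj_transpose_adj[of "of_real a" X] by (simp add: cscale_of_real)
  assume z: "?A = 0"
  have "exp (2 * \<alpha>) *\<^sub>R B = exp \<alpha> *\<^sub>R (exp \<alpha> *\<^sub>R B)"
    by (simp flip: exp_add)
  also have "exp \<alpha> *\<^sub>R B = - (exp (- \<alpha>) *\<^sub>R conj_transpose_adj B)"
    using z by (simp add: eq_neg_iff_add_eq_0)
  also have "exp \<alpha> *\<^sub>R - (exp (- \<alpha>) *\<^sub>R conj_transpose_adj B) = - conj_transpose_adj B"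
    by (simp flip: exp_add)
  finally have 1: "conj_transpose_adj B = (- exp (2 * \<alpha>)) *\<^sub>R B"
    by simp
  then have "B = (exp (2 * \<alpha>) * exp (2 * \<alpha>)) *\<^sub>R B"
    using conj_transpose_adj_involution[of B] by (simp add: adj_lin del: scaleR_minus_left)
  then have "(exp (2 * \<alpha>) * exp (2 * \<alpha>) - 1) *\<^sub>R B = 0"
    by (simp add: scaleR_diff_left)
  then have "exp (4 * \<alpha>) = 1"
    using assms(2) by (simp flip: exp_add)
  then show False using assms(1) by simp
qed

lemma psi_rclass:
  assumes "0 < \<alpha>" "B \<noteq> 0"
  shows "psi (\<alpha>, rclass B) = cclass (exp \<alpha> *\<^sub>R B + exp (- \<alpha>) *\<^sub>R conj_transpose_adj B)"
proof -
  obtain r where r: "r \<noteq> 0" "rep_rp7 (rclass B) = r *\<^sub>R B"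
    using rep_rclass[OF assms(2)] .
  have adj: "conj_transpose_adj (r *\<^sub>R B) = r *\<^sub>R conj_transpose_adj B"
    using antilinear_conj_transpose_adj[of "of_real r" B] by (simp add: cscale_of_real)
  let ?X = "exp \<alpha> *\<^sub>R B + exp (- \<alpha>) *\<^sub>R conj_transpose_adj B"
  have "psi (\<alpha>, rclass B) = cclass (cscale (of_real r) ?X)"
    unfolding cscale_of_real by (simp add: psi_def r adj scaleR_add_right mult.commute)
  also have "\<dots> = cclass ?X"
    using r psi_arg_nonzero[OF assms]
    by (subst eq_commute, subst cclass_eq_iff) (auto intro!: exI[of _ "of_real r"])
  finally show ?thesis .
qed

lemma sigma_cclass:
  assumes "homogeneous_poly m f" "homogeneous_poly (m + 2) g"
    and "B \<noteq> 0" "f B \<noteq> 0" "g B \<noteq> 0" "w\<^sup>2 = f B / g B"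
  shows "sigma f g (cclass B) = rclass (cscale w B)"
proof -
  obtain c where c: "c \<noteq> 0" "rep_cp3 (cclass B) = cscale c B"
    using rep_cclass[OF assms(3)] .
  define v where "v = csqrt (f (cscale c B) / g (cscale c B))"
  have "f (cscale c B) / g (cscale c B) = w\<^sup>2 / c\<^sup>2"
    using c assms(6) homogeneous_poly_cscale[OF assms(1), of c B]
      homogeneous_poly_cscale[OF assms(2), of c B]
    by (simp add: power2_eq_square)
  then have "v\<^sup>2 = w\<^sup>2 / c\<^sup>2"
    unfolding v_def by simp
  then have "(v * c)\<^sup>2 = w\<^sup>2"
    using c by (simp add: power_mult_distrib)
  then have "v * c = w \<or> v * c = - w"
    by (simp add: power2_eq_iff)
  moreover have "w \<noteq> 0"
    using assms by auto
  moreover have "cscale (- w) B = (- 1) *\<^sub>R cscale w B"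
    by (simp add: vec_eq_iff)
  ultimately have "rclass (cscale (v * c) B) = rclass (cscale w B)"
    using assms(3) by (auto simp: rclass_eq_iff intro!: exI[of _ "- 1::real"])
  then show ?thesis
    by (simp add: sigma_def c v_def)
qed

lemma kappa_cclass:
  assumes "det A = 1"
  shows "kappa (cclass A) = cclass (A + conj_transpose_adj A)"
proof -
  define A' where "A' = (SOME X. det X = 1 \<and> cclass X = cclass A)"
  have A': "det A' = 1" "cclass A' = cclass A"
    using someI[of "\<lambda>X. det X = 1 \<and> cclass X = cclass A" A] assms by (auto simp: A'_def)
  have nz: "A \<noteq> 0" "A' \<noteq> 0"
    using assms A'(1) by (auto simp: det_2)
  then obtain c where c: "c \<noteq> 0" "A' = cscale c A"
    using cclass_eq_iff[of A A'] A'(2) by auto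
  have "c\<^sup>2 = 1"
    using A'(1) assms by (simp add: c det_cscale)
  then have "c = 1 \<or> c = - 1"
    by (simp add: power2_eq_1_iff)
  then have "A' + conj_transpose_adj A' = cscale c (A + conj_transpose_adj A)"
    by (auto simp: c antilinear_conj_transpose_adj cscale_add)
  moreover have "A + conj_transpose_adj A \<noteq> 0"
  proof
    assume z: "A + conj_transpose_adj A = 0"
    have "(A + conj_transpose_adj A) $ 1 $ 1 = A$1$1 + cnj (A$2$2)"
      and "(A + conj_transpose_adj A) $ 1 $ 2 = A$1$2 - cnj (A$2$1)"
      by (simp_all add: conj_transpose_adj_def conj_transpose_def adjugate_def map_matrix_def
          transpose_def)
    then have e: "A$1$1 = - cnj (A$2$2)" "A$1$2 = cnj (A$2$1)"
      unfolding z by (simp_all add: eq_neg_iff_add_eq_0)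
    have "1 = Re (det A)"
      using assms by simp
    also have "\<dots> = - ((cmod (A$2$2))\<^sup>2) - (cmod (A$2$1))\<^sup>2"
      by (simp add: det_2 e cmod_power2) (simp add: power2_eq_square)
    also have "\<dots> \<le> 0"
      by (smt (verit) zero_le_power2)
    finally show False by simp
  qed
  ultimately have "cclass (A' + conj_transpose_adj A') = cclass (A + conj_transpose_adj A)"
    using c by (subst eq_commute, subst cclass_eq_iff) auto
  then show ?thesis
    by (simp add: kappa_def A'_def)
qed

section \<open>Primitive diagrams\<close>

text \<open>A diagram of degree \<open>d\<close> has \<open>d div 2\<close> critical levels \<open>\<gamma> 1 < \<gamma> 2 < \<dots>\<close>; only the values
  \<open>\<gamma> j\<close> with \<open>1 \<le> j \<le> d div 2\<close> and \<open>f m\<close> with \<open>m \<le> d\<close>, \<open>m \<equiv> d\<close> modulo 2, are used.\<close>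

definition degrees :: "nat \<Rightarrow> nat set" where
  "degrees d = {m. m \<le> d \<and> m mod 2 = d mod 2}"

definition deg_at :: "nat \<Rightarrow> nat \<Rightarrow> nat" where
  "deg_at d j = 2 * j + d mod 2"

definition level :: "nat \<Rightarrow> (nat \<Rightarrow> real) \<Rightarrow> nat \<Rightarrow> ereal" where
  "level d \<gamma> j = (if j \<le> d div 2 then ereal (\<gamma> j) else \<infinity>)"

definition primitive_data :: "nat \<Rightarrow> (nat \<Rightarrow> real) \<Rightarrow> (nat \<Rightarrow> M2 \<Rightarrow> complex) \<Rightarrow> bool" where
  "primitive_data d \<gamma> f \<longleftrightarrow>
     (\<forall>j\<in>{1..d div 2}. 0 < \<gamma> j) \<and>
     strict_mono_on {1..d div 2} \<gamma> \<and>
     (\<forall>m\<in>degrees d. homogeneous_poly m (f m)) \<and>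
     (even d \<longrightarrow> (\<forall>A. f 0 A \<noteq> 0)) \<and>
     (\<forall>m\<in>degrees d. smooth_curve (f m)) \<and>
     (\<forall>m. m \<in> degrees d \<and> m + 2 \<in> degrees d \<longrightarrow> transverse_curves (f m) (f (m + 2)))"

definition vertical_part :: "nat \<Rightarrow> (nat \<Rightarrow> real) \<Rightarrow> (nat \<Rightarrow> M2 \<Rightarrow> complex) \<Rightarrow> (real \<times> rp7) set" where
  "vertical_part d \<gamma> f =
     (\<Union>j\<in>{1..d div 2}. {\<alpha>. level d \<gamma> j < ereal \<alpha> \<and> ereal \<alpha> < level d \<gamma> (j + 1)}
        \<times> bundle_over (curve (f (deg_at d j))))"

definition horizontal_part :: "nat \<Rightarrow> (nat \<Rightarrow> real) \<Rightarrow> (nat \<Rightarrow> M2 \<Rightarrow> complex) \<Rightarrow> (real \<times> rp7) set" where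
  "horizontal_part d \<gamma> f =
     (\<Union>j\<in>{1..d div 2}. {\<gamma> j}
        \<times> sigma (f (deg_at d (j - 1))) (f (deg_at d j)) `
            (quadric - (curve (f (deg_at d (j - 1))) \<union> curve (f (deg_at d j)))))"

definition bottom_part :: "nat \<Rightarrow> (nat \<Rightarrow> real) \<Rightarrow> (nat \<Rightarrow> M2 \<Rightarrow> complex) \<Rightarrow> (real \<times> rp7) set" where
  "bottom_part d \<gamma> f =
     {\<alpha>. 0 < \<alpha> \<and> ereal \<alpha> < level d \<gamma> 1} \<times> bundle_over (curve (f 1))"

definition coamoeba :: "(M2 \<Rightarrow> complex) \<Rightarrow> cp3 set" where
  "coamoeba f = kappa ` (plane_section f \<inter> PSL2)"

definition open_diagram :: "nat \<Rightarrow> (nat \<Rightarrow> real) \<Rightarrow> (nat \<Rightarrow> M2 \<Rightarrow> complex) \<Rightarrow> cp3 set" where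
  "open_diagram d \<gamma> f =
     psi ` (vertical_part d \<gamma> f \<union> horizontal_part d \<gamma> f) \<union>
     (if odd d then psi ` bottom_part d \<gamma> f \<union> coamoeba (f 1) else {})"

definition primitive_diagram :: "nat \<Rightarrow> (nat \<Rightarrow> real) \<Rightarrow> (nat \<Rightarrow> M2 \<Rightarrow> complex) \<Rightarrow> cp3 set" where
  "primitive_diagram d \<gamma> f = closure (open_diagram d \<gamma> f)"

section \<open>Real structures and surfaces\<close>

text \<open>A real structure is given by its antilinear lift \<open>J\<close>.  The lifts \<open>entry_conj\<close>,
  \<open>conj_transpose_adj\<close> and \<open>conj_transpose\<close> are those with real quadric a torus, empty, and a
  sphere, respectively.\<close>

definition involution_of :: "(M2 \<Rightarrow> M2) \<Rightarrow> cp3 \<Rightarrow> cp3" where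
  "involution_of J p = cclass (J (rep_cp3 p))"

lemma involution_of_cclass:
  assumes "J \<in> {entry_conj, conj_transpose_adj, conj_transpose}" "A \<noteq> 0"
  shows "involution_of J (cclass A) = cclass (J A)"
proof -
  obtain c where c: "c \<noteq> 0" "rep_cp3 (cclass A) = cscale c A"
    using rep_cclass[OF assms(2)] .
  have J: "J (cscale c A) = cscale (cnj c) (J A)"
    using assms(1) antilinear_entry_conj antilinear_conj_transpose_adj antilinear_conj_transpose
    by auto
  have "entry_conj A \<noteq> 0" "conj_transpose A \<noteq> 0"
    using assms(2) by (auto simp: entry_conj_def conj_transpose_def map_matrix_def transpose_def
        vec_eq_iff)
  then have "J A \<noteq> 0"
    using assms by auto
  then have "cclass (J A) = cclass (cscale (cnj c) (J A))"
    using c by (subst cclass_eq_iff) auto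
  then show ?thesis
    by (simp add: involution_of_def c J)
qed

definition fixed_locus :: "(M2 \<Rightarrow> M2) \<Rightarrow> cp3 set" where
  "fixed_locus J = {p. involution_of J p = p}"

definition real_data :: "(M2 \<Rightarrow> M2) \<Rightarrow> nat \<Rightarrow> (nat \<Rightarrow> M2 \<Rightarrow> complex) \<Rightarrow> bool" where
  "real_data J d f \<longleftrightarrow> (\<forall>m\<in>degrees d. \<forall>A. cnj (f m (J A)) = f m A)"

definition topological_surface :: "'a topology \<Rightarrow> bool" where
  "topological_surface X \<longleftrightarrow>
     Hausdorff_space X \<and> second_countable X \<and>
     (\<forall>x\<in>topspace X. \<exists>U. openin X U \<and> x \<in> U \<and>
        (\<exists>V::(real^2) set. open V \<and> subtopology X U homeomorphic_space top_of_set V))"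

end

theory Submission
  imports Defs
begin

text \<open>Write \<open>\<tau>\<close> for \<open>conj_transpose_adj\<close>. With \<open>s = exp (- 2 \<alpha>)\<close> the map \<open>\<psi>\<close> becomes \<open>(s, B) \<mapsto> [B + s \<tau> B]\<close> and extends
  to \<open>0 \<le> s \<le> 1\<close>, so the closure of the open diagram is the image of a compact set: the vertical
  pieces are closed up by one-parameter limits, and the coamoeba lies in the limit at \<open>s = 1\<close>.

  The real locus is the projectivisation of the 4-dimensional real space \<open>V\<close> fixed by \<open>J\<close>. A
  non-unitary real point is \<open>[B + u \<tau> B]\<close> with \<open>B \<in> V\<close> singular and \<open>-1 < u < 1\<close>, where the sign of
  \<open>u\<close> distinguishes real from imaginary representatives. In the coordinates \<open>u\<close>, \<open>x = f\<^sub>m\<^sub>-\<^sub>2(B)\<close>,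
  \<open>y = f\<^sub>m(B)\<close> the diagram near a critical level is the union of the quadrants \<open>x y \<ge> 0\<close> of the
  level with a half-plane of \<open>y = 0\<close> on one side and one of \<open>x = 0\<close> on the other; the link of the
  origin is a single circle, so this is a surface. Unitary points occur only for odd degree.
  Decompose \<open>V\<close> into the eigenspaces of \<open>\<tau>\<close> and let \<open>m\<close>, \<open>n\<close> be the components there of the real
  linear form \<open>f\<^sub>1\<close>; smoothness of \<open>C\<^sub>1\<close> means \<open>|m| \<noteq> |n|\<close>. Near such a point the diagram is the set
  \<open>|q| (m \<bullet> p) + |p| (n \<bullet> q) = 0\<close>, closed up by \<open>|n \<bullet> q| \<le> |m| |q|\<close> where \<open>p = 0\<close>. It is a graph
  where the last inequality is strict, and elliptic coordinates flatten it at the boundary.\<close>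

section \<open>Antiunitary involutions of the space of matrices\<close>

text \<open>Only limits with \<open>B\<close> fixed and \<open>s\<close> moving are ever computed.
  Over a point of a curve bounding a horizontal sheet the whole circle lies at the end of a vertical
  piece, so a closed condition on pairs \<open>(s, B)\<close> can be written down and both
  inclusions checked without taking limits along a sheet. The coamoeba enters at
  \<open>s = 1\<close> through a dimension count.

  At a unitary matrix \<open>B\<close> is no longer determined and the coordinates used elsewhere
  collapse. The inequality there is the Cauchy-Schwarz criterion for a \<open>p\<close> in the
  opposite eigenspace with \<open>m \<bullet> p = - (n \<bullet> q)\<close> and
  \<open>|p| \<le> |q|\<close>. At its boundary normalise \<open>|q| = 1\<close>: the equation makes
  \<open>- (n \<bullet> q) / |m|\<close> the cosine of the angle between \<open>p\<close> and
  \<open>m\<close>, so if \<open>p\<close> varies in a plane, the circle of its directions is folded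
  onto a segment as \<open>p\<close> tends to 0. Elliptic coordinates fold an ellipse onto the
  segment between its foci in the same way.\<close>

abbreviation tau :: "M2 \<Rightarrow> M2" where "tau \<equiv> conj_transpose_adj"

text \<open>Common interface of \<open>tau\<close> and of the three lifts \<open>J\<close>, so that
  the same lemmas on eigenspaces serve the polar decomposition and the real structure. The inner
  product is the real one in dimension 8.\<close>

locale antiunitary =
  fixes K :: "M2 \<Rightarrow> M2"
  assumes add: "K (A + B) = K A + K B"
    and antilinear: "K (cscale c A) = cscale (cnj c) (K A)"
    and invol [simp]: "K (K A) = A"
    and inner [simp]: "K A \<bullet> K B = A \<bullet> B"
begin

lemma scaleR: "K (r *\<^sub>R A) = r *\<^sub>R K A"
  using antilinear[of "of_real r" A] by (simp add: cscale_of_real)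

lemma linear: "linear K"
  by (rule linearI) (simp_all add: add scaleR)

lemma zero [simp]: "K 0 = 0"
  using linear linear_0 by blast

lemma diff: "K (A - B) = K A - K B"
  using linear linear_diff by blast

lemma minus: "K (- A) = - K A"
  using linear linear_neg by blast

lemma norm [simp]: "norm (K A) = norm A"
  by (simp add: norm_eq_sqrt_inner)

lemma eq_0 [simp]: "K A = 0 \<longleftrightarrow> A = 0"
  using norm[of A] by (metis norm_eq_zero)

lemma inner_flip: "K A \<bullet> B = A \<bullet> K B"
  by (metis invol inner)

lemma continuous [continuous_intros]: "continuous_on S g \<Longrightarrow> continuous_on S (\<lambda>x. K (g x))"
  using linear by (simp add: linear_conv_bounded_linear bounded_linear.continuous_on)

end

lemma inner_M2: "(A::M2) \<bullet> B = A$1$1 \<bullet> B$1$1 + A$1$2 \<bullet> B$1$2 + (A$2$1 \<bullet> B$2$1 + A$2$2 \<bullet> B$2$2)"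
  by (simp add: inner_vec_def sum_2)

lemma tau_nth [simp]:
  "tau A $ 1 $ 1 = cnj (A$2$2)" "tau A $ 1 $ 2 = - cnj (A$2$1)"
  "tau A $ 2 $ 1 = - cnj (A$1$2)" "tau A $ 2 $ 2 = cnj (A$1$1)"
  by (simp_all add: conj_transpose_adj_def conj_transpose_def adjugate_def map_matrix_def
      transpose_def)

lemma entry_conj_nth [simp]: "entry_conj A $ i $ j = cnj (A$i$j)"
  by (simp add: entry_conj_def map_matrix_def)

lemma conj_transpose_nth [simp]: "conj_transpose A $ i $ j = cnj (A$j$i)"
  by (simp add: conj_transpose_def map_matrix_def transpose_def)

lemma M2_eq_iff: "(A::M2) = B \<longleftrightarrow> A$1$1 = B$1$1 \<and> A$1$2 = B$1$2 \<and> A$2$1 = B$2$1 \<and> A$2$2 = B$2$2"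
  by (auto simp: vec_eq_iff forall_2)

interpretation tau: antiunitary tau
  by unfold_locales (auto simp: M2_eq_iff inner_M2 inner_complex_def)

lemma antiunitary_entry_conj: "antiunitary entry_conj"
  by unfold_locales (auto simp: M2_eq_iff inner_M2 inner_complex_def)

lemma antiunitary_conj_transpose: "antiunitary conj_transpose"
  by unfold_locales (auto simp: M2_eq_iff inner_M2 inner_complex_def)

section \<open>Complex scaling, the real inner product and the determinant\<close>

lemma cscale_uminus: "cscale c (- A) = - cscale c A"
  by (simp add: M2_eq_iff)

lemma cscale_diff: "cscale c (A - B) = cscale c A - cscale c B"
  by (simp add: M2_eq_iff algebra_simps)

lemma cscale_scaleR: "cscale c (r *\<^sub>R A) = r *\<^sub>R cscale c A"
  by (simp add: M2_eq_iff)

lemma cscale_minus1 [simp]: "cscale (- 1) A = - A"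
  by (simp add: M2_eq_iff)

lemma norm_cscale: "norm (cscale c A) = cmod c * norm A"
proof -
  have "(norm (cscale c A))\<^sup>2 = (cmod c * norm A)\<^sup>2"
    unfolding power_mult_distrib power2_norm_eq_inner cmod_power2
    by (simp add: inner_M2 inner_complex_def algebra_simps power2_eq_square)
  then show ?thesis
    by (simp add: power2_eq_iff_nonneg)
qed

lemma inner_ii: "cscale \<i> A \<bullet> cscale \<i> B = A \<bullet> B"
  by (simp add: inner_M2 inner_complex_def)

lemma inner_ii_flip: "cscale \<i> A \<bullet> B = - (A \<bullet> cscale \<i> B)"
  by (simp add: inner_M2 inner_complex_def)

lemma inner_ii_self [simp]: "A \<bullet> cscale \<i> A = 0"
  by (simp add: inner_M2 inner_complex_def)

lemma linear_cscale: "linear (cscale c)"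
  by (rule linearI) (simp_all add: cscale_add cscale_scaleR)

text \<open>Polar form of the determinant: \<open>A\<close> is singular if and only if it is
  orthogonal to \<open>tau A\<close> and to \<open>cscale \<i> (tau A)\<close>. Through this the
  geometry of the quadric is read off from \<open>tau\<close>.\<close>

lemma Re_det: "Re (det A) = (A \<bullet> tau A) / 2"
  by (simp add: det_2 inner_M2 inner_complex_def algebra_simps)

lemma Im_det: "Im (det A) = (A \<bullet> cscale \<i> (tau A)) / 2"
  by (simp add: det_2 inner_M2 inner_complex_def algebra_simps)

lemma det_tau: "det (tau A) = cnj (det A)"
  by (simp add: det_2)

lemma continuous_on_det2 [continuous_intros]:
  fixes g :: "'a::topological_space \<Rightarrow> M2"
  shows "continuous_on S g \<Longrightarrow> continuous_on S (\<lambda>x. det (g x))"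
  unfolding det_2 by (intro continuous_intros)

text \<open>By antilinearity, multiplication by i carries the eigenspace of 1 onto that of -1; the
  two are orthogonal complements in dimension 8.\<close>

lemma dim_fixed:
  assumes "antiunitary K" shows "dim {A. K A = A} = 4"
proof -
  interpret antiunitary K by fact
  let ?P = "{A. K A = A}" and ?N = "{A. K A = - A}"
  have P: "subspace ?P" and N: "subspace ?N"
    by (auto simp: subspace_def add scaleR)
  have "{y \<in> UNIV. \<forall>x\<in>?P. orthogonal x y} = ?N"
  proof (intro set_eqI iffI; clarsimp)
    fix y assume "\<forall>x. K x = x \<longrightarrow> orthogonal x y"
    then have "(y + K y) \<bullet> y = 0"
      by (auto simp: orthogonal_def add add.commute)
    then have "(y + K y) \<bullet> (y + K y) = 0"
      by (simp add: inner_add_left inner_add_right inner_flip inner_commute)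
    then show "K y = - y"
      by (metis add_eq_0_iff inner_eq_zero_iff)
  next
    fix y x assume "K y = - y" "K x = x"
    then show "orthogonal x y"
      using inner[of x y] by (simp add: orthogonal_def)
  qed
  then have "dim ?N + dim ?P = dim (UNIV :: M2 set)"
    using dim_subspace_orthogonal_to_vectors[OF P, of UNIV] by simp
  moreover have "dim ?N = dim ?P"
  proof -
    have "inj (cscale \<i>)"
      by (rule injI) (auto simp: M2_eq_iff)
    moreover have "?N = cscale \<i> ` ?P"
    proof (intro set_eqI iffI)
      fix A assume "A \<in> ?N"
      then have "A = cscale \<i> (- cscale \<i> A)" "K (- cscale \<i> A) = - cscale \<i> A"
        by (auto simp: cscale_uminus minus antilinear M2_eq_iff)
      then show "A \<in> cscale \<i> ` ?P" by blast
    qed (auto simp: antilinear M2_eq_iff)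
    ultimately show ?thesis
      using dim_image_eq[OF linear_cscale, of \<i> ?P] by (simp add: inj_on_subset)
  qed
  ultimately show ?thesis
    by simp
qed

lemma orthonormal_extend:
  fixes V :: "'a::euclidean_space set"
  assumes "subspace V" "finite C" "card C < dim V" "C \<subseteq> V"
  obtains e where "e \<in> V" "norm e = 1" "\<And>c. c \<in> C \<Longrightarrow> e \<bullet> c = 0"
proof -
  have "dim C < dim V"
    using assms dim_le_card'[of C] by linarith
  have "span C \<subseteq> span V" by (simp add: assms(4) span_mono)
  moreover have "span C \<noteq> span V"
    using \<open>dim C < dim V\<close> by (metis dim_span less_irrefl)
  ultimately have "span C \<subset> span V" by blast
  then obtain x where x: "x \<noteq> 0" "x \<in> span V" "\<And>y. y \<in> span C \<Longrightarrow> orthogonal x y"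
    using orthogonal_to_subspace_exists_gen by metis
  show ?thesis
  proof (rule that[of "x /\<^sub>R norm x"])
    show "x /\<^sub>R norm x \<in> V"
      using x(2) assms(1) by (metis span_eq_iff subspace_scale)
    show "norm (x /\<^sub>R norm x) = 1" using x(1) by simp
    show "(x /\<^sub>R norm x) \<bullet> c = 0" if "c \<in> C" for c
      using x(3)[of c] that by (simp add: span_base orthogonal_def)
  qed
qed

lemma orthonormal_expand:
  fixes V :: "'a::euclidean_space set"
  assumes "subspace V" "dim V = 4" "{a,b,c,e} \<subseteq> V"
    and "norm a = 1" "norm b = 1" "norm c = 1" "norm e = 1"
    and "a \<bullet> b = 0" "a \<bullet> c = 0" "a \<bullet> e = 0" "b \<bullet> c = 0" "b \<bullet> e = 0" "c \<bullet> e = 0"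
    and "X \<in> V"
  shows "X = (X \<bullet> a) *\<^sub>R a + (X \<bullet> b) *\<^sub>R b + (X \<bullet> c) *\<^sub>R c + (X \<bullet> e) *\<^sub>R e"
proof (rule ccontr)
  define Y where "Y = X - ((X \<bullet> a) *\<^sub>R a + (X \<bullet> b) *\<^sub>R b + (X \<bullet> c) *\<^sub>R c + (X \<bullet> e) *\<^sub>R e)"
  assume "X \<noteq> (X \<bullet> a) *\<^sub>R a + (X \<bullet> b) *\<^sub>R b + (X \<bullet> c) *\<^sub>R c + (X \<bullet> e) *\<^sub>R e"
  then have Y0: "Y \<noteq> 0" by (simp add: Y_def)
  have n: "a \<bullet> a = 1" "b \<bullet> b = 1" "c \<bullet> c = 1" "e \<bullet> e = 1"
    using assms by (simp_all add: norm_eq_1)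
  have Y: "Y \<bullet> a = 0" "Y \<bullet> b = 0" "Y \<bullet> c = 0" "Y \<bullet> e = 0"
    using assms n by (simp_all add: Y_def inner_diff_left inner_add_left inner_commute[of b a]
        inner_commute[of c a] inner_commute[of e a] inner_commute[of c b] inner_commute[of e b]
        inner_commute[of e c])
  let ?S = "{a,b,c,e,Y}"
  have ne: "a \<noteq> b" "a \<noteq> c" "a \<noteq> e" "b \<noteq> c" "b \<noteq> e" "c \<noteq> e" "Y \<notin> {a,b,c,e}"
    using assms n Y Y0 by auto
  have "pairwise orthogonal ?S"
    using assms Y by (auto simp: pairwise_def orthogonal_def inner_commute)
  moreover have "0 \<notin> ?S" using assms Y0 by auto
  ultimately have "independent ?S"
    by (rule pairwise_orthogonal_independent)
  moreover have "Y \<in> V"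
    unfolding Y_def using assms by (intro subspace_diff subspace_add subspace_scale) auto
  then have "?S \<subseteq> V" using assms by auto
  ultimately have "card ?S \<le> dim V"
    by (rule independent_card_le_dim[rotated])
  moreover have "card ?S = 5"
    using ne by auto
  ultimately show False using assms by simp
qed

text \<open>The matrices \<open>W + Y\<close> with \<open>tau Y = - Y\<close> form a 4-dimensional
  family, in which \<open>Im (det (W + Y))\<close> and \<open>g\<close> impose three real affine
  conditions. A direction \<open>Z\<close> in their common kernel remains; moving along it until
  \<open>Y\<close> has the norm of \<open>W\<close> makes the real part of the determinant vanish
  too.\<close>

lemma fibre_of_unitary_part:
  assumes W: "tau W = W" and Y: "tau Y = - Y" and le: "norm Y \<le> norm W"
    and Im: "Im (det (W + Y)) = 0" and g: "linear g" "g (W + Y) = (0::complex)"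
  obtains B where "det B = 0" "g B = 0" "B + tau B = 2 *\<^sub>R W"
proof -
  define r1 where "r1 = adjoint (\<lambda>X. Re (g X)) 1"
  define r2 where "r2 = adjoint (\<lambda>X. Im (g X)) 1"
  have "linear (\<lambda>X. Re (g X))" "linear (\<lambda>X. Im (g X))"
    using g(1) by (auto simp: linear_iff)
  then have r: "X \<bullet> r1 = Re (g X)" "X \<bullet> r2 = Im (g X)" for X
    unfolding r1_def r2_def by (simp_all add: adjoint_works)
  let ?P = "{A. tau A = A}"
  have dP: "dim ?P = 4" using dim_fixed[OF tau.antiunitary_axioms] .
  obtain S where S: "S \<subseteq> ?P" "card S = 4" "?P \<subseteq> span S" "independent S"
    using basis_exists[of ?P] dP by (metis (no_types, lifting))
  \<comment> \<open>Orthogonality to the four vectors of \<open>S\<close> forces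
    \<open>tau Z = - Z\<close>; with the three gradients this makes at most 7 conditions in
    dimension 8.\<close>
  have "card (S \<union> {cscale \<i> W, r1, r2}) \<le> 7"
  proof -
    have "card {cscale \<i> W, r1, r2} \<le> 3"
      by (simp add: card_insert_if)
    then show ?thesis
      using S(2) card_Un_le[of S "{cscale \<i> W, r1, r2}"] by linarith
  qed
  moreover have "finite (S \<union> {cscale \<i> W, r1, r2})"
    using S by (simp add: independent_imp_finite)
  ultimately obtain Z where Z: "norm Z = 1" "\<And>c. c \<in> S \<union> {cscale \<i> W, r1, r2} \<Longrightarrow> Z \<bullet> c = 0"
    using orthonormal_extend[of "UNIV :: M2 set" "S \<union> {cscale \<i> W, r1, r2}"]
    by (auto simp: dim_UNIV)
  have "Z \<bullet> x = 0" if "tau x = x" for x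
  proof -
    have "x \<in> span S" using that S by auto
    then show ?thesis
      using Z(2) orthogonal_to_span[of x S Z] by (auto simp: orthogonal_def)
  qed
  then have "Z \<bullet> (Z + tau Z) = 0" by (simp add: tau.add add.commute)
  then have "(Z + tau Z) \<bullet> (Z + tau Z) = 0"
    by (simp add: inner_add_left inner_add_right tau.inner_flip inner_commute)
  then have tZ: "tau Z = - Z" by (simp add: add_eq_0_iff)
  have gZ: "g Z = 0" using Z(2)[of r1] Z(2)[of r2] r[of Z] by (simp add: complex_eq_iff)
  \<comment> \<open>The endpoint suffices because \<open>norm Y \<le> norm W\<close>: the triangle
    inequality gives norm at least \<open>norm W + 1\<close> there.\<close>
  have "\<exists>t\<ge>0. t \<le> 2 * norm W + 1 \<and> norm (Y + t *\<^sub>R Z) = norm W"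
  proof (rule IVT')
    have "norm ((2 * norm W + 1) *\<^sub>R Z) = 2 * norm W + 1" using Z(1) by simp
    then show "norm W \<le> norm (Y + (2 * norm W + 1) *\<^sub>R Z)"
      using norm_diff_ineq[of "(2 * norm W + 1) *\<^sub>R Z" Y] le
      unfolding add.commute[of Y] by linarith
  qed (use le in \<open>auto intro!: continuous_intros\<close>)
  then obtain t where t: "norm (Y + t *\<^sub>R Z) = norm W" by blast
  define B where "B = W + (Y + t *\<^sub>R Z)"
  have tB: "tau B = W - (Y + t *\<^sub>R Z)"
    by (simp add: B_def tau.add tau.scaleR W Y tZ)
  have Im': "Im (det (W + X)) = X \<bullet> cscale \<i> W" if "tau X = - X" for X
  proof -
    have "(W + X) \<bullet> cscale \<i> (W - X) = 2 * (X \<bullet> cscale \<i> W)"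
      using inner_ii_flip[of X W] 
      by (simp add: cscale_diff inner_add_left inner_diff_right) (simp add: inner_commute)
    then show ?thesis
      by (simp add: Im_det tau.add W that)
  qed
  have "Im (det B) = 0"
    unfolding B_def using Im Im'[OF Y] Z(2)[of "cscale \<i> W"]
    by (subst Im') (auto simp: tau.add tau.scaleR Y tZ inner_add_left)
  moreover have "Re (det B) = 0"
  proof -
    have "(W + X) \<bullet> (W - X) = (norm W)\<^sup>2 - (norm X)\<^sup>2" for X
      by (simp add: power2_norm_eq_inner inner_add_left inner_diff_right inner_commute[of X W])
    then show ?thesis
      unfolding Re_det tB by (simp add: B_def t)
  qed
  ultimately have "det B = 0" by (simp add: complex_eq_iff)
  moreover have "g B = 0"
    using g gZ by (simp add: B_def linear_add linear_scale flip: add.assoc)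
  moreover have "B + tau B = 2 *\<^sub>R W"
    unfolding tB by (simp add: B_def scaleR_2)
  ultimately show ?thesis by (rule that)
qed

section \<open>The topology of complex projective space\<close>

lemma cclass_cscale: "c \<noteq> 0 \<Longrightarrow> A \<noteq> 0 \<Longrightarrow> cclass (cscale c A) = cclass A"
  by (subst eq_commute, subst cclass_eq_iff) auto

lemma cclass_scaleR: "r \<noteq> 0 \<Longrightarrow> A \<noteq> 0 \<Longrightarrow> cclass (r *\<^sub>R A) = cclass A"
  using cclass_cscale[of "of_real r" A] by (simp add: cscale_of_real)

lemma continuous_on_cclass:
  assumes "continuous_on S g" "\<And>x. x \<in> S \<Longrightarrow> g x \<noteq> 0"
  shows "continuous_on S (\<lambda>x. cclass (g x))"
proof -
  have "continuous_on (- {0}) cclass"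
  proof (subst continuous_on_open_vimage)
    show "\<forall>B. open B \<longrightarrow> open (cclass -` B \<inter> - {0})"
      by (auto simp: open_cp3_def vimage_def Int_def conj_commute)
  qed auto
  then show ?thesis
    by (rule continuous_on_compose2) (use assms in auto)
qed

text \<open>The orthogonal projector onto the line through \<open>A\<close>, with \<open>A\<close>
  read as a vector of complex 4-space. It embeds the projective space into a Euclidean space, which
  supplies Hausdorffness and second countability.\<close>

definition segre :: "cp3 \<Rightarrow> complex^2^2^2^2" where
  "segre p = (let A = rep_cp3 p in
     \<chi> i j k l. A$i$j * cnj (A$k$l) / of_real ((norm A)\<^sup>2))"

lemma segre_cclass:
  assumes "A \<noteq> 0"
  shows "segre (cclass A) = (\<chi> i j k l. A$i$j * cnj (A$k$l) / of_real ((norm A)\<^sup>2))"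
proof -
  obtain c where c: "c \<noteq> 0" "rep_cp3 (cclass A) = cscale c A"
    using rep_cclass[OF assms] .
  have "of_real ((cmod c)\<^sup>2) = c * cnj c"
    using complex_norm_square[of c] by simp
  then show ?thesis
    using c(1) unfolding segre_def Let_def c(2) norm_cscale
    by (simp add: vec_eq_iff power_mult_distrib)
qed

text \<open>Any nonzero column of the projector spans the line; an entry \<open>A$k$l\<close> that
  does not vanish selects such a column.\<close>

lemma inj_segre: "inj segre"
proof (rule injI)
  fix p q assume eq: "segre p = segre q"
  define A where "A = rep_cp3 p"
  define B where "B = rep_cp3 q"
  have nz: "A \<noteq> 0" "B \<noteq> 0" and pq: "p = cclass A" "q = cclass B"
    by (simp_all add: A_def B_def)
  define a where "a = complex_of_real ((norm A)\<^sup>2)"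
  define b where "b = complex_of_real ((norm B)\<^sup>2)"
  have ab: "a \<noteq> 0" "b \<noteq> 0" using nz by (auto simp: a_def b_def)
  have e: "A$i$j * cnj (A$k$l) / a = B$i$j * cnj (B$k$l) / b" for i j k l
    using eq nz unfolding pq by (simp add: segre_cclass vec_eq_iff a_def b_def)
  obtain k l where kl: "A$k$l \<noteq> 0"
    using nz(1) by (auto simp: vec_eq_iff)
  then have Bkl: "B$k$l \<noteq> 0"
    using e[of k l k l] ab by auto
  define c where "c = (cnj (A$k$l) / a) / (cnj (B$k$l) / b)"
  have "B = cscale c A"
    using e[of _ _ k l] ab kl Bkl by (simp add: vec_eq_iff c_def field_simps)
  moreover have "c \<noteq> 0"
    using ab kl Bkl by (simp add: c_def)
  ultimately show "p = q"
    unfolding pq using cclass_eq_iff[OF nz] by auto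
qed

lemma continuous_on_segre: "continuous_on S segre"
proof -
  have "continuous_on UNIV segre"
  proof (subst continuous_on_open_vimage)
    let ?f = "\<lambda>A::M2. (\<chi> i j k l. A$i$j * cnj (A$k$l) / of_real ((norm A)\<^sup>2)) :: complex^2^2^2^2"
    have c: "continuous_on (- {0}) ?f"
      by (intro continuous_intros) auto
    show "\<forall>U. open U \<longrightarrow> open (segre -` U \<inter> UNIV)"
    proof (intro allI impI)
      fix U :: "(complex^2^2^2^2) set" assume "open U"
      then have "open (?f -` U \<inter> - {0})"
        using c by (subst (asm) continuous_on_open_vimage) auto
      moreover have "{A. A \<noteq> 0 \<and> cclass A \<in> segre -` U} = ?f -` U \<inter> - {0}"
        by (auto simp: segre_cclass)
      ultimately show "open (segre -` U \<inter> UNIV)"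
        by (simp add: open_cp3_def)
    qed
  qed auto
  then show ?thesis by (rule continuous_on_subset) auto
qed

instance cp3 :: t2_space
proof
  fix x y :: cp3 assume "x \<noteq> y"
  then have "segre x \<noteq> segre y"
    using inj_segre by (auto dest: injD)
  then obtain U V where UV: "open U" "open V" "segre x \<in> U" "segre y \<in> V" "U \<inter> V = {}"
    using hausdorff by metis
  have "open (segre -` U)" "open (segre -` V)"
    using continuous_on_segre[of UNIV] UV by (auto simp: continuous_on_open_vimage)
  then show "\<exists>U V. open U \<and> open V \<and> x \<in> U \<and> y \<in> V \<and> U \<inter> V = {}"
    using UV by (intro exI[of _ "segre -` U"] exI[of _ "segre -` V"]) auto
qed

lemma Hausdorff_cp3: "Hausdorff_space (top_of_set (S :: cp3 set))"
proof (rule Hausdorff_space_subtopology)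
  show "Hausdorff_space (euclidean :: cp3 topology)"
    unfolding Hausdorff_space_def using hausdorff by (auto simp: disjnt_def)
qed

lemma cclass_unit:
  obtains A where "norm A = 1" "cclass A = p"
proof (rule that)
  show "norm (rep_cp3 p /\<^sub>R norm (rep_cp3 p)) = 1" by simp
  show "cclass (rep_cp3 p /\<^sub>R norm (rep_cp3 p)) = p" by (subst cclass_scaleR) auto
qed

lemma compact_cp3: "compact (UNIV :: cp3 set)"
proof -
  have "compact (cclass ` sphere 0 1)"
    by (intro compact_continuous_image continuous_on_cclass continuous_intros) auto
  moreover have "cclass ` sphere 0 1 = UNIV"
  proof (intro set_eqI iffI UNIV_I)
    fix p show "p \<in> cclass ` sphere 0 1"
      by (rule cclass_unit[of p]) auto
  qed
  ultimately show ?thesis by simp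
qed

lemma second_countable_cp3: "second_countable (top_of_set (S :: cp3 set))"
proof -
  obtain g where g: "homeomorphism UNIV (range segre) segre g"
    using homeomorphism_compact[OF compact_cp3 continuous_on_segre refl inj_segre] by metis
  have "(euclidean :: cp3 topology) homeomorphic_space top_of_set (range segre)"
    unfolding homeomorphic_space_def homeomorphic_maps_def
    using g by (intro exI[of _ segre] exI[of _ g])
      (auto simp: homeomorphism_def continuous_map_in_subtopology)
  moreover have "second_countable (euclidean :: (complex^2^2^2^2) topology)"
  proof -
    obtain \<B> :: "(complex^2^2^2^2) set set" where "countable \<B>" "topological_basis \<B>"
      using ex_countable_basis by blast
    moreover have "\<exists>Z\<in>\<B>. x \<in> Z \<and> Z \<subseteq> U" if "open U" "x \<in> U" for U x
      by (rule topological_basisE[OF \<open>topological_basis \<B>\<close> that]) blast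
    ultimately show ?thesis
      unfolding second_countable_def
    proof (intro exI[of _ \<B>] conjI ballI allI impI; (elim conjE)?)
      show "openin euclidean Z" if "Z \<in> \<B>" for Z
        using topological_basis_open[OF \<open>topological_basis \<B>\<close> that] by simp
    qed simp_all
  qed
  ultimately have "second_countable (euclidean :: cp3 topology)"
    by (simp add: homeomorphic_space_second_countability second_countable_subtopology)
  then show ?thesis by (rule second_countable_subtopology)
qed

section \<open>Charts on subsets of the fixed locus\<close>

locale real_structure = antiunitary J for J +
  assumes det_J: "det (J A) = cnj (det A)" and J_tau: "J (tau A) = tau (J A)"
begin

definition V :: "M2 set" where "V = {A. J A = A}"

lemma subspace_V: "subspace V"
  by (auto simp: V_def subspace_def add scaleR)

lemma closed_V: "closed V"
  by (simp add: closed_subspace subspace_V)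

lemma dim_V: "dim V = 4"
  unfolding V_def by (rule dim_fixed) (rule antiunitary_axioms)

lemma V_tau: "A \<in> V \<Longrightarrow> tau A \<in> V"
  by (simp add: V_def J_tau)

lemma V_scaleR: "A \<in> V \<Longrightarrow> r *\<^sub>R A \<in> V"
  by (simp add: V_def scaleR)

lemma V_add: "A \<in> V \<Longrightarrow> B \<in> V \<Longrightarrow> A + B \<in> V"
  by (simp add: V_def add)

lemma V_diff: "A \<in> V \<Longrightarrow> B \<in> V \<Longrightarrow> A - B \<in> V"
  by (simp add: V_def diff)

lemma Im_det_V: "A \<in> V \<Longrightarrow> Im (det A) = 0"
  using det_J[of A] by (simp add: V_def complex_eq_iff)

lemma det_V_eq_0: "A \<in> V \<Longrightarrow> det A = 0 \<longleftrightarrow> A \<bullet> tau A = 0"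
  by (simp add: complex_eq_iff Im_det_V Re_det)

lemma cclass_V_eq:
  assumes "A \<in> V" "B \<in> V" "A \<noteq> 0" "B \<noteq> 0" "cclass A = cclass B"
  obtains r where "r \<noteq> 0" "B = r *\<^sub>R A"
proof -
  obtain c where c: "c \<noteq> 0" "B = cscale c A"
    using assms cclass_eq_iff by blast
  have "cscale (cnj c) A = cscale c A"
    using assms(1,2) c by (auto simp: V_def antilinear)
  moreover obtain i j where "A$i$j \<noteq> 0"
    using assms(3) by (auto simp: vec_eq_iff)
  ultimately have "cnj c = c"
    by (auto simp: vec_eq_iff)
  then have "c = of_real (Re c)" by (simp add: complex_eq_iff)
  then show ?thesis
    using c cscale_of_real[of "Re c" A] by (intro that[of "Re c"]) auto
qed

lemma involution_of_class: "A \<noteq> 0 \<Longrightarrow> involution_of J (cclass A) = cclass (J A)"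
  by (rule rep_cclass[of A]) (auto simp: involution_of_def antilinear cclass_cscale)

text \<open>A fixed class only yields \<open>J A = cscale c A\<close>. Preservation of the norm
  forces \<open>cmod c = 1\<close>, and a square root \<open>w\<close> of \<open>c\<close> satisfies
  \<open>cnj w * c = w\<close>, so that \<open>cscale w A\<close> lies in \<open>V\<close>.\<close>

lemma fixed_locus_eq: "fixed_locus J = cclass ` (V - {0})"
proof (intro set_eqI iffI)
  fix p assume p: "p \<in> fixed_locus J"
  obtain A where A: "norm A = 1" "cclass A = p" using cclass_unit .
  then have nz: "A \<noteq> 0" by auto
  then have "cclass A = cclass (J A)"
    using p A by (auto simp: fixed_locus_def involution_of_class)
  then obtain c where c: "c \<noteq> 0" "J A = cscale c A"
    using cclass_eq_iff[of A "J A"] nz by auto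
  have "cmod c = 1"
    using norm[of A] c A by (simp add: norm_cscale)
  define w where "w = csqrt c"
  have w: "w\<^sup>2 = c" "cmod w = 1"
    using \<open>cmod c = 1\<close> by (simp_all add: w_def norm_csqrt)
  then have "cnj w * c = w"
    by (metis complex_norm_square mult.assoc mult.commute mult.right_neutral of_real_1 one_power2 power2_eq_square)
  then have "cscale w A \<in> V"
    by (simp add: V_def antilinear c)
  moreover have "w \<noteq> 0" using w by auto
  ultimately show "p \<in> cclass ` (V - {0})"
    using A nz by (intro image_eqI[of _ _ "cscale w A"]) (auto simp: cclass_cscale)
next
  fix p assume "p \<in> cclass ` (V - {0})"
  then obtain A where "J A = A" "A \<noteq> 0" "p = cclass A" by (auto simp: V_def)
  then show "p \<in> fixed_locus J" by (simp add: fixed_locus_def involution_of_class)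
qed

text \<open>The complement in the fixed locus is the image of a compact piece of the unit sphere,
  hence closed; invariance of \<open>C\<close> under scaling keeps the two images disjoint.\<close>

lemma openin_fixed_locus:
  assumes "openin (top_of_set V) C" "0 \<notin> C" "\<And>A r. A \<in> C \<Longrightarrow> r \<noteq> 0 \<Longrightarrow> r *\<^sub>R A \<in> C"
  shows "openin (top_of_set (fixed_locus J)) (cclass ` C)"
proof -
  obtain T where T: "open T" "C = V \<inter> T"
    using assms(1) by (auto simp: openin_open)
  let ?K = "sphere 0 1 \<inter> V - T"
  have "compact ?K"
    by (intro compact_diff compact_Int_closed closed_V T) auto
  then have "closed (cclass ` ?K)"
    by (intro compact_imp_closed compact_continuous_image continuous_on_cclass continuous_intros) auto
  moreover have "cclass ` C = fixed_locus J \<inter> - (cclass ` ?K)"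
  proof (intro set_eqI iffI)
    fix p assume "p \<in> cclass ` C"
    then obtain A where A: "A \<in> C" "p = cclass A" by blast
    then have "A \<in> V" "A \<noteq> 0" using T assms(2) by auto
    moreover have "p \<notin> cclass ` ?K"
    proof
      assume "p \<in> cclass ` ?K"
      then obtain B where that: "B \<in> ?K" "p = cclass B" by blast
      have "B \<in> V" "B \<noteq> 0" "cclass A = cclass B" using that A by auto
      then obtain r where "r \<noteq> 0" "B = r *\<^sub>R A"
        using cclass_V_eq[OF \<open>A \<in> V\<close> _ \<open>A \<noteq> 0\<close>] by blast
      then show False using assms(3)[OF A(1)] that T by auto
    qed
    ultimately show "p \<in> fixed_locus J \<inter> - (cclass ` ?K)"
      using A by (simp add: fixed_locus_eq)
  next
    fix p assume p: "p \<in> fixed_locus J \<inter> - (cclass ` ?K)"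
    then obtain A where A: "A \<in> V" "A \<noteq> 0" "p = cclass A"
      by (auto simp: fixed_locus_eq)
    define B where "B = A /\<^sub>R norm A"
    have B: "B \<in> V" "norm B = 1" "p = cclass B"
      using A by (simp_all add: B_def V_scaleR cclass_scaleR)
    then have "B \<in> C" using p T by auto
    then show "p \<in> cclass ` C" using B by blast
  qed
  ultimately show ?thesis
    by (auto simp: openin_open)
qed

text \<open>Charts are given on matrices: \<open>F\<close> is invariant under scaling and
  \<open>G\<close> chooses a representative. As \<open>G\<close> may leave the cone
  \<open>C\<close>, its conditions are asked only where \<open>G w \<in> C\<close>, and the chart is
  onto the part of \<open>W\<close> that \<open>G\<close> sends into \<open>C\<close>, which is
  open.\<close>

lemma chart:
  fixes F :: "M2 \<Rightarrow> real^2" and G :: "real^2 \<Rightarrow> M2"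
  assumes X: "X \<subseteq> fixed_locus J"
    and C: "openin (top_of_set V) C" "0 \<notin> C" "\<And>A r. A \<in> C \<Longrightarrow> r \<noteq> 0 \<Longrightarrow> r *\<^sub>R A \<in> C"
    and A0: "A0 \<in> C" "cclass A0 \<in> X"
    and F: "continuous_on C F" "\<And>A r. A \<in> C \<Longrightarrow> r \<noteq> 0 \<Longrightarrow> F (r *\<^sub>R A) = F A"
    and G: "open W" "continuous_on W G" "G ` W \<subseteq> V"
    and FX: "\<And>A. A \<in> C \<Longrightarrow> cclass A \<in> X \<Longrightarrow> F A \<in> W \<and> (\<exists>r. r \<noteq> 0 \<and> G (F A) = r *\<^sub>R A)"
    and GX: "\<And>w. w \<in> W \<Longrightarrow> G w \<in> C \<Longrightarrow> cclass (G w) \<in> X \<and> F (G w) = w"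
  shows "\<exists>U. openin (top_of_set X) U \<and> cclass A0 \<in> U \<and>
           (\<exists>Y::(real^2) set. open Y \<and> subtopology (top_of_set X) U homeomorphic_space top_of_set Y)"
proof -
  define U where "U = X \<inter> cclass ` C"
  define f where "f p = F (SOME A. A \<in> C \<and> cclass A = p)" for p
  obtain T where T: "open T" "C = V \<inter> T"
    using C(1) by (auto simp: openin_open)
  define Y where "Y = W \<inter> G -` T"
  have Y: "open Y"
    unfolding Y_def using continuous_open_preimage[OF G(2,1) T(1)] .
  have YC: "G w \<in> C" if "w \<in> Y" for w
    using that G(3) T by (auto simp: Y_def)
  have fF: "f (cclass A) = F A" if "A \<in> C" for A
  proof -
    define B where "B = (SOME A'. A' \<in> C \<and> cclass A' = cclass A)"
    have B: "B \<in> C" "cclass B = cclass A"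
      using someI[of "\<lambda>A'. A' \<in> C \<and> cclass A' = cclass A" A] that by (auto simp: B_def)
    have AB: "A \<in> V" "B \<in> V" "A \<noteq> 0" "B \<noteq> 0" "cclass A = cclass B"
      using B that C(2) T by auto
    obtain r where "r \<noteq> 0" "B = r *\<^sub>R A"
      using cclass_V_eq[OF AB] by blast
    then show ?thesis
      using F(2)[OF that] by (simp add: f_def B_def[symmetric])
  qed
  have opC: "openin (top_of_set X) (X \<inter> cclass ` C')"
    if "openin (top_of_set V) C'" "0 \<notin> C'" "\<And>A r. A \<in> C' \<Longrightarrow> r \<noteq> 0 \<Longrightarrow> r *\<^sub>R A \<in> C'" for C'
    using openin_fixed_locus[OF that] X
    by (auto simp: openin_open)
  have U: "openin (top_of_set X) U"
    unfolding U_def by (rule opC[OF C])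
  have UX: "U \<subseteq> X" by (simp add: U_def)
  have contf: "continuous_on U f"
    unfolding continuous_on_open_gen[of f U UNIV, simplified]
  proof (intro allI impI)
    fix Z :: "(real^2) set" assume "open Z"
    have "openin (top_of_set V) (C \<inter> F -` Z)"
      using continuous_openin_preimage_gen[OF F(1) \<open>open Z\<close>] C(1) by (rule openin_trans)
    then have "openin (top_of_set X) (X \<inter> cclass ` (C \<inter> F -` Z))"
      using C F(2) by (intro opC) auto
    moreover have "X \<inter> cclass ` (C \<inter> F -` Z) = U \<inter> f -` Z"
      by (auto simp: U_def fF)
    ultimately show "openin (top_of_set U) (U \<inter> f -` Z)"
      using UX by (auto intro: openin_subset_trans)
  qed
  have fU: "f p \<in> Y \<and> cclass (G (f p)) = p" if "p \<in> U" for p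
  proof -
    obtain A where A: "A \<in> C" "p = cclass A" "p \<in> X"
      using \<open>p \<in> U\<close> by (auto simp: U_def)
    then obtain r where r: "F A \<in> W" "r \<noteq> 0" "G (F A) = r *\<^sub>R A"
      using FX by blast
    then have "G (F A) \<in> C" using C(3) A by simp
    moreover have "A \<noteq> 0" using A C(2) by auto
    ultimately show ?thesis
      using A r T by (simp add: fF Y_def cclass_scaleR)
  qed
  have gY: "cclass (G w) \<in> U \<and> f (cclass (G w)) = w" if "w \<in> Y" for w
    using GX[of w] YC[OF that] that by (auto simp: U_def fF Y_def)
  have contg: "continuous_on Y (\<lambda>w. cclass (G w))"
  proof (intro continuous_on_cclass continuous_on_subset[OF G(2)])
    show "G w \<noteq> 0" if "w \<in> Y" for w using YC[OF that] C(2) by auto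
  qed (simp add: Y_def)
  have "subtopology (top_of_set X) U = top_of_set U"
    using UX by (simp add: subtopology_subtopology inf.absorb2)
  moreover have "top_of_set U homeomorphic_space top_of_set Y"
    unfolding homeomorphic_space_def homeomorphic_maps_def
    using fU gY contf contg by (intro exI[of _ f] exI[of _ "\<lambda>w. cclass (G w)"])
      (simp add: Pi_iff)
  moreover have "cclass A0 \<in> U" using A0 by (auto simp: U_def)
  ultimately show ?thesis
    using U Y by (intro exI[of _ U] conjI exI[of _ Y]) simp_all
qed

end

lemma real_structureI:
  assumes "J \<in> {entry_conj, tau, conj_transpose}" shows "real_structure J"
proof -
  have "antiunitary J"
    using assms antiunitary_entry_conj antiunitary_conj_transpose tau.antiunitary_axioms by blast
  moreover have "real_structure_axioms J"
  proof -
    have "real_structure_axioms entry_conj" "real_structure_axioms tau"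
      "real_structure_axioms conj_transpose"
      by (simp_all add: real_structure_axioms_def det_2 M2_eq_iff)
    then show ?thesis using assms by blast
  qed
  ultimately show ?thesis by (simp add: real_structure_def)
qed

section \<open>The closure of the open diagram\<close>

lemma prod_2: "(\<Prod>i\<in>UNIV. h i) = h 1 * (h 2 :: complex)" for h :: "2 \<Rightarrow> complex"
  by (simp add: UNIV_2)

lemma homogeneous_poly_1_linear:
  assumes "homogeneous_poly 1 g" shows "linear g"
proof -
  obtain a where a: "\<And>A. g A = (\<Sum>e\<in>exponents 1. a e * (\<Prod>i\<in>UNIV. \<Prod>j\<in>UNIV. (A$i$j) ^ (e$i$j)))"
    using assms unfolding homogeneous_poly_def by blast
  have lin: "linear (\<lambda>A::M2. a e * (\<Prod>i\<in>UNIV. \<Prod>j\<in>UNIV. (A$i$j) ^ (e$i$j)))" if "e \<in> exponents 1" for e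
  proof -
    have "e$1$1 + e$1$2 + (e$2$1 + e$2$2) = 1"
      using that by (simp add: exponents_def sum_2)
    then consider "e$1$1 = 1 \<and> e$1$2 = 0 \<and> e$2$1 = 0 \<and> e$2$2 = 0"
      | "e$1$1 = 0 \<and> e$1$2 = 1 \<and> e$2$1 = 0 \<and> e$2$2 = 0"
      | "e$1$1 = 0 \<and> e$1$2 = 0 \<and> e$2$1 = 1 \<and> e$2$2 = 0"
      | "e$1$1 = 0 \<and> e$1$2 = 0 \<and> e$2$1 = 0 \<and> e$2$2 = 1"
      by (simp add: add_is_1) metis
    then show ?thesis
      by cases (simp_all add: prod_2 linear_iff algebra_simps)
  qed
  have "g = (\<lambda>A. \<Sum>e\<in>exponents 1. a e * (\<Prod>i\<in>UNIV. \<Prod>j\<in>UNIV. (A$i$j) ^ (e$i$j)))"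
    using a by blast
  moreover have "linear (\<lambda>A::M2. \<Sum>e\<in>exponents 1. a e * (\<Prod>i\<in>UNIV. \<Prod>j\<in>UNIV. (A$i$j) ^ (e$i$j)))"
    by (rule linear_compose_sum) (use lin in blast)
  ultimately show ?thesis by simp
qed

lemma homogeneous_poly_continuous:
  fixes h :: "'a::topological_space \<Rightarrow> M2"
  assumes "homogeneous_poly m g" "continuous_on S h"
  shows "continuous_on S (\<lambda>x. g (h x))"
proof -
  obtain a where a: "\<And>A. g A = (\<Sum>e\<in>exponents m. a e * (\<Prod>i\<in>UNIV. \<Prod>j\<in>UNIV. (A$i$j) ^ (e$i$j)))"
    using assms unfolding homogeneous_poly_def by blast
  show ?thesis
    unfolding a by (intro continuous_intros assms)
qed

lemma homogeneous_poly_curve_iff: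
  assumes "homogeneous_poly m g" "A \<noteq> 0"
  shows "cclass A \<in> curve g \<longleftrightarrow> det A = 0 \<and> g A = 0"
proof
  assume "cclass A \<in> curve g"
  then obtain B where B: "B \<noteq> 0" "det B = 0" "g B = 0" "cclass B = cclass A"
    by (auto simp: curve_def)
  then obtain c where "A = cscale c B"
    using cclass_eq_iff[OF B(1) assms(2)] by auto
  then show "det A = 0 \<and> g A = 0"
    using B by (simp add: det_cscale homogeneous_poly_cscale[OF assms(1)])
qed (use assms in \<open>auto simp: curve_def\<close>)

lemma inner_tau_singular: "det B = 0 \<Longrightarrow> B \<bullet> tau B = 0"
  using Re_det[of B] by simp

text \<open>For singular \<open>B\<close> the matrices \<open>B\<close> and \<open>tau B\<close> are
  orthogonal, so the product with \<open>B\<close> leaves \<open>B \<bullet> B\<close>. Hence the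
  parametrisation extends to all \<open>s\<close>, in particular to 0 and 1.\<close>

lemma collar_nonzero:
  assumes "B \<noteq> 0" "det B = 0" shows "B + s *\<^sub>R tau B \<noteq> 0"
proof
  assume "B + s *\<^sub>R tau B = 0"
  then have "(B + s *\<^sub>R tau B) \<bullet> B = 0" by simp
  then have "B \<bullet> B + s * (B \<bullet> tau B) = 0"
    by (simp add: inner_add_left inner_commute[of "tau B"])
  then show False
    using assms inner_tau_singular[of B] by simp
qed

lemma psi_collar:
  assumes "0 < \<alpha>" "B \<noteq> 0"
  shows "psi (\<alpha>, rclass B) = cclass (B + exp (- 2 * \<alpha>) *\<^sub>R tau B)"
proof -
  have "exp \<alpha> *\<^sub>R B + exp (- \<alpha>) *\<^sub>R tau B = exp \<alpha> *\<^sub>R (B + exp (- 2 * \<alpha>) *\<^sub>R tau B)"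
    by (simp add: scaleR_add_right flip: exp_add)
  moreover have "B + exp (- 2 * \<alpha>) *\<^sub>R tau B \<noteq> 0"
    using psi_arg_nonzero[OF assms] calculation by auto
  ultimately show ?thesis
    using psi_rclass[OF assms] by (simp add: cclass_scaleR)
qed

section \<open>Critical levels and the closed model of the diagram\<close>

locale diagram = real_structure J for J +
  fixes d :: nat and \<gamma> :: "nat \<Rightarrow> real" and f :: "nat \<Rightarrow> M2 \<Rightarrow> complex"
  assumes prim: "primitive_data d \<gamma> f" and real: "real_data J d f"
begin

definition k :: nat where "k = d div 2"

text \<open>Critical levels in the coordinate \<open>s\<close>, hence decreasing. The conventions
  \<open>lev 0 = 1\<close> (unitary matrices) and \<open>lev (Suc k) = 0\<close> (quadric) assign to
  each \<open>F j\<close> the closed interval from \<open>lev (Suc j)\<close> to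
  \<open>lev j\<close>.\<close>

definition lev :: "nat \<Rightarrow> real" where
  "lev j = (if j = 0 then 1 else if j \<le> k then exp (- 2 * \<gamma> j) else 0)"

text \<open>Counted by level: \<open>F 0\<close> is the linear form \<open>f 1\<close> in odd degree
  and the nonvanishing constant \<open>f 0\<close> in even degree.\<close>

definition F :: "nat \<Rightarrow> M2 \<Rightarrow> complex" where "F j = f (deg_at d j)"

lemma degrees: "j \<le> k \<Longrightarrow> deg_at d j \<in> degrees d"
proof -
  assume "j \<le> k"
  then have "2 * j + d mod 2 \<le> d" unfolding k_def by presburger
  then show ?thesis by (simp add: degrees_def deg_at_def)
qed

lemma deg_Suc: "deg_at d (Suc j) = deg_at d j + 2"
  by (simp add: deg_at_def)

lemma homog: "j \<le> k \<Longrightarrow> homogeneous_poly (deg_at d j) (F j)"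
  using prim degrees by (auto simp: primitive_data_def F_def)

lemma F_cscale: "j \<le> k \<Longrightarrow> F j (cscale c A) = c ^ deg_at d j * F j A"
  using homog homogeneous_poly_cscale by blast

lemma F_scaleR: "j \<le> k \<Longrightarrow> F j (r *\<^sub>R A) = of_real r ^ deg_at d j * F j A"
  using F_cscale[of j "of_real r" A] by (simp add: cscale_of_real)

lemma F_J: "j \<le> k \<Longrightarrow> F j (J A) = cnj (F j A)"
  using real degrees[of j] by (simp add: real_data_def F_def) (metis complex_cnj_cnj)

lemma Im_F: "j \<le> k \<Longrightarrow> A \<in> V \<Longrightarrow> Im (F j A) = 0"
  using F_J[of j A] by (simp add: V_def complex_eq_iff)

lemma continuous_on_F [continuous_intros]:
  "j \<le> k \<Longrightarrow> continuous_on S h \<Longrightarrow> continuous_on S (\<lambda>x. F j (h x))"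
  using homogeneous_poly_continuous homog by blast

lemma F0_even: "even d \<Longrightarrow> F 0 A \<noteq> 0"
  using prim by (auto simp: primitive_data_def F_def deg_at_def even_iff_mod_2_eq_zero)

lemma F0_linear: "odd d \<Longrightarrow> linear (F 0)"
  using homog[of 0] by (intro homogeneous_poly_1_linear) (simp add: deg_at_def odd_iff_mod_2_eq_one)

lemma gamma_pos: "1 \<le> j \<Longrightarrow> j \<le> k \<Longrightarrow> 0 < \<gamma> j"
  using prim by (auto simp: primitive_data_def k_def)

lemma lev_Suc_less: "j \<le> k \<Longrightarrow> lev (Suc j) < lev j"
proof -
  assume "j \<le> k"
  then have "\<gamma> j < \<gamma> (Suc j)" if "1 \<le> j" "Suc j \<le> k"
    using prim that by (auto simp: primitive_data_def strict_mono_on_def k_def)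
  then show ?thesis
    using \<open>j \<le> k\<close> gamma_pos[of "Suc j"] by (auto simp: lev_def)
qed

lemma lev_less: "i < j \<Longrightarrow> j \<le> Suc k \<Longrightarrow> lev j < lev i"
proof (induction j)
  case (Suc j)
  then show ?case
    using lev_Suc_less[of j] by (cases "i = j") auto
qed simp

lemma lev_bounds: "0 \<le> lev j" "lev j \<le> 1"
  using gamma_pos[of j] by (auto simp: lev_def)

lemma level_iff:
  assumes "j \<le> k" "0 < \<alpha>" "j = 0 \<or> level d \<gamma> j < ereal \<alpha>" "ereal \<alpha> < level d \<gamma> (Suc j)"
  shows "lev (Suc j) < exp (- 2 * \<alpha>)" "exp (- 2 * \<alpha>) < lev j"
  using assms by (auto simp: level_def lev_def k_def split: if_splits)

text \<open>The second alternative describes the section without a square root: off the two curves,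
  \<open>B\<close> represents a value of \<open>sigma\<close> exactly if
  \<open>F (j - 1) B * cnj (F j B)\<close> is positive. Allowing 0 adds only points over one of the
  curves, which the first alternative already contains.\<close>

definition E :: "real \<Rightarrow> M2 \<Rightarrow> bool" where
  "E s B \<longleftrightarrow> (\<exists>j\<le>k. lev (Suc j) \<le> s \<and> s \<le> lev j \<and> F j B = 0) \<or>
     (\<exists>j\<in>{1..k}. s = lev j \<and> Im (F (j - 1) B * cnj (F j B)) = 0 \<and> 0 \<le> Re (F (j - 1) B * cnj (F j B)))"

lemma E_bounds: "E s B \<Longrightarrow> 0 \<le> s \<and> s \<le> 1"
  unfolding E_def using lev_bounds by (metis order_trans)

definition collar :: "cp3 set" where
  "collar = {cclass (B + s *\<^sub>R tau B) |s B. B \<noteq> 0 \<and> det B = 0 \<and> E s B}"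

text \<open>Restricted to real \<open>c\<close>, as \<open>B\<close> stands for a class modulo real
  scalars. Consecutive degrees have an even sum, so the product in \<open>E\<close> changes by a
  nonnegative factor.\<close>

lemma E_cscale:
  assumes "E s B" "c \<noteq> 0" "c \<in> \<real>" shows "E s (cscale c B)"
proof -
  obtain r where r: "c = of_real r" using assms Reals_cases by blast
  have e: "F (j - 1) (cscale c B) * cnj (F j (cscale c B)) =
      of_real (r ^ (deg_at d (j - 1) + deg_at d (j - 1) + 2)) * (F (j - 1) B * cnj (F j B))" if jk: "j \<in> {1..k}" for j
  proof -
    obtain i where "j = Suc i" "i < k" by (cases j) (use jk in auto)
    then show ?thesis
      by (simp add: F_cscale deg_Suc r power_add power2_eq_square)
  qed
  have nn: "0 \<le> r ^ (deg_at d (j - 1) + deg_at d (j - 1) + 2)" for j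
    by (rule zero_le_even_power) simp
  show ?thesis
    using assms(1) unfolding E_def
  proof (elim disjE)
    assume "\<exists>j\<in>{1..k}. s = lev j \<and> Im (F (j - 1) B * cnj (F j B)) = 0 \<and> 0 \<le> Re (F (j - 1) B * cnj (F j B))"
    then obtain j where j: "j \<in> {1..k}" "s = lev j" "Im (F (j - 1) B * cnj (F j B)) = 0"
      "0 \<le> Re (F (j - 1) B * cnj (F j B))" by blast
    have "Im (F (j - 1) (cscale c B) * cnj (F j (cscale c B))) = 0"
      unfolding e[OF j(1)] using j(3) by (simp only: scaleR_conv_of_real[symmetric] scaleR_complex.sel mult_zero_right)
    moreover have "0 \<le> Re (F (j - 1) (cscale c B) * cnj (F j (cscale c B)))"
      unfolding e[OF j(1)] using mult_nonneg_nonneg[OF nn j(4)]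
      by (simp only: scaleR_conv_of_real[symmetric] scaleR_complex.sel)
    ultimately show "(\<exists>j\<le>k. lev (Suc j) \<le> s \<and> s \<le> lev j \<and> F j (cscale c B) = 0) \<or>
      (\<exists>j\<in>{1..k}. s = lev j \<and> Im (F (j - 1) (cscale c B) * cnj (F j (cscale c B))) = 0 \<and>
        0 \<le> Re (F (j - 1) (cscale c B) * cnj (F j (cscale c B))))"
      using j(1,2) by blast
  qed (auto simp: F_cscale)
qed

lemma closed_collar: "closed collar"
proof -
  let ?K = "{x. norm (snd x) = 1 \<and> det (snd x) = 0 \<and> E (fst x) (snd x)} :: (real \<times> M2) set"
  have "closed {x::real \<times> M2. E (fst x) (snd x)}"
  proof -
    have "{x::real \<times> M2. E (fst x) (snd x)} =
        (\<Union>j\<in>{..k}. {x. lev (Suc j) \<le> fst x \<and> fst x \<le> lev j \<and> F j (snd x) = 0}) \<union>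
        (\<Union>j\<in>{1..k}. {x. fst x = lev j \<and> Im (F (j - 1) (snd x) * cnj (F j (snd x))) = 0 \<and>
            0 \<le> Re (F (j - 1) (snd x) * cnj (F j (snd x)))})"
      unfolding E_def by blast
    also have "closed \<dots>"
      by (intro closed_Un closed_UN ballI finite_atMost finite_atLeastAtMost closed_Collect_conj
          closed_Collect_le closed_Collect_eq continuous_intros) auto
    finally show ?thesis .
  qed
  then have "closed ?K"
    by (intro closed_Collect_conj closed_Collect_eq continuous_intros)
  moreover have "bounded ?K"
    by (rule bounded_subset[of "{0..1} \<times> sphere 0 1"])
      (auto intro: bounded_Times bounded_closed_interval dest!: E_bounds)
  ultimately have "compact ?K" by (simp add: compact_eq_bounded_closed)
  then have "compact ((\<lambda>x. cclass (snd x + fst x *\<^sub>R tau (snd x))) ` ?K)"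
  proof (intro compact_continuous_image continuous_on_cclass continuous_intros tau.continuous)
    show "snd x + fst x *\<^sub>R tau (snd x) \<noteq> 0" if "x \<in> ?K" for x
      using that by (intro collar_nonzero) auto
  qed
  moreover have "collar = (\<lambda>x. cclass (snd x + fst x *\<^sub>R tau (snd x))) ` ?K"
  proof (intro set_eqI iffI)
    fix p assume "p \<in> collar"
    then obtain s B where B: "p = cclass (B + s *\<^sub>R tau B)" "B \<noteq> 0" "det B = 0" "E s B"
      by (auto simp: collar_def)
    define r where "r = inverse (norm B)"
    have r: "r \<noteq> 0" using B by (simp add: r_def)
    have "cclass (r *\<^sub>R B + s *\<^sub>R tau (r *\<^sub>R B)) = cclass (r *\<^sub>R (B + s *\<^sub>R tau B))"
      by (simp add: tau.scaleR scaleR_add_right mult.commute)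
    then have "p = cclass (r *\<^sub>R B + s *\<^sub>R tau (r *\<^sub>R B))"
      using B r collar_nonzero by (simp add: cclass_scaleR)
    moreover have "det (r *\<^sub>R B) = 0"
      using det_cscale[of "of_real r" B] B by (simp add: cscale_of_real)
    moreover have "E s (r *\<^sub>R B)"
      using E_cscale[OF B(4), of "of_real r"] r by (simp add: cscale_of_real)
    moreover have "norm (r *\<^sub>R B) = 1" using B by (simp add: r_def)
    ultimately show "p \<in> (\<lambda>x. cclass (snd x + fst x *\<^sub>R tau (snd x))) ` ?K"
      by (intro image_eqI[of _ _ "(s, r *\<^sub>R B)"]) auto
  next
    fix p assume "p \<in> (\<lambda>x. cclass (snd x + fst x *\<^sub>R tau (snd x))) ` ?K"
    then obtain s B where "p = cclass (B + s *\<^sub>R tau B)" "norm B = 1" "det B = 0" "E s B"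
      by auto
    then show "p \<in> collar"
      unfolding collar_def by (intro CollectI exI[of _ s] exI[of _ B]) auto
  qed
  ultimately show ?thesis
    by (simp add: compact_imp_closed)
qed

lemma collar_vertical:
  assumes "B \<noteq> 0" "j \<le> k" "det B = 0" "F j B = 0" "0 < \<alpha>"
    "j = 0 \<or> level d \<gamma> j < ereal \<alpha>" "ereal \<alpha> < level d \<gamma> (Suc j)"
  shows "psi (\<alpha>, rclass B) \<in> collar"
  using level_iff[OF assms(2,5,6,7)] assms psi_collar[OF assms(5,1)]
  unfolding collar_def E_def by (auto intro!: exI[of _ "exp (- 2 * \<alpha>)"] exI[of _ B] less_imp_le)

lemma bundle_over_curve:
  assumes "\<sigma> \<in> bundle_over (curve (F j))" "j \<le> k"
  obtains B where "\<sigma> = rclass B" "B \<noteq> 0" "det B = 0" "F j B = 0"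
proof -
  obtain B where B: "\<sigma> = rclass B" "B \<noteq> 0" "det B = 0" "bundle_proj \<sigma> \<in> curve (F j)"
    using assms(1) by (auto simp: bundle_over_def circle_bundle_def)
  then have "F j B = 0"
    using homogeneous_poly_curve_iff[OF homog[OF assms(2)] B(2)] by (simp add: bundle_proj_rclass)
  with B show ?thesis by (intro that)
qed

lemma open_diagram_subset: "open_diagram d \<gamma> f \<subseteq> collar"
proof -
  have vert: "psi x \<in> collar" if xin: "x \<in> vertical_part d \<gamma> f" for x
  proof -
    obtain j \<alpha> \<sigma> where x: "j \<in> {1..k}" "x = (\<alpha>, \<sigma>)" "level d \<gamma> j < ereal \<alpha>"
      "ereal \<alpha> < level d \<gamma> (Suc j)" "\<sigma> \<in> bundle_over (curve (F j))"
    proof -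
      obtain j where "j \<in> {1..d div 2}" "x \<in> {\<alpha>. level d \<gamma> j < ereal \<alpha> \<and> ereal \<alpha> < level d \<gamma> (j + 1)}
          \<times> bundle_over (curve (f (deg_at d j)))"
        using xin unfolding vertical_part_def by blast
      then show ?thesis
        using that[of j "fst x" "snd x"] by (auto simp: k_def F_def)
    qed
    moreover have "j \<le> k" using x by simp
    moreover obtain B where "\<sigma> = rclass B" "B \<noteq> 0" "det B = 0" "F j B = 0"
      using bundle_over_curve[OF x(5) \<open>j \<le> k\<close>] by blast
    moreover have "0 < \<alpha>"
      using x gamma_pos[of j] by (auto simp: level_def k_def)
    ultimately show ?thesis
      using collar_vertical[of B j \<alpha>] by simp
  qed
  have hor: "psi x \<in> collar" if xin: "x \<in> horizontal_part d \<gamma> f" for x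
  proof -
    obtain j p where x: "x = (\<gamma> j, sigma (F (j - 1)) (F j) p)" "j \<in> {1..k}" "p \<in> quadric"
      "p \<notin> curve (F (j - 1))" "p \<notin> curve (F j)"
    proof -
      obtain j where "j \<in> {1..d div 2}" "x \<in> {\<gamma> j} \<times> sigma (f (deg_at d (j - 1))) (f (deg_at d j)) `
            (quadric - (curve (f (deg_at d (j - 1))) \<union> curve (f (deg_at d j))))"
        using xin unfolding horizontal_part_def by blast
      then show ?thesis
        using that[of j] by (auto simp: k_def F_def)
    qed
    then obtain B where B: "p = cclass B" "B \<noteq> 0" "det B = 0"
      by (auto simp: quadric_def)
    obtain i where i: "j = Suc i" "i < k" by (cases j) (use x in auto)
    have nz: "F i B \<noteq> 0" "F j B \<noteq> 0"
      using x B i homogeneous_poly_curve_iff[OF homog[of i] B(2)] homogeneous_poly_curve_iff[OF homog[of j] B(2)]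
      by auto
    define w where "w = csqrt (F i B / F j B)"
    have w: "w\<^sup>2 = F i B / F j B" "w \<noteq> 0" using nz by (simp_all add: w_def)
    have "sigma (F i) (F j) p = rclass (cscale w B)"
      unfolding B(1)
    proof (rule sigma_cclass)
      show "homogeneous_poly (deg_at d i) (F i)" "homogeneous_poly (deg_at d i + 2) (F j)"
        using homog[of i] homog[of j] i by (simp_all add: deg_Suc)
    qed (use B nz w in auto)
    then have ps: "psi x = cclass (cscale w B + lev j *\<^sub>R tau (cscale w B))"
      using x i psi_collar[of "\<gamma> j" "cscale w B"] gamma_pos[of j] B w by (simp add: lev_def)
    \<comment> \<open>The degrees differ by 2, so exactly one factor \<open>(cnj w)\<^sup>2\<close>
      is left besides powers of \<open>w * cnj w\<close>; inserting the ratio makes the product a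
      positive real.\<close>
    have "F i (cscale w B) * cnj (F j (cscale w B)) =
        (w * cnj w) ^ deg_at d i * (cnj w ^ 2 * F i B * cnj (F j B))"
      using i by (simp add: F_cscale deg_Suc power_mult_distrib power_add power2_eq_square)
    also have "cnj w ^ 2 = cnj (F i B) / cnj (F j B)"
      by (metis w(1) complex_cnj_divide complex_cnj_power)
    also have "cnj (F i B) / cnj (F j B) * F i B * cnj (F j B) = F i B * cnj (F i B)"
      using nz by simp
    finally have "F i (cscale w B) * cnj (F j (cscale w B)) = of_real (((cmod w)\<^sup>2) ^ deg_at d i * (cmod (F i B))\<^sup>2)"
      unfolding of_real_mult of_real_power[of _ "deg_at d i"] complex_norm_square .
    then have "E (lev j) (cscale w B)"
      unfolding E_def using x i by (intro disjI2 bexI[of _ j]) auto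
    then show ?thesis
      unfolding ps collar_def using B w
      by (intro CollectI exI[of _ "lev j"] exI[of _ "cscale w B"]) (simp add: det_cscale)
  qed
  have bot: "psi x \<in> collar" if xin: "x \<in> bottom_part d \<gamma> f" "odd d" for x
  proof -
    have F0: "F 0 = f 1" using xin by (simp add: F_def deg_at_def odd_iff_mod_2_eq_one)
    obtain \<alpha> \<sigma> where x: "x = (\<alpha>, \<sigma>)" "0 < \<alpha>" "ereal \<alpha> < level d \<gamma> (Suc 0)"
      "\<sigma> \<in> bundle_over (curve (F 0))"
      using xin by (auto simp: bottom_part_def F0)
    moreover obtain B where "\<sigma> = rclass B" "B \<noteq> 0" "det B = 0" "F 0 B = 0"
      using bundle_over_curve[OF x(4)] by blast
    ultimately show ?thesis
      using collar_vertical[of B 0 \<alpha>] by simp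
  qed
  have coam: "p \<in> collar" if pin: "p \<in> coamoeba (f 1)" "odd d" for p
  proof -
    have F0: "F 0 = f 1" using pin by (simp add: F_def deg_at_def odd_iff_mod_2_eq_one)
    obtain q where q: "p = kappa q" "q \<in> plane_section (F 0)" "q \<in> PSL2"
      using pin by (auto simp: coamoeba_def F0)
    obtain A0 where A0: "q = cclass A0" "A0 \<noteq> 0" "F 0 A0 = 0"
      using q by (auto simp: plane_section_def)
    obtain A1 where A1: "q = cclass A1" "A1 \<noteq> 0" "det A1 \<noteq> 0"
      using q by (auto simp: PSL2_def)
    obtain c where c: "c \<noteq> 0" "A1 = cscale c A0"
      using cclass_eq_iff[OF A0(2) A1(2)] A0 A1 by auto
    \<comment> \<open>The plane and the group come with different representatives of
      \<open>q\<close>, and \<open>kappa\<close> asks for determinant 1; one rescaled matrix serves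
      all three.\<close>
    define w where "w = csqrt (1 / det A1)"
    have w: "w\<^sup>2 = 1 / det A1" "w \<noteq> 0" using A1 by (auto simp: w_def)
    define A where "A = cscale w A1"
    have A: "det A = 1" "F 0 A = 0" "q = cclass A"
    proof -
      show "det A = 1" using A1 w by (simp add: A_def det_cscale)
      show "F 0 A = 0" using A0 c by (simp add: A_def F_cscale)
      show "q = cclass A" using A1 w by (simp add: A_def cclass_cscale)
    qed
    define W where "W = (1/2) *\<^sub>R (A + tau A)"
    define Y where "Y = (1/2) *\<^sub>R (A - tau A)"
    have WY: "W + Y = A" by (simp add: W_def Y_def flip: scaleR_add_right) 
    have tW: "tau W = W" "tau Y = - Y"
      by (simp_all add: W_def Y_def tau.add tau.scaleR tau.diff add.commute flip: scaleR_minus_right)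
    \<comment> \<open>\<open>W\<close> is half of the matrix in \<open>kappa\<close>. Determinant 1
      means \<open>(norm W)\<^sup>2 - (norm Y)\<^sup>2 = 2\<close>, which yields the inequality for
      \<open>fibre_of_unitary_part\<close>.\<close>
    have "tau A = W - Y" using WY tW by (metis tau.add diff_conv_add_uminus)
    then have "2 = (W + Y) \<bullet> (W - Y)"
      using Re_det[of A] A WY by simp
    then have "norm Y ^ 2 \<le> norm W ^ 2"
      by (simp add: power2_norm_eq_inner inner_add_left inner_diff_right inner_commute[of Y W])
    then have "norm Y \<le> norm W" by simp
    then obtain B where B: "det B = 0" "F 0 B = 0" "B + tau B = 2 *\<^sub>R W"
      using fibre_of_unitary_part[OF tW, of "F 0"] \<open>norm Y \<le> norm W\<close> A WY F0_linear pin by auto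
    have "p = cclass (B + tau B)"
      using q A kappa_cclass[of A] by (simp add: B(3) W_def)
    moreover have "W \<noteq> 0" using \<open>norm Y \<le> norm W\<close> WY A by (auto simp: det_2)
    then have "B \<noteq> 0" using B(3) by auto
    moreover have "E 1 B"
      unfolding E_def using B lev_bounds[of "Suc 0"]
      by (intro disjI1 exI[of _ 0]) (auto simp: lev_def)
    ultimately show ?thesis
      unfolding collar_def using B by (intro CollectI exI[of _ 1] exI[of _ B]) simp
  qed
  show ?thesis
    using vert hor bot coam by (auto simp: open_diagram_def)
qed

text \<open>With \<open>B\<close> fixed and \<open>s\<close> in the open interval the point lies in
  the open diagram, and by continuity both ends are limits, including the quadric at
  \<open>s = 0\<close> and the unitary matrices at \<open>s = 1\<close>.\<close>

lemma vertical_closure: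
  assumes "B \<noteq> 0" "det B = 0" "F j B = 0" "j \<le> k" "lev (Suc j) \<le> s" "s \<le> lev j"
  shows "cclass (B + s *\<^sub>R tau B) \<in> closure (open_diagram d \<gamma> f)"
proof -
  let ?h = "\<lambda>s. cclass (B + s *\<^sub>R tau B)"
  have odd: "odd d" if "j = 0"
    using F0_even assms(3) that by auto
  have "?h t \<in> open_diagram d \<gamma> f" if t: "lev (Suc j) < t" "t < lev j" for t
  proof -
    define \<alpha> where "\<alpha> = - ln t / 2"
    have t01: "0 < t" "t < 1" using t lev_bounds[of j] lev_bounds[of "Suc j"] by linarith+
    have e: "exp (- 2 * \<alpha>) = t" using t01 by (simp add: \<alpha>_def)
    have a0: "0 < \<alpha>" using t01 by (simp add: \<alpha>_def)
    have 1: "j = 0 \<or> level d \<gamma> j < ereal \<alpha>" "ereal \<alpha> < level d \<gamma> (Suc j)"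
      using t assms(4) unfolding e[symmetric] by (auto simp: lev_def level_def k_def split: if_splits)
    have 2: "rclass B \<in> bundle_over (curve (F j))"
      using assms homogeneous_poly_curve_iff[OF homog[OF assms(4)] assms(1)]
      by (auto simp: bundle_over_def circle_bundle_def bundle_proj_rclass)
    have h: "?h t = psi (\<alpha>, rclass B)"
      using psi_collar[OF a0 assms(1)] e by simp
    show ?thesis
    proof (cases "j = 0")
      case True
      then have "(\<alpha>, rclass B) \<in> bottom_part d \<gamma> f"
        using 1 2 a0 odd by (auto simp: bottom_part_def F_def deg_at_def odd_iff_mod_2_eq_one)
      then show ?thesis
        unfolding h open_diagram_def using odd True by auto
    next
      case False
      then have "(\<alpha>, rclass B) \<in> vertical_part d \<gamma> f"
        using 1 2 assms(4) by (auto simp: vertical_part_def F_def k_def intro!: bexI[of _ j])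
      then show ?thesis
        unfolding h open_diagram_def by auto
    qed
  qed
  then have "?h ` {lev (Suc j)<..<lev j} \<subseteq> closure (open_diagram d \<gamma> f)"
    using closure_subset by fastforce
  moreover have "continuous_on (closure {lev (Suc j)<..<lev j}) ?h"
    using collar_nonzero assms(1,2) by (intro continuous_on_cclass continuous_intros) auto
  ultimately have "?h ` closure {lev (Suc j)<..<lev j} \<subseteq> closure (open_diagram d \<gamma> f)"
    by (intro image_closure_subset) auto
  then show ?thesis
    using lev_Suc_less[OF assms(4)] assms(5,6) by auto
qed

text \<open>At a critical level two vertical pieces end, so a point where \<open>F (j - 1)\<close>
  or \<open>F j\<close> vanishes is a limit of one of them. The remaining points of the level lie on
  the section itself.\<close>

lemma collar_subset: "collar \<subseteq> primitive_diagram d \<gamma> f"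
proof
  fix p assume "p \<in> collar"
  then obtain s B where B: "p = cclass (B + s *\<^sub>R tau B)" "B \<noteq> 0" "det B = 0" "E s B"
    by (auto simp: collar_def)
  show "p \<in> primitive_diagram d \<gamma> f"
  proof (cases "\<exists>j\<le>k. lev (Suc j) \<le> s \<and> s \<le> lev j \<and> F j B = 0")
    case True
    then show ?thesis
      using vertical_closure B unfolding primitive_diagram_def by blast
  next
    case False
    then obtain j where j: "j \<in> {1..k}" "s = lev j" "Im (F (j - 1) B * cnj (F j B)) = 0"
      "0 \<le> Re (F (j - 1) B * cnj (F j B))"
      using B(4) unfolding E_def by blast
    obtain i where i: "j = Suc i" "i < k" by (cases j) (use j in auto)
    have nz: "F i B \<noteq> 0" "F j B \<noteq> 0"
      using False[simplified, rule_format, of i] False[simplified, rule_format, of j] i j(2)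
        lev_Suc_less[of i] lev_Suc_less[of j] by auto
    define r where "r = Re (F i B * cnj (F j B)) / (cmod (F j B))\<^sup>2"
    have z: "F i B * cnj (F j B) = of_real (Re (F i B * cnj (F j B)))"
      using j(3) i by (simp add: complex_eq_iff)
    have r: "of_real r = F i B / F j B"
      unfolding r_def of_real_divide z[symmetric] complex_norm_square using nz by simp
    have "r \<ge> 0" using j(4) i by (simp add: r_def)
    have "r \<noteq> 0" using r nz by auto
    then have "r > 0" using \<open>r \<ge> 0\<close> by simp
    \<comment> \<open>The ratio \<open>r\<close> is a positive real, so the square root in the
      section is real and leaves the class of \<open>B\<close> modulo real scalars
      unchanged.\<close>
    have "sigma (F i) (F j) (cclass B) = rclass (cscale (of_real (sqrt r)) B)"
    proof (rule sigma_cclass)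
      show "homogeneous_poly (deg_at d i) (F i)" "homogeneous_poly (deg_at d i + 2) (F j)"
        using homog[of i] homog[of j] i by (simp_all add: deg_Suc)
      show "(of_real (sqrt r))\<^sup>2 = F i B / F j B"
        using \<open>r > 0\<close> r by (simp flip: of_real_power)
    qed (use B nz in auto)
    also have "\<dots> = rclass B"
      using B(2) \<open>r > 0\<close> unfolding cscale_of_real
      by (subst eq_commute, subst rclass_eq_iff) (auto intro!: exI[of _ "sqrt r"])
    finally have sg: "rclass B = sigma (F i) (F j) (cclass B)" by simp
    have "cclass B \<in> quadric" using B by (auto simp: quadric_def)
    moreover have "cclass B \<notin> curve (F i)" "cclass B \<notin> curve (F j)"
      using nz B i homogeneous_poly_curve_iff[OF homog[of i] B(2)] homogeneous_poly_curve_iff[OF homog[of j] B(2)]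
      by auto
    ultimately have "(\<gamma> j, rclass B) \<in> horizontal_part d \<gamma> f"
      using j(1) i unfolding horizontal_part_def sg
      by (intro UN_I[of j]) (auto simp: F_def k_def)
    then have "psi (\<gamma> j, rclass B) \<in> open_diagram d \<gamma> f"
      by (auto simp: open_diagram_def)
    moreover have "psi (\<gamma> j, rclass B) = p"
      using psi_collar[of "\<gamma> j" B] gamma_pos[of j] j i B by (simp add: lev_def)
    ultimately show ?thesis
      unfolding primitive_diagram_def using closure_subset by blast
  qed
qed

lemma primitive_diagram_eq: "primitive_diagram d \<gamma> f = collar"
  using collar_subset closure_minimal[OF open_diagram_subset closed_collar]
  by (auto simp: primitive_diagram_def)

end

section \<open>The real points of the diagram\<close>

text \<open>\<open>pos\<close> and \<open>neg\<close> are the orthogonal projections to the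
  eigenspaces of \<open>tau\<close>; the two components of a singular matrix have equal
  norm.\<close>

definition pos :: "M2 \<Rightarrow> M2" where "pos A = (1/2) *\<^sub>R (A + tau A)"

definition neg :: "M2 \<Rightarrow> M2" where "neg A = (1/2) *\<^sub>R (A - tau A)"

lemma half_double: "(1/2) *\<^sub>R (x + x) = (x::'a::real_vector)"
  by (simp add: scaleR_2[symmetric])

lemma pos_neg: "pos A + neg A = A" "pos A - neg A = tau A"
  by (simp_all add: pos_def neg_def half_double flip: scaleR_add_right scaleR_diff_right)

lemma tau_pos [simp]: "tau (pos A) = pos A"
  by (simp add: pos_def tau.add tau.scaleR add.commute)

lemma tau_neg [simp]: "tau (neg A) = - neg A"
  by (simp add: neg_def tau.diff tau.scaleR flip: scaleR_minus_right)

lemma linear_pos: "linear pos"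
  by (rule linearI) (simp_all add: pos_def tau.add tau.scaleR algebra_simps)

lemma linear_neg: "linear neg"
  by (rule linearI) (simp_all add: neg_def tau.add tau.scaleR algebra_simps)

lemmas pos_simps = linear_add[OF linear_pos] linear_scale[OF linear_pos] linear_diff[OF linear_pos]
  linear_0[OF linear_pos]

lemmas neg_simps = linear_add[OF linear_neg] linear_scale[OF linear_neg] linear_diff[OF linear_neg]
  linear_0[OF linear_neg]

lemma pos_idem [simp]: "pos (pos A) = pos A" "neg (pos A) = 0" "pos (neg A) = 0" "neg (neg A) = neg A"
  unfolding pos_def[of "pos A"] neg_def[of "pos A"] pos_def[of "neg A"] neg_def[of "neg A"]
  by (simp_all add: half_double)

lemma pos_tau [simp]: "pos (tau A) = pos A" "neg (tau A) = - neg A"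
  by (simp_all add: pos_def neg_def add.commute flip: scaleR_minus_right)

lemma pos_eq_iff: "pos A = A \<longleftrightarrow> tau A = A" "neg A = 0 \<longleftrightarrow> tau A = A"
  "neg A = A \<longleftrightarrow> tau A = - A" "pos A = 0 \<longleftrightarrow> tau A = - A"
  using pos_neg[of A] by (auto simp: pos_def neg_def half_double add_eq_0_iff)

lemma inner_pos_neg [simp]: "pos A \<bullet> neg B = 0" "neg B \<bullet> pos A = 0"
proof -
  have "pos A \<bullet> neg B = tau (pos A) \<bullet> tau (neg B)" by (rule tau.inner[symmetric])
  then show "pos A \<bullet> neg B = 0" by simp
  then show "neg B \<bullet> pos A = 0" by (simp add: inner_commute)
qed

lemma inner_pos: "pos A \<bullet> B = A \<bullet> pos B" "neg A \<bullet> B = A \<bullet> neg B"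
proof -
  have "pos A \<bullet> (pos B + neg B) = (pos A + neg A) \<bullet> pos B"
    by (simp only: inner_add_left inner_add_right inner_pos_neg add_0 add_0_right)
  then show "pos A \<bullet> B = A \<bullet> pos B" by (simp only: pos_neg)
  have "neg A \<bullet> (pos B + neg B) = (pos A + neg A) \<bullet> neg B"
    by (simp only: inner_add_left inner_add_right inner_pos_neg add_0 add_0_right)
  then show "neg A \<bullet> B = A \<bullet> neg B" by (simp only: pos_neg)
qed

lemma inner_tau: "A \<bullet> tau A = (norm (pos A))\<^sup>2 - (norm (neg A))\<^sup>2"
proof -
  have "(pos A + neg A) \<bullet> (pos A - neg A) = (norm (pos A))\<^sup>2 - (norm (neg A))\<^sup>2"
    by (simp add: inner_add_left inner_diff_right power2_norm_eq_inner)
  then show ?thesis by (simp only: pos_neg)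
qed

lemma norm_pos_eq_neg:
  assumes "det B = 0" shows "norm (pos B) = norm (neg B)"
proof -
  have "(norm (pos B))\<^sup>2 = (norm (neg B))\<^sup>2"
    using inner_tau[of B] inner_tau_singular[OF assms] by simp
  then show ?thesis by simp
qed

lemma norm_pos_singular:
  assumes "det B = 0" "B \<noteq> 0" shows "norm (neg B) > 0"
  using norm_pos_eq_neg[OF assms(1)] pos_neg(1)[of B] assms(2) by auto

lemma continuous_on_pos [continuous_intros]: "continuous_on S h \<Longrightarrow> continuous_on S (\<lambda>x. pos (h x))"
  unfolding pos_def by (intro continuous_intros tau.continuous)

lemma continuous_on_neg [continuous_intros]: "continuous_on S h \<Longrightarrow> continuous_on S (\<lambda>x. neg (h x))"
  unfolding neg_def by (intro continuous_intros tau.continuous)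

lemma tau_cscale_ii: "tau (cscale \<i> A) = - cscale \<i> (tau A)"
  by (simp add: tau.antilinear M2_eq_iff)

text \<open>Away from the unitary matrices and in a suitable normalisation, a matrix \<open>A\<close> is
  \<open>B + u \<tau>B\<close> with \<open>B\<close> singular; \<open>retract A\<close> recovers \<open>B\<close> up to a positive factor and
  \<open>ucoord A\<close> recovers \<open>u\<close>.\<close>

definition retract :: "M2 \<Rightarrow> M2" where
  "retract A = norm (neg A) *\<^sub>R pos A + norm (pos A) *\<^sub>R neg A"

definition ucoord :: "M2 \<Rightarrow> real" where
  "ucoord A = (norm (pos A) - norm (neg A)) / (norm (pos A) + norm (neg A))"

lemma pos_collar: "pos (B + u *\<^sub>R tau B) = (1 + u) *\<^sub>R pos B" "neg (B + u *\<^sub>R tau B) = (1 - u) *\<^sub>R neg B"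
  by (simp_all add: pos_simps neg_simps algebra_simps)

text \<open>The components of \<open>B\<close> have equal norm, so those of \<open>A\<close> have
  norms in the ratio \<open>1 + u\<close> to \<open>1 - u\<close>, which determines
  \<open>u\<close>. Weighting each with the norm of the other makes them equal again.\<close>

lemma retract_collar:
  assumes "det B = 0" "B \<noteq> 0" "\<bar>u\<bar> < 1" "r \<noteq> 0" "A = r *\<^sub>R (B + u *\<^sub>R tau B)"
  shows "ucoord A = u" "retract A = (\<bar>r\<bar> * r * (1 - u\<^sup>2) * norm (neg B)) *\<^sub>R B"
    "pos A \<noteq> 0" "neg A \<noteq> 0"
proof -
  let ?b = "norm (neg B)"
  have b: "?b > 0" "norm (pos B) = ?b"
    using assms norm_pos_singular norm_pos_eq_neg by auto
  have p: "pos A = (r * (1 + u)) *\<^sub>R pos B" "neg A = (r * (1 - u)) *\<^sub>R neg B"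
    unfolding assms(5) by (simp_all only: pos_simps(2) neg_simps(2) pos_collar scaleR_scaleR)
  have n: "norm (pos A) = \<bar>r\<bar> * (1 + u) * ?b" "norm (neg A) = \<bar>r\<bar> * (1 - u) * ?b"
    using assms(3) b by (simp_all add: p abs_mult)
  then show "ucoord A = u"
    using b assms by (simp add: ucoord_def field_simps flip: distrib_left)
  have "retract A = (\<bar>r\<bar> * r * (1 - u\<^sup>2) * ?b) *\<^sub>R (pos B + neg B)"
    unfolding retract_def n unfolding p scaleR_add_right by (simp add: power2_eq_square algebra_simps)
  then show "retract A = (\<bar>r\<bar> * r * (1 - u\<^sup>2) * ?b) *\<^sub>R B"
    by (simp only: pos_neg)
  show "pos A \<noteq> 0" "neg A \<noteq> 0"
    using n b assms by auto
qed

context real_structure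
begin

lemma V_pos: "A \<in> V \<Longrightarrow> pos A \<in> V" and V_neg: "A \<in> V \<Longrightarrow> neg A \<in> V"
  by (simp_all add: pos_def neg_def V_scaleR V_add V_diff V_tau)

lemma retract_props:
  assumes "A \<in> V" "pos A \<noteq> 0" "neg A \<noteq> 0"
  shows "retract A \<in> V" "det (retract A) = 0" "retract A \<noteq> 0" "\<bar>ucoord A\<bar> < 1"
    "retract A + ucoord A *\<^sub>R tau (retract A) =
      (2 * norm (pos A) * norm (neg A) / (norm (pos A) + norm (neg A))) *\<^sub>R A"
proof -
  let ?p = "norm (pos A)" and ?q = "norm (neg A)"
  have pq: "?p > 0" "?q > 0" using assms by auto
  show V: "retract A \<in> V"
    using assms by (simp add: retract_def V_add V_scaleR V_pos V_neg)
  have r: "pos (retract A) = ?q *\<^sub>R pos A" "neg (retract A) = ?p *\<^sub>R neg A"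
    by (simp_all add: retract_def pos_simps neg_simps)
  show "det (retract A) = 0"
    unfolding det_V_eq_0[OF V] inner_tau r by simp
  show "retract A \<noteq> 0"
    using r(1) assms pq by (auto simp: pos_simps)
  show "\<bar>ucoord A\<bar> < 1"
    using pq by (simp add: ucoord_def divide_less_eq_1 abs_less_iff add_pos_pos)
  let ?B = "retract A + ucoord A *\<^sub>R tau (retract A)"
  have u: "1 + ucoord A = 2 * ?p / (?p + ?q)" "1 - ucoord A = 2 * ?q / (?p + ?q)"
  proof -
    have "?p + ?q \<noteq> 0" "?q + ?p \<noteq> 0" using pq by linarith+
    then show "1 + ucoord A = 2 * ?p / (?p + ?q)" "1 - ucoord A = 2 * ?q / (?p + ?q)"
      by (simp_all add: ucoord_def field_simps)
  qed
  have "pos ?B + neg ?B = (2 * ?p * ?q / (?p + ?q)) *\<^sub>R (pos A + neg A)"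
    unfolding pos_collar r u scaleR_add_right by simp
  then show "?B = (2 * ?p * ?q / (?p + ?q)) *\<^sub>R A"
    by (simp only: pos_neg)
qed

end

section \<open>Real and imaginary representatives of the real points\<close>

context diagram
begin

text \<open>On \<open>V\<close> the values of \<open>F\<close> are real, and a negative
  \<open>u\<close> stands for the parameter \<open>- u\<close> at \<open>cscale \<i> B\<close>.
  Since consecutive degrees differ by 2, multiplication by i reverses the sign of
  \<open>F (j - 1) B * cnj (F j B)\<close>, whence \<open>sgn u\<close>. No critical level occurs at
  \<open>u = 0\<close>, since \<open>lev j\<close> is positive for \<open>j \<le> k\<close>.\<close>

definition ER :: "real \<Rightarrow> M2 \<Rightarrow> bool" where
  "ER u B \<longleftrightarrow> (\<exists>j\<le>k. lev (Suc j) \<le> \<bar>u\<bar> \<and> \<bar>u\<bar> \<le> lev j \<and> Re (F j B) = 0) \<or>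
     (\<exists>j\<in>{1..k}. \<bar>u\<bar> = lev j \<and> 0 \<le> sgn u * (Re (F (j - 1) B) * Re (F j B)))"

lemma lev_pos: "j \<le> k \<Longrightarrow> 0 < lev j"
  by (auto simp: lev_def)

lemma ER_nonneg:
  assumes "B \<in> V" "0 \<le> s" shows "ER s B \<longleftrightarrow> E s B"
proof -
  have F: "F j B = 0 \<longleftrightarrow> Re (F j B) = 0" if "j \<le> k" for j
    using Im_F[OF that assms(1)] by (simp add: complex_eq_iff)
  have "s = lev j \<and> Im (F (j - 1) B * cnj (F j B)) = 0 \<and> 0 \<le> Re (F (j - 1) B * cnj (F j B)) \<longleftrightarrow>
      \<bar>s\<bar> = lev j \<and> 0 \<le> sgn s * (Re (F (j - 1) B) * Re (F j B))" if "j \<in> {1..k}" for j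
    using Im_F[of j B] Im_F[of "j - 1" B] that assms lev_pos[of j] by auto
  then show ?thesis
    unfolding ER_def E_def using F assms(2) by (intro disj_cong) (auto cong: conj_cong)
qed

lemma ER_neg:
  assumes "B \<in> V" "0 \<le> s" shows "ER (- s) B \<longleftrightarrow> E s (cscale \<i> B)"
proof -
  have F: "F j (cscale \<i> B) = 0 \<longleftrightarrow> Re (F j B) = 0" if "j \<le> k" for j
  proof -
    have "F j (cscale \<i> B) = 0 \<longleftrightarrow> F j B = 0" by (simp add: F_cscale[OF that])
    then show ?thesis using Im_F[OF that assms(1)] by (simp add: complex_eq_iff)
  qed
  have "s = lev j \<and> Im (F (j - 1) (cscale \<i> B) * cnj (F j (cscale \<i> B))) = 0 \<and>
      0 \<le> Re (F (j - 1) (cscale \<i> B) * cnj (F j (cscale \<i> B))) \<longleftrightarrow>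
      \<bar>- s\<bar> = lev j \<and> 0 \<le> sgn (- s) * (Re (F (j - 1) B) * Re (F j B))" if jk: "j \<in> {1..k}" for j
  proof -
    obtain i where i: "j = Suc i" "i < k" by (cases j) (use jk in auto)
    have "F i (cscale \<i> B) * cnj (F j (cscale \<i> B)) =
        (\<i> * cnj \<i>) ^ deg_at d i * (cnj \<i>)\<^sup>2 * (F i B * cnj (F j B))"
      using i by (simp only: F_cscale deg_Suc power_mult_distrib power_add complex_cnj_mult
          complex_cnj_power less_imp_le Suc_leI mult_ac)
    also have "\<dots> = - (F i B * cnj (F j B))"
      by simp
    finally show ?thesis
      using Im_F[of j B] Im_F[of i B] i assms lev_pos[of j] by auto
  qed
  then show ?thesis
    unfolding ER_def E_def using F assms(2) by (intro disj_cong) (auto cong: conj_cong)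
qed

lemma ER_scaleR:
  assumes "B \<in> V" "r \<noteq> 0" shows "ER u (r *\<^sub>R B) \<longleftrightarrow> ER u B"
proof -
  have *: "E s (r *\<^sub>R B) \<longleftrightarrow> E s B" if "r \<noteq> 0" for s r B
  proof -
    have 1: "E s (t *\<^sub>R C)" if "E s C" "t \<noteq> 0" for t C
      using E_cscale[OF that(1), of "of_real t"] that(2) by (simp add: cscale_of_real)
    show ?thesis
      using 1[of B r] 1[of "r *\<^sub>R B" "inverse r"] that by auto
  qed
  show ?thesis
  proof (cases "0 \<le> u")
    case True
    then show ?thesis using * assms by (simp add: ER_nonneg V_scaleR)
  next
    case False
    then have "ER u X \<longleftrightarrow> E (- u) (cscale \<i> X)" if "X \<in> V" for X
      using ER_neg[OF that, of "- u"] by simp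
    then show ?thesis using * assms by (simp add: V_scaleR cscale_scaleR)
  qed
qed

lemma ER_collar:
  assumes "B \<in> V" "B \<noteq> 0" "det B = 0" "ER u B"
  shows "cclass (B + u *\<^sub>R tau B) \<in> collar"
proof (cases "0 \<le> u")
  case True
  then show ?thesis
    using assms ER_nonneg[OF assms(1) True] unfolding collar_def by blast
next
  case False
  then have "E (- u) (cscale \<i> B)"
    using ER_neg[OF assms(1), of "- u"] assms by simp
  moreover have "det (cscale \<i> B) = 0" "cscale \<i> B \<noteq> 0"
    using assms by (simp_all add: det_cscale)
  moreover have "cscale \<i> B + (- u) *\<^sub>R tau (cscale \<i> B) = cscale \<i> (B + u *\<^sub>R tau B)"
    by (simp add: tau_cscale_ii cscale_add cscale_scaleR)
  then have "cclass (B + u *\<^sub>R tau B) = cclass (cscale \<i> B + (- u) *\<^sub>R tau (cscale \<i> B))"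
    using collar_nonzero[OF assms(2,3)] by (simp add: cclass_cscale)
  ultimately show ?thesis
    unfolding collar_def by blast
qed

text \<open>Both \<open>det B\<close> and \<open>det (tau B)\<close> vanish, and the mixed term is
  real. For \<open>s > 0\<close>, comparison with the real determinant of a matrix in
  \<open>V\<close> makes the scalar between the two real or imaginary.\<close>

lemma det_collar:
  assumes "det B = 0" shows "det (B + s *\<^sub>R tau B) = of_real (s * (norm B)\<^sup>2)"
proof (rule complex_eqI)
  have t: "tau (B + s *\<^sub>R tau B) = tau B + s *\<^sub>R B"
    by (simp add: tau.add tau.scaleR)
  have z: "B \<bullet> tau B = 0" "B \<bullet> cscale \<i> (tau B) = 0"
    using assms Re_det[of B] Im_det[of B] by auto
  have z': "tau B \<bullet> cscale \<i> B = 0"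
    using z(2) by (metis cscale_cscale inner_commute inner_ii complex_i_mult_minus inner_minus_right
      cscale_minus1 power2_i power2_eq_square minus_zero neg_equal_0_iff_equal)
  show "Re (det (B + s *\<^sub>R tau B)) = Re (of_real (s * (norm B)\<^sup>2))"
    unfolding Re_det t using z(1)
    by (simp add: inner_add_left inner_add_right power2_norm_eq_inner inner_commute[of "tau B" B])
  show "Im (det (B + s *\<^sub>R tau B)) = Im (of_real (s * (norm B)\<^sup>2))"
    unfolding Im_det t using z z'
    by (simp add: cscale_add cscale_scaleR inner_add_left inner_add_right)
qed

text \<open>Only the interval of index 0 reaches \<open>s = 1\<close>, and in even degree its
  polynomial has no zeros.\<close>

lemma E_one:
  assumes "E 1 B" shows "odd d" "F 0 B = 0"
proof -
  have "lev j < 1" if "1 \<le> j" "j \<le> k" for j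
    using lev_less[of 0 j] that by (simp add: lev_def[of 0])
  then have "\<not> 1 \<le> lev j" if "1 \<le> j" "j \<le> k" for j
    using that by (simp add: not_le)
  then show "F 0 B = 0"
    using assms unfolding E_def by (metis atLeastAtMost_iff less_one not_le order_refl)
  then show "odd d" using F0_even by auto
qed

text \<open>For \<open>s > 0\<close> the scalar \<open>c\<close> relating \<open>A\<close> to
  \<open>B + s *\<^sub>R tau B\<close> has real square; a real \<open>c\<close> gives
  \<open>u = s\<close>, an imaginary one \<open>u = - s\<close>. For \<open>s < 1\<close> the
  rescaled \<open>B\<close> is a combination of \<open>A\<close> and \<open>tau A\<close>, hence in
  \<open>V\<close>. At \<open>s = 1\<close> it cannot be recovered from \<open>A\<close>, so the
  last two cases do not claim that it is real.\<close>

lemma collar_cases: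
  assumes A: "A \<in> V" "A \<noteq> 0" "cclass A \<in> collar"
  obtains (interior) B u r where "B \<in> V" "B \<noteq> 0" "det B = 0" "\<bar>u\<bar> < 1" "r \<noteq> 0"
      "A = r *\<^sub>R (B + u *\<^sub>R tau B)" "ER u B"
    | (pos) B where "odd d" "det B = 0" "F 0 B = 0" "A = B + tau B"
    | (neg) B where "odd d" "det B = 0" "F 0 B = 0" "A = B - tau B"
proof -
  obtain s B where B: "cclass A = cclass (B + s *\<^sub>R tau B)" "B \<noteq> 0" "det B = 0" "E s B"
    using A(3) by (auto simp: collar_def)
  obtain c where c: "c \<noteq> 0" "A = cscale c (B + s *\<^sub>R tau B)"
    using cclass_eq_iff[OF collar_nonzero[OF B(2,3)] A(2)] B(1) by metis
  have s: "0 \<le> s" "s \<le> 1" using E_bounds[OF B(4)] by auto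
  \<comment> \<open>For \<open>s = 0\<close> the determinant says nothing about \<open>c\<close>,
    but \<open>A\<close> itself is singular and serves as \<open>B\<close>.\<close>
  show ?thesis
  proof (cases "s = 0")
    case True
    then have "\<exists>j\<le>k. lev (Suc j) \<le> 0 \<and> 0 \<le> lev j \<and> F j B = 0"
      using B(4) lev_pos unfolding E_def by force
    then have "ER 0 A"
      unfolding ER_def using True c by (auto simp: F_cscale)
    moreover have "det A = 0" using c B True by (simp add: det_cscale)
    ultimately show ?thesis
      using interior[of A 0 1] A by simp
  next
    case False
    then have "s > 0" using s by simp
    have "det A = c\<^sup>2 * of_real (s * (norm B)\<^sup>2)"
      by (simp only: c(2) det_cscale det_collar[OF B(3)])
    then have "Im (c\<^sup>2) * (s * (norm B)\<^sup>2) = 0"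
      using Im_det_V[OF A(1)] by (simp add: mult.commute)
    then have "Im (c\<^sup>2) = 0" using \<open>s > 0\<close> B by simp
    then have "Re c = 0 \<or> Im c = 0" by (auto simp: power2_eq_square)
    show ?thesis
    proof (cases "Im c = 0")
      case True
      then obtain r where r: "c = of_real r" "r \<noteq> 0"
        using c(1) by (metis complex_is_Real_iff Reals_cases of_real_0)
      define B' where "B' = r *\<^sub>R B"
      have A1: "A = B' + s *\<^sub>R tau B'"
        by (simp add: c(2) r(1) cscale_of_real B'_def tau.scaleR scaleR_add_right mult.commute)
      have "tau A = tau B' + s *\<^sub>R B'" unfolding A1 by (simp add: tau.add tau.scaleR)
      note AB = A1 this
      have B': "B' \<noteq> 0" "det B' = 0" "E s B'"
        using B r det_cscale[of "of_real r" B] E_cscale[OF B(4), of "of_real r"]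
        by (simp_all add: B'_def cscale_of_real)
      show ?thesis
      proof (cases "s = 1")
        case True
        then have "odd d" "F 0 B' = 0"
          using B'(3) E_one by auto
        then show ?thesis using pos B' AB True by simp
      next
        case False
        then have "s < 1" using s by simp
        then have "s\<^sup>2 < 1" using s by (simp add: power_less_one_iff abs_square_less_1)
        have "A - s *\<^sub>R tau A = (1 - s\<^sup>2) *\<^sub>R B'"
          unfolding AB(2) by (subst AB(1)) (simp add: algebra_simps power2_eq_square)
        then have "B' = (1 / (1 - s\<^sup>2)) *\<^sub>R (A - s *\<^sub>R tau A)"
          using \<open>s\<^sup>2 < 1\<close> by simp
        then have V: "B' \<in> V" using A by (metis V_diff V_scaleR V_tau)
        then show ?thesis
          using interior[of B' s 1] B' AB \<open>s < 1\<close> s ER_nonneg[OF V s(1)] by simp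
      qed
    next
      case False
      then have "Re c = 0" using \<open>Re c = 0 \<or> Im c = 0\<close> by simp
      then obtain r where r: "c = \<i> * of_real r" "r \<noteq> 0"
        using c(1) by (metis complex_eq False add_0 of_real_0)
      define B' where "B' = cscale (\<i> * of_real r) B"
      have A1: "A = B' - s *\<^sub>R tau B'"
        by (simp add: c(2) r(1) B'_def tau.antilinear M2_eq_iff algebra_simps)
      have "tau A = tau B' - s *\<^sub>R B'" unfolding A1 by (simp add: tau.diff tau.scaleR)
      note AB = A1 this
      have B': "B' \<noteq> 0" "det B' = 0"
        using B r by (simp_all add: B'_def det_cscale)
      have "cscale (of_real (- r)) B = cscale \<i> B'"
        by (simp add: B'_def flip: mult.assoc)
      then have EB': "E s (cscale \<i> B')"
        using E_cscale[OF B(4), of "of_real (- r)"] r by simp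
      show ?thesis
      proof (cases "s = 1")
        case True
        then have "odd d" "F 0 B = 0"
          using B(4) E_one by auto
        then show ?thesis using neg[of B'] B' AB True by (simp add: B'_def F_cscale)
      next
        case False
        then have "s < 1" using s by simp
        then have "s\<^sup>2 < 1" using s by (simp add: power_less_one_iff abs_square_less_1)
        have "A + s *\<^sub>R tau A = (1 - s\<^sup>2) *\<^sub>R B'"
          unfolding AB(2) by (subst AB(1)) (simp add: algebra_simps power2_eq_square)
        then have "B' = (1 / (1 - s\<^sup>2)) *\<^sub>R (A + s *\<^sub>R tau A)"
          using \<open>s\<^sup>2 < 1\<close> by simp
        then have V: "B' \<in> V" using A by (metis V_add V_scaleR V_tau)
        then show ?thesis
          using interior[of B' "- s" 1] B' AB \<open>s < 1\<close> s ER_neg[OF V s(1)] EB' by simp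
      qed
    qed
  qed
qed

lemma collar_interior_iff:
  assumes "A \<in> V" "pos A \<noteq> 0" "neg A \<noteq> 0"
  shows "cclass A \<in> collar \<longleftrightarrow> ER (ucoord A) (retract A)"
proof
  assume "ER (ucoord A) (retract A)"
  then have "cclass (retract A + ucoord A *\<^sub>R tau (retract A)) \<in> collar"
    using retract_props[OF assms] by (intro ER_collar) auto
  moreover have "norm (pos A) + norm (neg A) > 0"
    using assms by (simp add: add_pos_pos)
  ultimately show "cclass A \<in> collar"
    using assms unfolding retract_props(5)[OF assms]
    by (subst (asm) cclass_scaleR) (auto simp: pos_simps)
next
  assume coll: "cclass A \<in> collar"
  have "A \<noteq> 0" using assms by (auto simp: pos_simps)
  from assms(1) this coll show "ER (ucoord A) (retract A)"
  proof (cases rule: collar_cases)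
    case (interior B u r)
    have "u\<^sup>2 < 1" using interior by (simp add: abs_square_less_1)
    then have "\<bar>r\<bar> * r * (1 - u\<^sup>2) * norm (neg B) \<noteq> 0"
      using interior norm_pos_singular[of B] by simp
    then show ?thesis
      using retract_collar[OF interior(3,2,4,5,6)] ER_scaleR[OF interior(1)] interior by simp
  next
    case (pos B)
    then have "tau A = A" by (simp add: tau.add add.commute)
    then show ?thesis using assms pos_eq_iff by blast
  next
    case (neg B)
    then have "tau A = - A" by (simp add: tau.diff)
    then show ?thesis using assms pos_eq_iff by blast
  qed
qed

text \<open>\<open>\<epsilon>\<close> is 1 or -1, for the two kinds of unitary points. Singularity
  puts \<open>X = B - A/2\<close> in the opposite eigenspace with norm exactly
  \<open>norm A / 2\<close>. Since \<open>B\<close> may be nonreal, \<open>Q\<close> arises by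
  symmetrising with \<open>J\<close>, which only bounds its norm: this is the source of the
  inequality.\<close>

lemma unitary_witness:
  assumes "odd d" "A \<in> V" "tau A = \<epsilon> *\<^sub>R A" "\<epsilon> * \<epsilon> = 1"
    and B: "det B = 0" "F 0 B = 0" "tau B = \<epsilon> *\<^sub>R (A - B)"
  obtains Q where "Q \<in> V" "tau Q = - \<epsilon> *\<^sub>R Q" "norm Q \<le> norm A" "F 0 (A + Q) = 0"
proof -
  define X where "X = B - (1/2) *\<^sub>R A"
  have BX: "B = (1/2) *\<^sub>R A + X" by (simp add: X_def)
  have "A - B = (1/2) *\<^sub>R A - X"
    using half_double[of A] unfolding BX scaleR_add_right by (simp add: algebra_simps)
  then have tB: "tau B = \<epsilon> *\<^sub>R ((1/2) *\<^sub>R A - X)" using B(3) by simp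
  have tX: "tau X = - \<epsilon> *\<^sub>R X"
    unfolding X_def tau.diff tau.scaleR tB assms(3) by (simp add: X_def algebra_simps)
  have "((1/2) *\<^sub>R A + X) \<bullet> (\<epsilon> *\<^sub>R ((1/2) *\<^sub>R A - X)) = 0"
    using inner_tau_singular[OF B(1)] unfolding tB by (simp only: BX[symmetric])
  moreover have "\<epsilon> \<noteq> 0" using assms(4) by auto
  ultimately have "((1/2) *\<^sub>R A + X) \<bullet> ((1/2) *\<^sub>R A - X) = 0" by simp
  then have "(norm ((1/2) *\<^sub>R A))\<^sup>2 = (norm X)\<^sup>2"
    by (simp add: power2_norm_eq_inner power_divide inner_add_left inner_diff_right inner_commute[of X A])
  then have nX: "norm X = norm A / 2" by simp
  have JA: "J A = A" using assms(2) by (simp add: V_def)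
  show ?thesis
  proof (rule that)
    show "X + J X \<in> V" by (simp add: V_def add add.commute)
    show "tau (X + J X) = - \<epsilon> *\<^sub>R (X + J X)"
      by (simp add: tau.add tX minus scaleR scaleR_add_right flip: J_tau)
    show "norm (X + J X) \<le> norm A"
      using norm_triangle_ineq[of X "J X"] nX by simp
    have "A + (X + J X) = B + J B"
      unfolding BX add scaleR JA using half_double[of A] by (simp add: scaleR_add_right)
    then have "F 0 (A + (X + J X)) = F 0 B + cnj (F 0 B)"
      using F0_linear[OF assms(1)] F_J[of 0 B] by (simp add: linear_add)
    then show "F 0 (A + (X + J X)) = 0" using B by simp
  qed
qed

text \<open>The collar supplies a singular matrix that may be nonreal, the right side a real one
  that may be nonsingular. \<open>unitary_witness\<close> leads from the former to the latter,
  \<open>fibre_of_unitary_part\<close> back.\<close>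

lemma collar_pos_iff:
  assumes "A \<in> V" "A \<noteq> 0" "tau A = A"
  shows "cclass A \<in> collar \<longleftrightarrow>
    odd d \<and> (\<exists>Q\<in>V. tau Q = - Q \<and> norm Q \<le> norm A \<and> F 0 (A + Q) = 0)"
proof
  assume "cclass A \<in> collar"
  with assms(1,2) show "odd d \<and> (\<exists>Q\<in>V. tau Q = - Q \<and> norm Q \<le> norm A \<and> F 0 (A + Q) = 0)"
  proof (cases rule: collar_cases)
    case (interior B u r)
    then show ?thesis
      using retract_collar(4)[OF interior(3,2,4,5,6)] assms(3) pos_eq_iff(2) by blast
  next
    case (neg B)
    then have "tau A = - A" by (simp add: tau.diff)
    then have "A = - A" using assms by simp
    then have "A = 0" using half_double[of A] by (metis add.right_inverse scaleR_zero_right)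
    then show ?thesis using assms by simp
  next
    case (pos B)
    then have tB: "tau B = 1 *\<^sub>R (A - B)" "tau A = 1 *\<^sub>R A" using assms(3) by simp_all
    obtain Q where "Q \<in> V" "tau Q = - 1 *\<^sub>R Q" "norm Q \<le> norm A" "F 0 (A + Q) = 0"
      by (rule unitary_witness[OF pos(1) assms(1) tB(2) mult_1 pos(2,3) tB(1)]) (rule that)
    then show ?thesis using pos(1) by auto
  qed
next
  assume "odd d \<and> (\<exists>Q\<in>V. tau Q = - Q \<and> norm Q \<le> norm A \<and> F 0 (A + Q) = 0)"
  then obtain Q where odd: "odd d" and Q: "Q \<in> V" "tau Q = - Q" "norm Q \<le> norm A" "F 0 (A + Q) = 0"
    by blast
  let ?W = "(1/2) *\<^sub>R A" and ?Y = "(1/2) *\<^sub>R Q"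
  have e: "?W + ?Y = (1/2) *\<^sub>R (A + Q)" by (simp add: scaleR_add_right)
  have "Im (det (?W + ?Y)) = 0" unfolding e using assms Q by (intro Im_det_V V_scaleR V_add)
  moreover have "F 0 (?W + ?Y) = 0" unfolding e using Q F0_linear[OF odd] by (simp add: linear_scale)
  ultimately obtain B where B: "det B = 0" "F 0 B = 0" "B + tau B = A"
    using fibre_of_unitary_part[of ?W ?Y "F 0"] F0_linear[OF odd] assms Q by (auto simp: tau.scaleR)
  moreover have "B \<noteq> 0" using B assms by auto
  moreover have "E 1 B"
    unfolding E_def using B lev_bounds[of "Suc 0"] by (intro disjI1 exI[of _ 0]) (auto simp: lev_def)
  ultimately show "cclass A \<in> collar"
    unfolding collar_def by (intro CollectI exI[of _ 1] exI[of _ B]) simp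
qed

lemma collar_neg_iff:
  assumes "A \<in> V" "A \<noteq> 0" "tau A = - A"
  shows "cclass A \<in> collar \<longleftrightarrow>
    odd d \<and> (\<exists>P\<in>V. tau P = P \<and> norm P \<le> norm A \<and> F 0 (A + P) = 0)"
proof
  assume "cclass A \<in> collar"
  with assms(1,2) show "odd d \<and> (\<exists>P\<in>V. tau P = P \<and> norm P \<le> norm A \<and> F 0 (A + P) = 0)"
  proof (cases rule: collar_cases)
    case (interior B u r)
    then show ?thesis
      using retract_collar(3)[OF interior(3,2,4,5,6)] assms(3) pos_eq_iff(4) by blast
  next
    case (pos B)
    then have "tau A = A" by (simp add: tau.add add.commute)
    then have "A = - A" using assms by simp
    then have "A = 0" using half_double[of A] by (metis add.right_inverse scaleR_zero_right)
    then show ?thesis using assms by simp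
  next
    case (neg B)
    then have tB: "tau B = - 1 *\<^sub>R (A - B)" "tau A = - 1 *\<^sub>R A" using assms(3) by simp_all
    have "- 1 * - 1 = (1::real)" by simp
    then obtain P where "P \<in> V" "tau P = - (- 1) *\<^sub>R P" "norm P \<le> norm A" "F 0 (A + P) = 0"
      by (rule unitary_witness[OF neg(1) assms(1) tB(2) _ neg(2,3) tB(1)]) (rule that)
    then show ?thesis using neg(1) by auto
  qed
next
  assume "odd d \<and> (\<exists>P\<in>V. tau P = P \<and> norm P \<le> norm A \<and> F 0 (A + P) = 0)"
  then obtain P where odd: "odd d" and P: "P \<in> V" "tau P = P" "norm P \<le> norm A" "F 0 (A + P) = 0"
    by blast
  \<comment> \<open>Multiplication by i exchanges the eigenspaces, bringing \<open>A\<close> to that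
    of 1; the factor 1/2 accounts for \<open>B + tau B = 2 *\<^sub>R W\<close>.\<close>
  let ?W = "cscale (\<i> / 2) A" and ?Y = "cscale (\<i> / 2) P"
  have e: "?W + ?Y = cscale (\<i> / 2) (A + P)" by (simp add: cscale_add)
  have "det (?W + ?Y) = - (1/4) * det (A + P)"
    unfolding e by (simp add: det_cscale power_divide)
  then have "Im (det (?W + ?Y)) = 0" using Im_det_V[of "A + P"] assms P by (simp add: V_add)
  moreover have "F 0 (?W + ?Y) = 0" unfolding e using P by (simp add: F_cscale)
  moreover have "tau ?W = ?W" "tau ?Y = - ?Y"
    using assms(3) P(2) by (simp_all add: tau.antilinear M2_eq_iff)
  moreover have "norm ?Y \<le> norm ?W" using P by (simp add: norm_cscale norm_divide)
  ultimately obtain B where B: "det B = 0" "F 0 B = 0" "B + tau B = 2 *\<^sub>R ?W"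
    using fibre_of_unitary_part[of ?W ?Y "F 0"] F0_linear[OF odd] by blast
  then have BA: "B + tau B = cscale \<i> A" by (simp add: M2_eq_iff scaleR_conv_of_real)
  have "B \<noteq> 0" using BA assms by auto
  moreover have "E 1 B"
    unfolding E_def using B lev_bounds[of "Suc 0"] by (intro disjI1 exI[of _ 0]) (auto simp: lev_def)
  moreover have "cclass A = cclass (B + tau B)"
    using assms by (simp add: BA cclass_cscale)
  ultimately show "cclass A \<in> collar"
    unfolding collar_def using B by (intro CollectI exI[of _ 1] exI[of _ B]) simp
qed

end

section \<open>Local coordinates in the plane\<close>

definition C1_fun :: "(real^2 \<Rightarrow> real) \<Rightarrow> bool" where
  "C1_fun g \<longleftrightarrow> (\<exists>D. continuous_on UNIV D \<and> (\<forall>y. (g has_derivative (\<lambda>h. h \<bullet> D y)) (at y)))"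

lemma C1_fun_const: "C1_fun (\<lambda>y. c)"
  unfolding C1_fun_def by (rule exI[of _ "\<lambda>y. 0"]) auto

lemma C1_fun_inner: "C1_fun (\<lambda>y. y \<bullet> a)"
  unfolding C1_fun_def by (rule exI[of _ "\<lambda>y. a"]) (auto intro!: derivative_eq_intros)

lemma C1_fun_nth: "C1_fun (\<lambda>y. y $ i)"
  using C1_fun_inner[of "axis i 1"] by (simp add: inner_axis)

lemma C1_fun_add:
  assumes "C1_fun g" "C1_fun h" shows "C1_fun (\<lambda>y. g y + h y)"
proof -
  obtain D E where D: "continuous_on UNIV D" "\<And>y. (g has_derivative (\<lambda>h. h \<bullet> D y)) (at y)"
    and E: "continuous_on UNIV E" "\<And>y. (h has_derivative (\<lambda>h. h \<bullet> E y)) (at y)"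
    using assms unfolding C1_fun_def by blast
  show ?thesis
    unfolding C1_fun_def
    by (rule exI[of _ "\<lambda>y. D y + E y"])
      (auto intro!: continuous_intros D E derivative_eq_intros simp: inner_add_right)
qed

lemma C1_fun_mult:
  assumes "C1_fun g" "C1_fun h" shows "C1_fun (\<lambda>y. g y * h y)"
proof -
  obtain D E where D: "continuous_on UNIV D" "\<And>y. (g has_derivative (\<lambda>h. h \<bullet> D y)) (at y)"
    and E: "continuous_on UNIV E" "\<And>y. (h has_derivative (\<lambda>h. h \<bullet> E y)) (at y)"
    using assms unfolding C1_fun_def by blast
  have "continuous_on UNIV g" "continuous_on UNIV h"
    using D E by (auto intro!: has_derivative_continuous_on)
  then show ?thesis
    unfolding C1_fun_def
    by (intro exI[of _ "\<lambda>y. g y *\<^sub>R E y + h y *\<^sub>R D y"])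
      (auto intro!: continuous_intros D E derivative_eq_intros simp: inner_add_right algebra_simps)
qed

definition C1_complex :: "(real^2 \<Rightarrow> complex) \<Rightarrow> bool" where
  "C1_complex g \<longleftrightarrow> C1_fun (\<lambda>y. Re (g y)) \<and> C1_fun (\<lambda>y. Im (g y))"

lemma C1_complex_const: "C1_complex (\<lambda>y. c)"
  by (simp add: C1_complex_def C1_fun_const)

lemma C1_complex_of_real: "C1_fun g \<Longrightarrow> C1_complex (\<lambda>y. of_real (g y))"
  by (simp add: C1_complex_def C1_fun_const)

lemma C1_complex_add: "C1_complex g \<Longrightarrow> C1_complex h \<Longrightarrow> C1_complex (\<lambda>y. g y + h y)"
  by (simp add: C1_complex_def C1_fun_add)

lemma C1_complex_mult: "C1_complex g \<Longrightarrow> C1_complex h \<Longrightarrow> C1_complex (\<lambda>y. g y * h y)"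
proof -
  assume gh: "C1_complex g" "C1_complex h"
  have "C1_fun (\<lambda>y. Re (g y) * Re (h y) + (- 1) * (Im (g y) * Im (h y)))"
    using gh by (intro C1_fun_add C1_fun_mult C1_fun_const) (auto simp: C1_complex_def)
  moreover have "C1_fun (\<lambda>y. Re (g y) * Im (h y) + Im (g y) * Re (h y))"
    using gh by (intro C1_fun_add C1_fun_mult) (auto simp: C1_complex_def)
  ultimately show ?thesis by (simp add: C1_complex_def)
qed

lemma C1_complex_power: "C1_complex g \<Longrightarrow> C1_complex (\<lambda>y. g y ^ n)"
  by (induction n) (simp_all add: C1_complex_const C1_complex_mult)

lemma C1_complex_sum: "(\<And>i. i \<in> I \<Longrightarrow> C1_complex (g i)) \<Longrightarrow> C1_complex (\<lambda>y. \<Sum>i\<in>I. g i y)"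
  by (induction I rule: infinite_finite_induct) (simp_all add: C1_complex_const C1_complex_add)

lemma C1_complex_poly:
  assumes "homogeneous_poly m g" "\<And>i j. C1_complex (\<lambda>y. B y $ i $ j)"
  shows "C1_complex (\<lambda>y. g (B y))"
proof -
  obtain a where a: "\<And>A. g A = (\<Sum>e\<in>exponents m. a e * (\<Prod>i\<in>UNIV. \<Prod>j\<in>UNIV. (A$i$j) ^ (e$i$j)))"
    using assms unfolding homogeneous_poly_def by blast
  show ?thesis
    unfolding a prod_2
    by (intro C1_complex_sum C1_complex_mult C1_complex_const C1_complex_power assms(2))
qed

definition pair :: "real \<Rightarrow> real \<Rightarrow> real^2" where "pair a b = vector [a, b]"

lemma pair_nth [simp]: "pair a b $ 1 = a" "pair a b $ 2 = b"
  by (simp_all add: pair_def)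

lemma pair_eq_iff: "(x::real^2) = y \<longleftrightarrow> x$1 = y$1 \<and> x$2 = y$2"
  by (simp add: vec_eq_iff forall_2)

lemma pair_eta [simp]: "pair (x$1) (x$2) = x"
  by (simp add: pair_eq_iff)

lemma pair_conv: "pair a b = a *\<^sub>R axis 1 1 + b *\<^sub>R axis 2 1"
  by (simp add: pair_eq_iff axis_def)

lemma inner_2: "(x::real^2) \<bullet> y = x$1 * y$1 + x$2 * y$2"
  by (simp add: inner_vec_def sum_2)

lemma continuous_on_pair [continuous_intros]:
  "continuous_on S g \<Longrightarrow> continuous_on S h \<Longrightarrow> continuous_on S (\<lambda>x. pair (g x) (h x))"
  unfolding pair_conv by (intro continuous_intros)

lemma C1_local_homeomorphism:
  assumes "C1_fun g" "C1_fun h"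
    and g: "(g has_derivative (\<lambda>x. x \<bullet> a)) (at x0)" and h: "(h has_derivative (\<lambda>x. x \<bullet> b)) (at x0)"
    and det: "a$1 * b$2 - a$2 * b$1 \<noteq> 0"
  obtains U V k where "open U" "x0 \<in> U" "open V" "homeomorphism U V (\<lambda>y. pair (g y) (h y)) k"
proof -
  obtain D E where D: "continuous_on UNIV D" "\<And>y. (g has_derivative (\<lambda>h. h \<bullet> D y)) (at y)"
    and E: "continuous_on UNIV E" "\<And>y. (h has_derivative (\<lambda>h. h \<bullet> E y)) (at y)"
    using assms(1,2) unfolding C1_fun_def by blast
  have "(\<lambda>x. x \<bullet> D x0) = (\<lambda>x. x \<bullet> a)" "(\<lambda>x. x \<bullet> E x0) = (\<lambda>x. x \<bullet> b)"
    using has_derivative_unique D(2) E(2) g h by blast+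
  then have ab: "D x0 = a" "E x0 = b"
    by (metis vector_eq_ldot)+
  define L where "L y = Blinfun (\<lambda>v. pair (v \<bullet> D y) (v \<bullet> E y))" for y
  have L: "blinfun_apply (L y) = (\<lambda>v. pair (v \<bullet> D y) (v \<bullet> E y))" for y
    unfolding L_def pair_conv
    by (intro bounded_linear_Blinfun_apply bounded_linear_intros)
  \<comment> \<open>\<open>M\<close> inverts the Jacobian matrix at \<open>x0\<close> by Cramer's
    rule.\<close>
  define \<delta> where "\<delta> = a$1 * b$2 - a$2 * b$1"
  define M where "M = Blinfun (\<lambda>v. pair (v \<bullet> pair (b$2 / \<delta>) (- a$2 / \<delta>)) (v \<bullet> pair (- b$1 / \<delta>) (a$1 / \<delta>)))"
  have M: "blinfun_apply M = (\<lambda>v. pair (v \<bullet> pair (b$2 / \<delta>) (- a$2 / \<delta>)) (v \<bullet> pair (- b$1 / \<delta>) (a$1 / \<delta>)))"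
    unfolding M_def pair_conv
    by (intro bounded_linear_Blinfun_apply bounded_linear_intros)
  have d0: "\<delta> \<noteq> 0" using det by (simp add: \<delta>_def)
  have "((\<lambda>y. pair (g y) (h y)) has_derivative blinfun_apply (L y)) (at y)" for y
    unfolding L pair_conv by (auto intro!: derivative_eq_intros D E)
  moreover have "continuous_on UNIV L"
  proof (rule continuous_on_blinfun_componentwise)
    show "continuous_on UNIV (\<lambda>y. blinfun_apply (L y) i)" for i
      unfolding L by (intro continuous_intros D E)
  qed
  moreover have "M o\<^sub>L L x0 = id_blinfun"
  proof (rule blinfun_eqI)
    fix v :: "real^2"
    have "((v$1 * a$1 + v$2 * a$2) * b$2 - (v$1 * b$1 + v$2 * b$2) * a$2) / \<delta> = v$1"
      "((v$1 * b$1 + v$2 * b$2) * a$1 - (v$1 * a$1 + v$2 * a$2) * b$1) / \<delta> = v$2"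
      using d0 by (simp_all add: field_simps) (simp_all add: \<delta>_def algebra_simps)
    then show "blinfun_apply (M o\<^sub>L L x0) v = blinfun_apply id_blinfun v"
      by (simp add: M L ab pair_eq_iff inner_2 diff_divide_distrib)
  qed
  ultimately obtain U V k where "open U" "x0 \<in> U" "open V" "homeomorphism U V (\<lambda>y. pair (g y) (h y)) k"
    using inverse_function_theorem[of UNIV "\<lambda>y. pair (g y) (h y)" L x0 M] by (metis UNIV_I open_UNIV)
  then show ?thesis by (rule that)
qed

text \<open>Near a point the sign of a nonvanishing function may be represented by any coordinate
  that does not vanish, so only the vanishing functions constrain the coordinates.\<close>

lemma sign_coordinates:
  assumes "C1_fun g" "C1_fun h"
    and g: "(g has_derivative (\<lambda>x. x \<bullet> a)) (at 0)" and h: "(h has_derivative (\<lambda>x. x \<bullet> b)) (at 0)"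
    and a: "g 0 = 0 \<Longrightarrow> a \<noteq> 0" and b: "h 0 = 0 \<Longrightarrow> b \<noteq> 0"
    and ab: "g 0 = 0 \<Longrightarrow> h 0 = 0 \<Longrightarrow> a$1 * b$2 - a$2 * b$1 \<noteq> 0"
  obtains U V and \<Phi> :: "real^2 \<Rightarrow> real^2" and k where "open U" "0 \<in> U" "open V" "homeomorphism U V \<Phi> k"
    "\<And>y. y \<in> U \<Longrightarrow> sgn (\<Phi> y $ 1) = sgn (g y)" "\<And>y. y \<in> U \<Longrightarrow> sgn (\<Phi> y $ 2) = sgn (h y)"
proof -
  \<comment> \<open>A function that is nonzero at 0 is replaced by an affine one with the same value
    there. Its gradient is the other gradient turned by a right angle, so the Jacobian is a sum of
    two squares; if neither function vanishes, the axes serve.\<close>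
  define a' where "a' = (if g 0 = 0 then a else if h 0 = 0 then pair (b$2) (- b$1) else pair 1 0)"
  define b' where "b' = (if h 0 = 0 then b else if g 0 = 0 then pair (- a$2) (a$1) else pair 0 1)"
  define g' where "g' = (if g 0 = 0 then g else (\<lambda>y. g 0 + y \<bullet> a'))"
  define h' where "h' = (if h 0 = 0 then h else (\<lambda>y. h 0 + y \<bullet> b'))"
  have nz: "x$1 * x$1 + x$2 * x$2 > 0" if "x \<noteq> 0" for x :: "real^2"
    using that by (auto simp: pair_eq_iff sum_squares_gt_zero_iff)
  have det: "a'$1 * b'$2 - a'$2 * b'$1 \<noteq> 0"
  proof (cases "g 0 = 0"; cases "h 0 = 0")
    assume "g 0 \<noteq> 0" "h 0 = 0"
    then have "b$2 * b$2 - - b$1 * b$1 > 0" using nz[OF b] by (simp add: add.commute)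
    then show ?thesis using \<open>g 0 \<noteq> 0\<close> \<open>h 0 = 0\<close> by (auto simp: a'_def b'_def)
  next
    assume "g 0 = 0" "h 0 \<noteq> 0"
    then have "a$1 * a$1 - a$2 * (- a$2) > 0" using nz[OF a] by simp
    then show ?thesis using \<open>g 0 = 0\<close> \<open>h 0 \<noteq> 0\<close> by (auto simp: a'_def b'_def)
  qed (use ab in \<open>simp_all add: a'_def b'_def\<close>)
  have C: "C1_fun g'" "C1_fun h'"
    using assms(1,2) by (auto simp: g'_def h'_def intro!: C1_fun_add C1_fun_const C1_fun_inner)
  have Dg: "(g' has_derivative (\<lambda>x. x \<bullet> a')) (at 0)"
    using g by (auto simp: g'_def a'_def intro!: derivative_eq_intros)
  have Dh: "(h' has_derivative (\<lambda>x. x \<bullet> b')) (at 0)"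
    using h by (auto simp: h'_def b'_def intro!: derivative_eq_intros)
  obtain U V k where U: "open U" "0 \<in> U" "open V" "homeomorphism U V (\<lambda>y. pair (g' y) (h' y)) k"
    by (rule C1_local_homeomorphism[OF C Dg Dh det])
  have cont: "continuous_on UNIV \<phi>" if C: "C1_fun \<phi>" for \<phi>
  proof -
    obtain D where "\<And>y. (\<phi> has_derivative (\<lambda>h. h \<bullet> D y)) (at y)"
      using C unfolding C1_fun_def by blast
    then show ?thesis by (auto intro!: has_derivative_continuous_on)
  qed
  \<comment> \<open>Where a function is nonzero at 0, the neighbourhood is cut down until the
    function and its replacement both keep that sign.\<close>
  define P where "P \<phi> \<phi>' = {y. (\<phi>::real^2 \<Rightarrow> real) 0 = 0 \<or> (\<phi> y * \<phi> 0 > 0 \<and> \<phi>' y * \<phi> 0 > 0)}" for \<phi> \<phi>'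
  have P: "open (P \<phi> \<phi>')" if "C1_fun \<phi>" "C1_fun \<phi>'" for \<phi> \<phi>'
    unfolding P_def using cont[OF that(1)] cont[OF that(2)]
    by (cases "\<phi> 0 = 0") (auto intro!: open_Collect_conj open_Collect_less continuous_intros)
  define U' where "U' = U \<inter> (P g g' \<inter> P h h')"
  let ?\<Phi> = "\<lambda>y. pair (g' y) (h' y)"
  have op: "openin (top_of_set U) U'"
    unfolding U'_def using P C assms(1,2) by (intro openin_open_Int open_Int)
  have "homeomorphism U' (?\<Phi> ` U') ?\<Phi> k"
    by (rule homeomorphism_of_subsets[OF U(4) _ order_refl refl]) (simp add: U'_def)
  moreover have "open (?\<Phi> ` U')"
    using homeomorphism_imp_open_map[OF U(4) op] openin_open_eq[OF U(3)] by blast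
  moreover have "open U'" using op openin_open_eq[OF U(1)] by blast
  moreover have "0 \<in> U'"
    using U(2) by (auto simp: U'_def P_def g'_def h'_def not_sum_squares_lt_zero zero_less_mult_iff)
  moreover have sg: "sgn (\<phi>' y) = sgn (\<phi> y)" if "y \<in> P \<phi> \<phi>'" "\<phi> 0 = 0 \<Longrightarrow> \<phi>' = \<phi>" for \<phi> \<phi>' y
    using that by (cases "\<phi> 0 = 0") (auto simp: P_def zero_less_mult_iff)
  have "sgn (?\<Phi> y $ 1) = sgn (g y)" "sgn (?\<Phi> y $ 2) = sgn (h y)" if "y \<in> U'" for y
    using that sg[of y g g'] sg[of y h h'] by (auto simp: U'_def g'_def h'_def)
  ultimately show ?thesis by (intro that[of U' "?\<Phi> ` U'" ?\<Phi> k])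
qed

section \<open>The crossing surface\<close>

text \<open>The local model of a diagram at a critical level: two opposite quadrants at height 0, a
  vertical half-plane above one coordinate axis and one below the other. In the plane the six
  half-axes bounding its sectors become the half-lines through the vertices of a hexagon.\<close>

definition crossing :: "real \<Rightarrow> real \<Rightarrow> real \<Rightarrow> bool" where
  "crossing x y t \<longleftrightarrow> t = 0 \<and> 0 \<le> x * y \<or> 0 \<le> t \<and> y = 0 \<or> t \<le> 0 \<and> x = 0"

text \<open>The half-axes \<open>+x, +y, -t, -y, -x, +t\<close> go in this cyclic order to (1,0),
  (0,1), (-1,1), (-1,0), (0,-1), (1,-1). Each sector of the crossing is spanned by two neighbours,
  and the map is linear on it.\<close>

definition flatten :: "real \<Rightarrow> real \<Rightarrow> real \<Rightarrow> real^2" where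
  "flatten x y t = pair (max x 0 + min y 0 + t) (max y 0 + min x 0 - t)"

definition cx :: "real^2 \<Rightarrow> real" where "cx w = max (w$1) 0 + min (w$2) 0"
definition cy :: "real^2 \<Rightarrow> real" where "cy w = max (w$2) 0 + min (w$1) 0"
definition ct :: "real^2 \<Rightarrow> real" where
  "ct w = max 0 (min (w$1) (- w$2)) - max 0 (min (- w$1) (w$2))"

lemma crossing_sgn: "sgn x = sgn x' \<Longrightarrow> sgn y = sgn y' \<Longrightarrow> crossing x y t \<longleftrightarrow> crossing x' y' t"
  by (auto simp: crossing_def zero_le_mult_iff sgn_if split: if_splits)

lemma crossing_unflatten: "crossing (cx w) (cy w) (ct w)"
  by (auto simp: crossing_def cx_def cy_def ct_def max_def min_def zero_le_mult_iff)

lemma flatten_unflatten: "flatten (cx w) (cy w) (ct w) = w"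
  by (auto simp: flatten_def cx_def cy_def ct_def max_def min_def pair_eq_iff)

lemma unflatten_flatten:
  assumes "crossing x y t"
  shows "cx (flatten x y t) = x" "cy (flatten x y t) = y" "ct (flatten x y t) = t"
  using assms
  by (auto simp: crossing_def flatten_def cx_def cy_def ct_def max_def min_def zero_le_mult_iff)

lemma continuous_on_crossing [continuous_intros]:
  "continuous_on S cx" "continuous_on S cy" "continuous_on S ct"
  unfolding cx_def[abs_def] cy_def[abs_def] ct_def[abs_def] by (intro continuous_intros)+

lemma continuous_on_flatten [continuous_intros]:
  "continuous_on S g \<Longrightarrow> continuous_on S h \<Longrightarrow> continuous_on S k \<Longrightarrow>
    continuous_on S (\<lambda>x. flatten (g x) (h x) (k x))"
  unfolding flatten_def by (intro continuous_intros)

section \<open>Derivatives and the smoothness assumptions\<close>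

lemma has_derivative_entry: "((\<lambda>A::M2. A $ i $ j) has_derivative (\<lambda>X. X $ i $ j)) (at A)"
  by (intro bounded_linear_imp_has_derivative bounded_linear_compose[OF bounded_linear_vec_nth]
      bounded_linear_vec_nth)

text \<open>A Frechet derivative is a priori only real linear; complex linearity carries conditions
  between \<open>V\<close> and its complexification.\<close>

definition complex_diff :: "(M2 \<Rightarrow> complex) \<Rightarrow> M2 \<Rightarrow> bool" where
  "complex_diff g A \<longleftrightarrow> (\<exists>D. (g has_derivative D) (at A) \<and> (\<forall>c X. D (cscale c X) = c * D X))"

lemma complex_diff_const: "complex_diff (\<lambda>A. c) A"
  unfolding complex_diff_def by (rule exI[of _ "\<lambda>X. 0"]) auto

lemma complex_diff_entry: "complex_diff (\<lambda>A. A $ i $ j) A"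
  unfolding complex_diff_def by (intro exI[of _ "\<lambda>X. X $ i $ j"] conjI has_derivative_entry) auto

lemma complex_diff_add:
  assumes "complex_diff g A" "complex_diff h A" shows "complex_diff (\<lambda>A. g A + h A) A"
proof -
  obtain D E where "(g has_derivative D) (at A)" "(h has_derivative E) (at A)"
    "\<forall>c X. D (cscale c X) = c * D X" "\<forall>c X. E (cscale c X) = c * E X"
    using assms unfolding complex_diff_def by blast
  then show ?thesis
    unfolding complex_diff_def
    by (intro exI[of _ "\<lambda>X. D X + E X"]) (auto intro!: derivative_intros simp: algebra_simps)
qed

lemma complex_diff_mult:
  assumes "complex_diff g A" "complex_diff h A" shows "complex_diff (\<lambda>A. g A * h A) A"
proof -
  obtain D E where "(g has_derivative D) (at A)" "(h has_derivative E) (at A)"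
    "\<forall>c X. D (cscale c X) = c * D X" "\<forall>c X. E (cscale c X) = c * E X"
    using assms unfolding complex_diff_def by blast
  then show ?thesis
    unfolding complex_diff_def
    by (intro exI[of _ "\<lambda>X. g A * E X + D X * h A"] conjI has_derivative_mult)
      (auto simp: algebra_simps)
qed

lemma complex_diff_power: "complex_diff g A \<Longrightarrow> complex_diff (\<lambda>A. g A ^ n) A"
  by (induction n) (simp_all add: complex_diff_const complex_diff_mult)

lemma complex_diff_sum: "(\<And>i. i \<in> I \<Longrightarrow> complex_diff (g i) A) \<Longrightarrow> complex_diff (\<lambda>A. \<Sum>i\<in>I. g i A) A"
  by (induction I rule: infinite_finite_induct) (simp_all add: complex_diff_const complex_diff_add)

lemma homogeneous_poly_diff:
  assumes "homogeneous_poly m g"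
  shows "(g has_derivative frechet_derivative g (at A)) (at A)"
    "frechet_derivative g (at A) (cscale c X) = c * frechet_derivative g (at A) X"
proof -
  obtain a where a: "\<And>A. g A = (\<Sum>e\<in>exponents m. a e * (\<Prod>i\<in>UNIV. \<Prod>j\<in>UNIV. (A$i$j) ^ (e$i$j)))"
    using assms unfolding homogeneous_poly_def by blast
  have g: "g = (\<lambda>A. \<Sum>e\<in>exponents m. a e * (\<Prod>i\<in>UNIV. \<Prod>j\<in>UNIV. (A$i$j) ^ (e$i$j)))"
    using a by blast
  have "complex_diff g A"
    unfolding g prod_2
    by (intro complex_diff_sum complex_diff_mult complex_diff_const complex_diff_power complex_diff_entry)
  then obtain D where D: "(g has_derivative D) (at A)" "\<forall>c X. D (cscale c X) = c * D X"
    unfolding complex_diff_def by blast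
  have "D = frechet_derivative g (at A)"
    by (rule frechet_derivative_at[OF D(1)])
  then show "(g has_derivative frechet_derivative g (at A)) (at A)"
    "frechet_derivative g (at A) (cscale c X) = c * frechet_derivative g (at A) X"
    using D by auto
qed

text \<open>The determinant has gradient \<open>tau B\<close> at \<open>B\<close>, so
  \<open>tangent_quadric B\<close> is the complex orthogonal complement of
  \<open>tau B\<close>.\<close>

lemma frechet_derivative_det:
  "frechet_derivative det (at B) X = Complex (X \<bullet> tau B) (X \<bullet> cscale \<i> (tau B))"
proof -
  have "((\<lambda>A::M2. A$1$1 * A$2$2 - A$1$2 * A$2$1) has_derivative
      (\<lambda>X. B$1$1 * X$2$2 + X$1$1 * B$2$2 - (B$1$2 * X$2$1 + X$1$2 * B$2$1))) (at B)"
    by (intro has_derivative_diff has_derivative_mult has_derivative_entry)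
  then have "(det has_derivative
      (\<lambda>X. B$1$1 * X$2$2 + X$1$1 * B$2$2 - (B$1$2 * X$2$1 + X$1$2 * B$2$1))) (at B)"
    by (simp add: det_2[abs_def])
  then have "frechet_derivative det (at B) =
      (\<lambda>X. B$1$1 * X$2$2 + X$1$1 * B$2$2 - (B$1$2 * X$2$1 + X$1$2 * B$2$1))"
    by (rule frechet_derivative_at[symmetric])
  then show ?thesis
    by (simp add: complex_eq_iff inner_M2 inner_complex_def algebra_simps)
qed

section \<open>\<open>V\<close> as a real form of the space of matrices\<close>

context real_structure
begin

lemma V_inner_ii:
  assumes "A \<in> V" "B \<in> V" shows "A \<bullet> cscale \<i> B = 0"
proof -
  have "J (cscale \<i> B) = - cscale \<i> B"
    using assms(2) by (simp add: V_def antilinear M2_eq_iff)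
  then show ?thesis
    using inner[of A "cscale \<i> B"] assms(1) by (simp add: V_def)
qed

lemma V_decompose:
  obtains X1 X2 where "X1 \<in> V" "X2 \<in> V" "X = X1 + cscale \<i> X2"
proof (rule that)
  show "(1/2) *\<^sub>R (X + J X) \<in> V" by (simp add: V_def scaleR add add.commute)
  show "cscale (- \<i> / 2) (X - J X) \<in> V"
    by (simp add: V_def antilinear diff M2_eq_iff algebra_simps)
  show "X = (1/2) *\<^sub>R (X + J X) + cscale \<i> (cscale (- \<i> / 2) (X - J X))"
    by (simp add: M2_eq_iff scaleR_conv_of_real[where 'a = complex] field_simps)
qed

end

text \<open>\<open>B0\<close>, \<open>tau B0\<close>, \<open>e1\<close>, \<open>e2\<close> form an
  orthonormal basis of \<open>V\<close>. At \<open>B0\<close> the cone of singular matrices has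
  radial direction \<open>B0\<close> and normal \<open>tau B0\<close>, so \<open>e1\<close> and
  \<open>e2\<close> span the tangent plane of the real quadric.\<close>

locale collar_frame = diagram +
  fixes B0 e1 e2 :: M2
  assumes B0: "B0 \<in> V" "norm B0 = 1" "det B0 = 0"
    and e: "e1 \<in> V" "e2 \<in> V" "norm e1 = 1" "norm e2 = 1" "e1 \<bullet> e2 = 0"
    and perp: "e1 \<bullet> B0 = 0" "e1 \<bullet> tau B0 = 0" "e2 \<bullet> B0 = 0" "e2 \<bullet> tau B0 = 0"
begin

lemma B0_tau: "B0 \<bullet> tau B0 = 0" "tau B0 \<bullet> B0 = 0" "B0 \<bullet> B0 = 1" "tau B0 \<bullet> tau B0 = 1"
  using inner_tau_singular[OF B0(3)] B0(2) by (simp_all add: inner_commute norm_eq_1)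

lemma e_inner: "e1 \<bullet> e1 = 1" "e2 \<bullet> e2 = 1" "e2 \<bullet> e1 = 0"
  "B0 \<bullet> e1 = 0" "B0 \<bullet> e2 = 0" "tau B0 \<bullet> e1 = 0" "tau B0 \<bullet> e2 = 0"
  using e perp by (simp_all add: norm_eq_1 inner_commute)

lemma expand: "X \<in> V \<Longrightarrow>
  X = (X \<bullet> B0) *\<^sub>R B0 + (X \<bullet> tau B0) *\<^sub>R tau B0 + (X \<bullet> e1) *\<^sub>R e1 + (X \<bullet> e2) *\<^sub>R e2"
  using e B0 by (intro orthonormal_expand[OF subspace_V dim_V]) (simp_all add: V_tau B0_tau e_inner)

text \<open>The tangent space of the complex quadric cone is the complexification of the span of
  \<open>B0\<close>, \<open>e1\<close>, \<open>e2\<close>. Thus smoothness and transversality,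
  stated for complex tangent vectors, become statements on two real derivatives.\<close>

lemma linear_vanish_tangent:
  assumes D: "linear D" "\<And>c X. D (cscale c X) = c * (D X :: complex)"
    and "D B0 = 0" "D e1 = 0" "D e2 = 0" "X \<in> tangent_quadric B0"
  shows "D X = 0"
proof -
  obtain X1 X2 where X: "X1 \<in> V" "X2 \<in> V" "X = X1 + cscale \<i> X2" by (rule V_decompose)
  have "X \<bullet> tau B0 = 0" "X \<bullet> cscale \<i> (tau B0) = 0"
    using assms(6) by (auto simp: tangent_quadric_def frechet_derivative_det complex_eq_iff)
  then have "X1 \<bullet> tau B0 = 0" "X2 \<bullet> tau B0 = 0"
    using V_inner_ii[OF X(1) V_tau[OF B0(1)]] V_inner_ii[OF X(2) V_tau[OF B0(1)]]
    by (simp_all add: X(3) inner_add_left inner_ii inner_ii_flip)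
  then have "X1 = (X1 \<bullet> B0) *\<^sub>R B0 + (X1 \<bullet> e1) *\<^sub>R e1 + (X1 \<bullet> e2) *\<^sub>R e2"
    "X2 = (X2 \<bullet> B0) *\<^sub>R B0 + (X2 \<bullet> e1) *\<^sub>R e1 + (X2 \<bullet> e2) *\<^sub>R e2"
    using expand[OF X(1)] expand[OF X(2)] by simp_all
  moreover have "D (a *\<^sub>R B0 + b *\<^sub>R e1 + c *\<^sub>R e2) = 0" for a b c
    using D(1) assms by (simp add: linear_add linear_scale)
  ultimately have "D X1 = 0" "D X2 = 0" by metis+
  then show ?thesis using D by (simp add: X(3) linear_add)
qed

definition DF :: "nat \<Rightarrow> M2 \<Rightarrow> complex" where "DF j = frechet_derivative (F j) (at B0)"

lemma DF: "j \<le> k \<Longrightarrow> (F j has_derivative DF j) (at B0)" "j \<le> k \<Longrightarrow> DF j (cscale c X) = c * DF j X"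
  unfolding DF_def using homogeneous_poly_diff[OF homog] by blast+

lemma linear_DF: "j \<le> k \<Longrightarrow> linear (DF j)"
  using DF(1) has_derivative_linear by blast

lemma DF_line:
  assumes "j \<le> k"
  shows "((\<lambda>t::real. F j (B0 + t *\<^sub>R X)) has_derivative (\<lambda>t. DF j (t *\<^sub>R X))) (at 0)"
proof -
  have "((\<lambda>t::real. B0 + t *\<^sub>R X) has_derivative (\<lambda>t. t *\<^sub>R X)) (at 0)"
    by (auto intro!: derivative_eq_intros)
  moreover have "(F j has_derivative DF j) (at (B0 + 0 *\<^sub>R X))" using DF(1)[OF assms] by simp
  ultimately show ?thesis
    using has_derivative_compose[of "\<lambda>t. B0 + t *\<^sub>R X" "\<lambda>t. t *\<^sub>R X" 0 UNIV "F j" "DF j"] by simp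
qed

text \<open>Euler's relation: a homogeneous polynomial that vanishes at \<open>B0\<close> vanishes
  on the line through it.\<close>

lemma DF_B0:
  assumes "j \<le> k" "F j B0 = 0" shows "DF j B0 = 0"
proof -
  have "F j (B0 + t *\<^sub>R B0) = 0" for t
    using F_scaleR[OF assms(1), of "1 + t" B0] assms(2) by (simp add: scaleR_add_left)
  then have "((\<lambda>t::real. 0::complex) has_derivative (\<lambda>t. DF j (t *\<^sub>R B0))) (at 0)"
    using DF_line[OF assms(1), of B0] by simp
  then have "(\<lambda>t. DF j (t *\<^sub>R B0)) = (\<lambda>t. 0)"
    by (rule has_derivative_unique) (rule has_derivative_const)
  then show ?thesis by (metis scaleR_one)
qed

lemma Im_DF:
  assumes "j \<le> k" "X \<in> V" shows "Im (DF j X) = 0"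
proof -
  have "Im (F j (B0 + t *\<^sub>R X)) = 0" for t
    using Im_F[OF assms(1)] assms(2) B0(1) by (simp add: V_add V_scaleR)
  then have "((\<lambda>t::real. 0::real) has_derivative (\<lambda>t. Im (DF j (t *\<^sub>R X)))) (at 0)"
    using has_derivative_Im[OF DF_line[OF assms(1), of X]] by simp
  then have "(\<lambda>t. Im (DF j (t *\<^sub>R X))) = (\<lambda>t. 0)"
    by (rule has_derivative_unique) (rule has_derivative_const)
  then show ?thesis by (metis scaleR_one)
qed

lemma B0_nonzero: "B0 \<noteq> 0"
  using B0(2) by auto

lemma smooth:
  assumes "j \<le> k" "F j B0 = 0" shows "\<exists>X\<in>tangent_quadric B0. DF j X \<noteq> 0"
proof -
  have "smooth_curve (F j)"
    using prim degrees[OF assms(1)] unfolding primitive_data_def F_def by blast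
  then show ?thesis
    using B0_nonzero B0(3) assms(2) unfolding smooth_curve_def DF_def by blast
qed

definition grad :: "nat \<Rightarrow> real^2" where "grad j = pair (Re (DF j e1)) (Re (DF j e2))"

lemma grad_nonzero:
  assumes "j \<le> k" "F j B0 = 0" shows "grad j \<noteq> 0"
proof
  assume "grad j = 0"
  then have "DF j e1 = 0" "DF j e2 = 0"
    using Im_DF[OF assms(1)] e by (auto simp: grad_def pair_eq_iff complex_eq_iff)
  then show False
    using smooth[OF assms] linear_vanish_tangent[of "DF j"] linear_DF DF(2) DF_B0 assms by blast
qed

text \<open>Dependent gradients would make the two differentials proportional on the tangent space
  of the quadric, with nonzero factor by smoothness. The curves would share their tangent space, and
  its sum with itself cannot contain a direction \<open>a\<close> where a differential is
  nonzero.\<close>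

lemma grad_independent:
  assumes "Suc i \<le> k" "F i B0 = 0" "F (Suc i) B0 = 0"
  shows "grad i $ 1 * grad (Suc i) $ 2 - grad i $ 2 * grad (Suc i) $ 1 \<noteq> 0"
proof
  let ?f = "DF i" and ?g = "DF (Suc i)"
  assume z: "grad i $ 1 * grad (Suc i) $ 2 - grad i $ 2 * grad (Suc i) $ 1 = 0"
  have i: "i \<le> k" using assms by simp
  have re: "DF j X = of_real (Re (DF j X))" if "j \<le> k" "X \<in> V" for j X
    using Im_DF[OF that] by (simp add: complex_eq_iff)
  have cross: "?f e1 * ?g e2 = ?f e2 * ?g e1"
    using z e by (subst (1 2 3 4) re) (simp_all add: grad_def i assms(1) flip: of_real_mult)
  have "?f e1 \<noteq> 0 \<or> ?f e2 \<noteq> 0"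
    using grad_nonzero[OF i assms(2)] by (auto simp: grad_def pair_eq_iff)
  then obtain a where a: "a \<in> {e1, e2}" "?f a \<noteq> 0" by blast
  have aT: "a \<in> tangent_quadric B0"
    using a e perp V_inner_ii[of a "tau B0"] V_tau[OF B0(1)]
    by (auto simp: tangent_quadric_def frechet_derivative_det complex_eq_iff)
  define D where "D X = ?f a * ?g X - ?g a * ?f X" for X
  have "linear D"
    using linear_DF[OF i] linear_DF[OF assms(1)]
    by (auto simp: D_def linear_iff algebra_simps)
  moreover have "D (cscale c X) = c * D X" for c X
    by (simp add: D_def DF(2)[OF i] DF(2)[OF assms(1)] algebra_simps)
  moreover have "D B0 = 0" "D e1 = 0" "D e2 = 0"
    using a(1) cross DF_B0[OF i assms(2)] DF_B0[OF assms(1,3)] by (auto simp: D_def mult.commute)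
  ultimately have "D X = 0" if "X \<in> tangent_quadric B0" for X
    using linear_vanish_tangent that by blast
  then have g: "?f a * ?g X = ?g a * ?f X" if "X \<in> tangent_quadric B0" for X
    using that by (simp add: D_def)
  have "?g a \<noteq> 0"
    using smooth[OF assms(1,3)] g a(2) by fastforce
  then have fg: "?f X = 0 \<longleftrightarrow> ?g X = 0" if "X \<in> tangent_quadric B0" for X
    using g[OF that] a(2) by auto
  have "transverse_curves (F i) (F (Suc i))"
    using prim degrees[OF i] degrees[OF assms(1)] by (auto simp: primitive_data_def F_def deg_Suc)
  then have "tangent_quadric B0 = {X + Y |X Y. X \<in> tangent_curve (F i) B0 \<and> Y \<in> tangent_curve (F (Suc i)) B0}"
    using B0_nonzero B0(3) assms unfolding transverse_curves_def by blast
  with aT obtain X Y where XY: "a = X + Y" "X \<in> tangent_curve (F i) B0" "Y \<in> tangent_curve (F (Suc i)) B0"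
    by blast
  then have "?f X = 0" "?f Y = 0"
    using fg by (auto simp: tangent_curve_def DF_def)
  then show False
    using a(2) XY(1) linear_DF[OF i] by (simp add: linear_add)
qed

section \<open>Charts at non-unitary points\<close>

definition Ey :: "real^2 \<Rightarrow> M2" where "Ey y = y$1 *\<^sub>R e1 + y$2 *\<^sub>R e2"

definition Q :: "real^2 \<Rightarrow> real" where "Q y = Ey y \<bullet> tau (Ey y)"

text \<open>Chart of the real quadric in the affine slice with \<open>B0\<close>-component 1.
  Singularity reads \<open>2 * r + Q y = 0\<close> and so fixes the coefficient \<open>r\<close> of
  \<open>tau B0\<close>; as \<open>Q\<close> is quadratic, the derivative at 0 is
  \<open>Ey\<close>.\<close>

definition Bp :: "real^2 \<Rightarrow> M2" where "Bp y = B0 + (- Q y / 2) *\<^sub>R tau B0 + Ey y"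

lemma Ey_V: "Ey y \<in> V"
  by (simp add: Ey_def V_add V_scaleR e)

lemma Ey_inner: "Ey y \<bullet> B0 = 0" "Ey y \<bullet> tau B0 = 0" "Ey y \<bullet> e1 = y$1" "Ey y \<bullet> e2 = y$2"
  using perp e e_inner by (simp_all add: Ey_def inner_add_left)

lemma Bp_V: "Bp y \<in> V"
  by (simp add: Bp_def V_add V_diff V_scaleR V_tau B0 Ey_V)

lemma Bp_inner: "Bp y \<bullet> B0 = 1" "Bp y \<bullet> e1 = y$1" "Bp y \<bullet> e2 = y$2"
  by (simp_all add: Bp_def inner_add_left inner_diff_left B0_tau Ey_inner e_inner)

lemma inner_tau_Bp: "(B0 + r *\<^sub>R tau B0 + Ey y) \<bullet> tau (B0 + r *\<^sub>R tau B0 + Ey y) = 2 * r + Q y"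
proof -
  have "tau B0 \<bullet> Ey y = 0" "B0 \<bullet> tau (Ey y) = 0" "tau B0 \<bullet> tau (Ey y) = 0" "B0 \<bullet> Ey y = 0"
    using Ey_inner[of y] by (simp_all add: inner_commute tau.inner_flip[symmetric])
  then show ?thesis
    by (simp add: tau.add tau.scaleR inner_add_left inner_add_right B0_tau Ey_inner Q_def)
qed

lemma det_Bp: "det (Bp y) = 0"
  unfolding det_V_eq_0[OF Bp_V] unfolding Bp_def inner_tau_Bp by simp

lemma Bp_nonzero: "Bp y \<noteq> 0"
  using Bp_inner(1)[of y] by auto

lemma Bp_unique:
  assumes "B \<in> V" "det B = 0" "B \<bullet> B0 = 1" shows "B = Bp (pair (B \<bullet> e1) (B \<bullet> e2))"
proof -
  let ?y = "pair (B \<bullet> e1) (B \<bullet> e2)" and ?r = "B \<bullet> tau B0"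
  have B: "B = B0 + ?r *\<^sub>R tau B0 + Ey ?y"
    using expand[OF assms(1)] assms(3) by (simp add: Ey_def add.assoc)
  have "B \<bullet> tau B = 2 * ?r + Q ?y"
    using inner_tau_Bp[of ?r ?y] by (simp only: B[symmetric])
  then have "?r = - Q ?y / 2"
    using inner_tau_singular[OF assms(2)] by simp
  then show ?thesis
    using B by (simp add: Bp_def)
qed

lemma Bp_0: "Bp 0 = B0"
  by (simp add: Bp_def Q_def Ey_def)

lemma Q_expand: "Q y = (e1 \<bullet> tau e1) * (y$1 * y$1) + (2 * (e1 \<bullet> tau e2)) * (y$1 * y$2)
    + (e2 \<bullet> tau e2) * (y$2 * y$2)"
  using tau.inner_flip[of e2 e1]
  by (simp add: Q_def Ey_def tau.add tau.scaleR inner_add_left inner_add_right inner_commute algebra_simps)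

lemma continuous_on_Bp [continuous_intros]: "continuous_on S g \<Longrightarrow> continuous_on S (\<lambda>x. Bp (g x))"
  unfolding Bp_def Q_expand Ey_def by (intro continuous_intros) auto

lemma C1_F_Bp: "j \<le> k \<Longrightarrow> C1_fun (\<lambda>y. Re (F j (Bp y)))"
proof -
  assume j: "j \<le> k"
  have "C1_complex (\<lambda>y. Bp y $ a $ b)" for a b
  proof -
    have "C1_fun Q"
      unfolding Q_expand[abs_def] by (intro C1_fun_add C1_fun_mult C1_fun_const C1_fun_nth)
    then have "C1_complex (\<lambda>y. B0 $ a $ b + of_real ((- 1 / 2) * Q y) * tau B0 $ a $ b +
        (of_real (y$1) * e1 $ a $ b + of_real (y$2) * e2 $ a $ b))"
      by (intro C1_complex_add C1_complex_mult C1_complex_const C1_complex_of_real C1_fun_mult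
          C1_fun_const C1_fun_nth)
    then show ?thesis
      by (simp add: Bp_def Ey_def scaleR_conv_of_real[where 'a = complex])
  qed
  then show ?thesis
    using C1_complex_poly[OF homog[OF j]] by (simp add: C1_complex_def)
qed

lemma derivative_F_Bp:
  assumes "j \<le> k" shows "((\<lambda>y. Re (F j (Bp y))) has_derivative (\<lambda>h. h \<bullet> grad j)) (at 0)"
proof -
  have nth: "((\<lambda>y::real^2. y $ i) has_derivative (\<lambda>h. h $ i)) (at 0)" for i
    by (intro bounded_linear_imp_has_derivative bounded_linear_vec_nth)
  have "(Q has_derivative (\<lambda>h. 0)) (at 0)"
    unfolding Q_expand[abs_def] by (auto intro!: derivative_eq_intros nth)
  then have "(Bp has_derivative Ey) (at 0)"
    unfolding Bp_def[abs_def] Ey_def[abs_def]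
    by (auto intro!: derivative_eq_intros nth)
  moreover have "(F j has_derivative DF j) (at (Bp 0))"
    using DF(1)[OF assms] by (simp add: Bp_0)
  ultimately have "((\<lambda>y. F j (Bp y)) has_derivative (\<lambda>h. DF j (Ey h))) (at 0)"
    by (rule has_derivative_compose)
  then have "((\<lambda>y. Re (F j (Bp y))) has_derivative (\<lambda>h. Re (DF j (Ey h)))) (at 0)"
    by (rule has_derivative_Re)
  moreover have "Re (DF j (Ey h)) = h \<bullet> grad j" for h
    using linear_DF[OF assms] by (simp add: Ey_def linear_add linear_scale grad_def inner_2)
  ultimately show ?thesis by simp
qed

end

section \<open>Position relative to the critical levels\<close>

context diagram
begin

lemma lev_le: "i \<le> j \<Longrightarrow> j \<le> Suc k \<Longrightarrow> lev j \<le> lev i"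
  using lev_less[of i j] by (cases "i = j") auto

text \<open>The height \<open>lev (Suc i) - \<bar>u\<bar>\<close> is positive towards the quadric,
  where \<open>F (Suc i)\<close> cuts out the vertical piece, and negative towards the unitary
  matrices, where \<open>F i\<close> does. The factor \<open>s\<close> absorbs the sign in
  \<open>ER\<close>.\<close>

lemma ER_at_level:
  assumes i: "Suc i \<le> k" and v: "lev (Suc (Suc i)) < \<bar>u\<bar>" "\<bar>u\<bar> < lev i" and s: "sgn u = s" "s \<noteq> 0"
  shows "ER u B \<longleftrightarrow> crossing (s * Re (F i B)) (Re (F (Suc i) B)) (lev (Suc i) - s * u)"
proof -
  have su: "s * u = \<bar>u\<bar>" using s by (metis abs_sgn mult.commute)
  have ij: "j = i \<or> j = Suc i" if "j \<le> k" "lev (Suc j) \<le> \<bar>u\<bar>" "\<bar>u\<bar> \<le> lev j" for j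
  proof (rule ccontr)
    assume "\<not> (j = i \<or> j = Suc i)"
    then consider "Suc j \<le> i" | "Suc (Suc i) \<le> j" by linarith
    then show False
      using lev_le[of "Suc j" i] lev_le[of "Suc (Suc i)" j] that v i by cases auto
  qed
  have jl: "j = Suc i" if "j \<in> {1..k}" "\<bar>u\<bar> = lev j" for j
  proof (rule ccontr)
    assume "j \<noteq> Suc i"
    then consider "j \<le> i" | "Suc (Suc i) \<le> j" by linarith
    then show False
      using lev_le[of j i] lev_le[of "Suc (Suc i)" j] that v i by cases auto
  qed
  have A: "(\<exists>j\<le>k. lev (Suc j) \<le> \<bar>u\<bar> \<and> \<bar>u\<bar> \<le> lev j \<and> Re (F j B) = 0) \<longleftrightarrow>
      (\<bar>u\<bar> \<le> lev (Suc i) \<and> Re (F (Suc i) B) = 0) \<or> (lev (Suc i) \<le> \<bar>u\<bar> \<and> Re (F i B) = 0)"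
  proof
    assume "\<exists>j\<le>k. lev (Suc j) \<le> \<bar>u\<bar> \<and> \<bar>u\<bar> \<le> lev j \<and> Re (F j B) = 0"
    then obtain j where "j \<le> k" "lev (Suc j) \<le> \<bar>u\<bar>" "\<bar>u\<bar> \<le> lev j" "Re (F j B) = 0" by blast
    then show "(\<bar>u\<bar> \<le> lev (Suc i) \<and> Re (F (Suc i) B) = 0) \<or> (lev (Suc i) \<le> \<bar>u\<bar> \<and> Re (F i B) = 0)"
      using ij[of j] by auto
  qed (use i v in \<open>auto intro: exI[of _ i] exI[of _ "Suc i"]\<close>)
  have B: "(\<exists>j\<in>{1..k}. \<bar>u\<bar> = lev j \<and> 0 \<le> sgn u * (Re (F (j - 1) B) * Re (F j B))) \<longleftrightarrow>
      \<bar>u\<bar> = lev (Suc i) \<and> 0 \<le> s * Re (F i B) * Re (F (Suc i) B)"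
  proof
    assume "\<exists>j\<in>{1..k}. \<bar>u\<bar> = lev j \<and> 0 \<le> sgn u * (Re (F (j - 1) B) * Re (F j B))"
    then obtain j where "j \<in> {1..k}" "\<bar>u\<bar> = lev j" "0 \<le> sgn u * (Re (F (j - 1) B) * Re (F j B))"
      by blast
    with jl[of j] s(1) show "\<bar>u\<bar> = lev (Suc i) \<and> 0 \<le> s * Re (F i B) * Re (F (Suc i) B)"
      by (simp add: mult.assoc)
  qed (use i s(1) in \<open>auto simp: mult.assoc intro!: bexI[of _ "Suc i"]\<close>)
  show ?thesis
    unfolding ER_def A B crossing_def su using s(2) by auto
qed

text \<open>The alternative \<open>j = k\<close> admits \<open>u = 0\<close>, the quadric, which is
  not strictly above \<open>lev (Suc k) = 0\<close>; positive and negative \<open>u\<close> join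
  there.\<close>

lemma ER_between_levels:
  assumes j: "j \<le> k" and v: "lev (Suc j) < \<bar>u\<bar> \<or> j = k" "\<bar>u\<bar> < lev j"
  shows "ER u B \<longleftrightarrow> Re (F j B) = 0"
proof -
  have ij: "i = j" if "i \<le> k" "lev (Suc i) \<le> \<bar>u\<bar>" "\<bar>u\<bar> \<le> lev i" for i
  proof (rule ccontr)
    assume "i \<noteq> j"
    then consider "Suc i \<le> j" | "Suc j \<le> i" by linarith
    then show False
    proof cases
      case 1 then show ?thesis using lev_le[of "Suc i" j] that v j by auto
    next
      case 2 then show ?thesis using lev_le[of "Suc j" i] that v j by auto
    qed
  qed
  have jl: False if "i \<in> {1..k}" "\<bar>u\<bar> = lev i" for i
  proof -
    consider "i \<le> j" | "Suc j \<le> i" by linarith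
    then show False
    proof cases
      case 1 then show ?thesis using lev_le[of i j] that v j by auto
    next
      case 2 then show ?thesis using lev_le[of "Suc j" i] that v j by auto
    qed
  qed
  have "lev (Suc j) \<le> \<bar>u\<bar>" using v(1) by (auto simp: lev_def)
  then show ?thesis
    unfolding ER_def using ij jl j v(2) by (metis less_imp_le)
qed

lemma lev_position:
  assumes "\<bar>u\<bar> < 1"
  obtains (level) i where "Suc i \<le> k" "\<bar>u\<bar> = lev (Suc i)"
    | (between) j where "j \<le> k" "lev (Suc j) < \<bar>u\<bar> \<or> j = k" "\<bar>u\<bar> < lev j"
proof -
  define j where "j = (GREATEST j. j \<le> k \<and> \<bar>u\<bar> < lev j)"
  have ex: "\<exists>j. j \<le> k \<and> \<bar>u\<bar> < lev j" using assms by (intro exI[of _ 0]) (simp add: lev_def)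
  have j: "j \<le> k \<and> \<bar>u\<bar> < lev j"
    unfolding j_def using ex by (rule GreatestI_ex_nat[where b = k]) simp
  have gr: "i \<le> j" if "i \<le> k" "\<bar>u\<bar> < lev i" for i
    unfolding j_def using that by (intro Greatest_le_nat[where b = k]) auto
  show ?thesis
  proof (cases "Suc j \<le> k \<and> \<bar>u\<bar> = lev (Suc j)")
    case True
    then show ?thesis using level by blast
  next
    case False
    have "lev (Suc j) < \<bar>u\<bar> \<or> j = k"
    proof (rule ccontr)
      assume "\<not> (lev (Suc j) < \<bar>u\<bar> \<or> j = k)"
      then have "Suc j \<le> k" "\<bar>u\<bar> < lev (Suc j)" using j False by auto
      then show False using gr[of "Suc j"] by simp
    qed
    then show ?thesis using between j by blast
  qed
qed

end

context collar_frame
begin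

lemma local_model:
  assumes "\<bar>u0\<bar> < 1"
  obtains U N and \<Phi> :: "real^2 \<Rightarrow> real^2" and k' \<epsilon> c \<delta> where "open U" "0 \<in> U" "open N"
    "homeomorphism U N \<Phi> k'" "\<epsilon> * \<epsilon> = (1::real)" "0 < (\<delta>::real)"
    "\<And>u y. \<bar>u - u0\<bar> < \<delta> \<Longrightarrow> y \<in> U \<Longrightarrow> ER u (Bp y) \<longleftrightarrow> crossing (\<Phi> y $ 1) (\<Phi> y $ 2) (c - \<epsilon> * u)"
  using assms
proof (cases rule: lev_position)
  case (level i)
  define s where "s = sgn u0"
  have u0: "u0 \<noteq> 0" using level lev_pos[of "Suc i"] by auto
  then have s: "s * s = 1" "s \<noteq> 0" "s * u0 = \<bar>u0\<bar>" by (auto simp: s_def sgn_if)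
  define \<delta> where "\<delta> = min (lev i - \<bar>u0\<bar>) (\<bar>u0\<bar> - lev (Suc (Suc i)))"
  have d: "0 < \<delta>"
    using level lev_less[of i "Suc i"] lev_less[of "Suc i" "Suc (Suc i)"] by (simp add: \<delta>_def)
  have near: "ER u B \<longleftrightarrow> crossing (s * Re (F i B)) (Re (F (Suc i) B)) (lev (Suc i) - s * u)"
    if "\<bar>u - u0\<bar> < \<delta>" for u B
  proof (rule ER_at_level[OF level(1)])
    have "\<bar>u - u0\<bar> < \<bar>u0\<bar>" using that lev_bounds(1)[of "Suc (Suc i)"] by (simp add: \<delta>_def)
    then show "sgn u = s" by (auto simp: s_def sgn_if)
    show "lev (Suc (Suc i)) < \<bar>u\<bar>" "\<bar>u\<bar> < lev i" using that by (auto simp: \<delta>_def)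
  qed (rule s)
  let ?g = "\<lambda>y. s * Re (F i (Bp y))" and ?h = "\<lambda>y. Re (F (Suc i) (Bp y))"
  have ik: "i \<le> k" using level by simp
  have z: "F j B0 = 0" if "Re (F j B0) = 0" "j \<le> k" for j
    using Im_F[OF that(2) B0(1)] that(1) by (simp add: complex_eq_iff)
  have Dg: "(?g has_derivative (\<lambda>x. x \<bullet> (s *\<^sub>R grad i))) (at 0)"
    using has_derivative_mult_right[OF derivative_F_Bp[OF ik], of s] by simp
  obtain U V and \<Phi> :: "real^2 \<Rightarrow> real^2" and k' where U: "open U" "0 \<in> U" "open V" "homeomorphism U V \<Phi> k'"
    "\<And>y. y \<in> U \<Longrightarrow> sgn (\<Phi> y $ 1) = sgn (?g y)" "\<And>y. y \<in> U \<Longrightarrow> sgn (\<Phi> y $ 2) = sgn (?h y)"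
  proof (rule sign_coordinates[OF _ C1_F_Bp[OF level(1)] Dg derivative_F_Bp[OF level(1)]])
    show "C1_fun ?g" by (intro C1_fun_mult C1_fun_const C1_F_Bp ik)
    show "s *\<^sub>R grad i \<noteq> 0" if "s * Re (F i (Bp 0)) = 0"
      using that s(2) grad_nonzero[OF ik z[OF _ ik]] by (simp add: Bp_0)
    show "grad (Suc i) \<noteq> 0" if "Re (F (Suc i) (Bp 0)) = 0"
      using that grad_nonzero[OF level(1) z[OF _ level(1)]] by (simp add: Bp_0)
    show "(s *\<^sub>R grad i) $ 1 * grad (Suc i) $ 2 - (s *\<^sub>R grad i) $ 2 * grad (Suc i) $ 1 \<noteq> 0"
      if "s * Re (F i (Bp 0)) = 0" "Re (F (Suc i) (Bp 0)) = 0"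
      using that s(2) grad_independent[OF level(1) z[OF _ ik] z[OF _ level(1)]]
      by (simp add: Bp_0 mult.assoc flip: right_diff_distrib)
  qed (rule that)
  show ?thesis
  proof (rule that[OF U(1-4) s(1) d])
    fix u y assume "\<bar>u - u0\<bar> < \<delta>" "y \<in> U"
    then show "ER u (Bp y) \<longleftrightarrow> crossing (\<Phi> y $ 1) (\<Phi> y $ 2) (lev (Suc i) - s * u)"
      using near[of u "Bp y"] crossing_sgn[OF U(5) U(6), of y] by simp
  qed
next
  case (between j)
  define \<delta> where "\<delta> = min 1 (if lev (Suc j) < \<bar>u0\<bar> then min (lev j - \<bar>u0\<bar>) (\<bar>u0\<bar> - lev (Suc j)) else lev j - \<bar>u0\<bar>)"
  have d: "0 < \<delta>" using between by (simp add: \<delta>_def)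
  \<comment> \<open>Away from the levels the crossing is used with first coordinate 1 and positive
    height, where only the half-plane \<open>y = 0\<close> is left.\<close>
  have near: "ER u B \<longleftrightarrow> crossing 1 (Re (F j B)) (1 + u0 - u)" if "\<bar>u - u0\<bar> < \<delta>" for u B
  proof -
    have "ER u B \<longleftrightarrow> Re (F j B) = 0"
      using that between by (intro ER_between_levels) (auto simp: \<delta>_def split: if_splits)
    moreover have "1 + u0 - u > 0" using that by (auto simp: \<delta>_def)
    ultimately show ?thesis by (auto simp: crossing_def)
  qed
  let ?g = "\<lambda>y::real^2. 1::real" and ?h = "\<lambda>y. Re (F j (Bp y))"
  have Dg: "(?g has_derivative (\<lambda>x. x \<bullet> 0)) (at 0)" by simp
  have z: "F j B0 = 0" if "Re (F j B0) = 0"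
    using Im_F[OF between(1) B0(1)] that by (simp add: complex_eq_iff)
  obtain U V and \<Phi> :: "real^2 \<Rightarrow> real^2" and k' where U: "open U" "0 \<in> U" "open V" "homeomorphism U V \<Phi> k'"
    "\<And>y. y \<in> U \<Longrightarrow> sgn (\<Phi> y $ 1) = sgn (?g y)" "\<And>y. y \<in> U \<Longrightarrow> sgn (\<Phi> y $ 2) = sgn (?h y)"
  proof (rule sign_coordinates[OF C1_fun_const C1_F_Bp[OF between(1)] Dg derivative_F_Bp[OF between(1)]])
    show "grad j \<noteq> 0" if "Re (F j (Bp 0)) = 0"
      using that grad_nonzero[OF between(1) z] by (simp add: Bp_0)
    show "(0::real^2) \<noteq> 0" if "(1::real) = 0" using that by simp
    show "(0::real^2) $ 1 * grad j $ 2 - (0::real^2) $ 2 * grad j $ 1 \<noteq> 0" if "(1::real) = 0"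
      using that by simp
  qed (rule that)
  show ?thesis
  proof (rule that[OF U(1-4) _ d])
    fix u y assume "\<bar>u - u0\<bar> < \<delta>" "y \<in> U"
    then show "ER u (Bp y) \<longleftrightarrow> crossing (\<Phi> y $ 1) (\<Phi> y $ 2) (1 + u0 - 1 * u)"
      using near[of u "Bp y"] U(5,6)[of y] crossing_sgn[of "\<Phi> y $ 1" 1 "\<Phi> y $ 2"] by simp
  qed simp
qed

end

lemma retract_scaleR: "retract (r *\<^sub>R A) = (\<bar>r\<bar> * r) *\<^sub>R retract A"
  by (simp add: retract_def pos_simps neg_simps algebra_simps)

lemma ucoord_scaleR: "r \<noteq> 0 \<Longrightarrow> ucoord (r *\<^sub>R A) = ucoord A"
  by (simp add: ucoord_def pos_simps neg_simps flip: right_diff_distrib distrib_left)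

definition surface_near :: "cp3 set \<Rightarrow> cp3 \<Rightarrow> bool" where
  "surface_near X p \<longleftrightarrow> (\<exists>U. openin (top_of_set X) U \<and> p \<in> U \<and>
     (\<exists>Y::(real^2) set. open Y \<and> subtopology (top_of_set X) U homeomorphic_space top_of_set Y))"

context collar_frame
begin

definition yc :: "M2 \<Rightarrow> real^2" where
  "yc A = pair (retract A \<bullet> e1 / (retract A \<bullet> B0)) (retract A \<bullet> e2 / (retract A \<bullet> B0))"

lemma yc_scaleR: "r \<noteq> 0 \<Longrightarrow> yc (r *\<^sub>R A) = yc A"
  by (simp add: yc_def retract_scaleR)

lemma Bp_yc:
  assumes "A \<in> V" "pos A \<noteq> 0" "neg A \<noteq> 0" "retract A \<bullet> B0 \<noteq> 0"
  shows "Bp (yc A) = (1 / (retract A \<bullet> B0)) *\<^sub>R retract A"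
proof -
  let ?B = "(1 / (retract A \<bullet> B0)) *\<^sub>R retract A"
  have "det ?B = 0"
    using det_cscale[of "of_real (1 / (retract A \<bullet> B0))" "retract A"] retract_props(2)[OF assms(1-3)]
    unfolding cscale_of_real by simp
  then have "?B = Bp (pair (?B \<bullet> e1) (?B \<bullet> e2))"
    using retract_props(1)[OF assms(1-3)] assms(4) by (intro Bp_unique) (auto simp: V_scaleR)
  then show ?thesis by (simp add: yc_def)
qed

text \<open>The sign coordinates of \<open>yc A\<close> and the height
  \<open>c - \<epsilon> * ucoord A\<close> are flattened to the plane. As \<open>\<epsilon>\<close>
  is 1 or -1, a height \<open>t\<close> gives back \<open>u = \<epsilon> * (c - t)\<close>; the
  bound on its absolute value in \<open>W\<close> excludes the unitary matrices.\<close>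

lemma chart_frame:
  assumes A0: "A0 \<in> V" "pos A0 \<noteq> 0" "neg A0 \<noteq> 0" "cclass A0 \<in> collar"
    and B0_eq: "retract A0 = norm (retract A0) *\<^sub>R B0"
  shows "surface_near (fixed_locus J \<inter> collar) (cclass A0)"
proof -
  define u0 where "u0 = ucoord A0"
  have u0: "\<bar>u0\<bar> < 1" unfolding u0_def using retract_props(4)[OF A0(1-3)] .
  obtain U N and \<Phi> :: "real^2 \<Rightarrow> real^2" and k' \<epsilon> c \<delta> where U: "open U" "0 \<in> U" "open N"
    "homeomorphism U N \<Phi> k'" "\<epsilon> * \<epsilon> = (1::real)" "0 < (\<delta>::real)"
    and ER: "\<And>u y. \<bar>u - u0\<bar> < \<delta> \<Longrightarrow> y \<in> U \<Longrightarrow>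
      ER u (Bp y) \<longleftrightarrow> crossing (\<Phi> y $ 1) (\<Phi> y $ 2) (c - \<epsilon> * u)"
    by (rule local_model[OF u0]) (rule that)
  have e2: "\<epsilon> * (\<epsilon> * x) = x" for x using U(5) by (simp flip: mult.assoc)
  define O1 where "O1 = {A. pos A \<noteq> 0 \<and> neg A \<noteq> 0 \<and> retract A \<bullet> B0 \<noteq> 0}"
  define C where "C = {A \<in> V. A \<in> O1 \<and> yc A \<in> U \<and> \<bar>ucoord A - u0\<bar> < \<delta>}"
  define H where "H A = flatten (\<Phi> (yc A) $ 1) (\<Phi> (yc A) $ 2) (c - \<epsilon> * ucoord A)" for A
  define W where "W = {w. pair (cx w) (cy w) \<in> N \<and> \<bar>\<epsilon> * (c - ct w) - u0\<bar> < \<delta> \<and> \<bar>\<epsilon> * (c - ct w)\<bar> < 1}"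
  define G where "G w = Bp (k' (pair (cx w) (cy w))) + (\<epsilon> * (c - ct w)) *\<^sub>R tau (Bp (k' (pair (cx w) (cy w))))" for w
  have cr: "continuous_on S retract" for S
    unfolding retract_def[abs_def] by (intro continuous_intros)
  have O1: "open O1"
    unfolding O1_def by (intro open_Collect_conj open_Collect_neq continuous_intros cr)
  have cyc: "continuous_on O1 yc"
    unfolding yc_def[abs_def] by (intro continuous_intros cr) (auto simp: O1_def)
  have cu: "continuous_on O1 ucoord"
    unfolding ucoord_def[abs_def]
    by (intro continuous_intros) (auto simp: O1_def add_nonneg_eq_0_iff)
  have "open (O1 \<inter> yc -` U)" "open (O1 \<inter> ucoord -` {u0 - \<delta><..<u0 + \<delta>})"
    using continuous_open_preimage[OF cyc O1 U(1)] continuous_open_preimage[OF cu O1 open_greaterThanLessThan] .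
  then have "open (O1 \<inter> yc -` U \<inter> (O1 \<inter> ucoord -` {u0 - \<delta><..<u0 + \<delta>}))" by (rule open_Int)
  moreover have "C = V \<inter> (O1 \<inter> yc -` U \<inter> (O1 \<inter> ucoord -` {u0 - \<delta><..<u0 + \<delta>}))"
    by (auto simp: C_def)
  ultimately have Cop: "openin (top_of_set V) C" by (metis openin_open_Int)
  have CD: "A \<in> V" "pos A \<noteq> 0" "neg A \<noteq> 0" "retract A \<bullet> B0 \<noteq> 0" "yc A \<in> U" "\<bar>ucoord A - u0\<bar> < \<delta>"
    if "A \<in> C" for A
    using that by (auto simp: C_def O1_def)
  have hom: "\<Phi> y \<in> N" "k' (\<Phi> y) = y" if "y \<in> U" for y
    using U(4) that by (auto simp: homeomorphism_def)
  have hom': "k' z \<in> U" "\<Phi> (k' z) = z" if "z \<in> N" for z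
    using U(4) that by (auto simp: homeomorphism_def)
  show ?thesis
    unfolding surface_near_def
  proof (rule chart[where C = C and F = H and W = W and G = G])
    show "A0 \<in> C"
    proof -
      have r: "retract A0 \<bullet> B0 = norm (retract A0)" "retract A0 \<bullet> e1 = 0" "retract A0 \<bullet> e2 = 0"
        by (subst B0_eq, simp add: B0_tau e_inner)+
      then have "yc A0 = 0" by (simp add: yc_def pair_eq_iff)
      then show ?thesis
        using A0 U(2,6) r(1) retract_props(3)[OF A0(1-3)] by (simp add: C_def O1_def u0_def)
    qed
    show "0 \<notin> C" by (auto simp: C_def O1_def pos_simps)
    show "r *\<^sub>R A \<in> C" if "A \<in> C" "r \<noteq> 0" for A r
      using that by (simp add: C_def O1_def V_scaleR pos_simps neg_simps retract_scaleR yc_scaleR ucoord_scaleR)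
    show "H (r *\<^sub>R A) = H A" if "A \<in> C" "r \<noteq> 0" for A r
      using that by (simp add: H_def yc_scaleR ucoord_scaleR)
    have "C \<subseteq> O1" by (auto simp: C_def)
    then show "continuous_on C H"
      unfolding H_def
      by (intro continuous_intros continuous_on_compose2[OF homeomorphism_cont1[OF U(4)]]
          continuous_on_subset[OF cyc] continuous_on_subset[OF cu]) (auto simp: C_def)
    have cp: "continuous_on S (\<lambda>w. pair (cx w) (cy w))" for S
      by (intro continuous_intros)
    have "open ((\<lambda>w. pair (cx w) (cy w)) -` N)"
      using continuous_on_open_vimage[of UNIV "\<lambda>w. pair (cx w) (cy w)"] cp U(3) by simp
    then have "open {w. pair (cx w) (cy w) \<in> N}" by (simp add: vimage_def)
    then show "open W"
      unfolding W_def by (intro open_Collect_conj open_Collect_less continuous_intros)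
    show "continuous_on W G"
      unfolding G_def
      by (intro continuous_intros tau.continuous continuous_on_compose2[OF homeomorphism_cont2[OF U(4)] cp])
        (auto simp: W_def)
    show "G ` W \<subseteq> V"
      by (auto simp: G_def V_add V_scaleR V_tau Bp_V)
  next
    fix A assume A: "A \<in> C" "cclass A \<in> fixed_locus J \<inter> collar"
    note D = CD[OF A(1)]
    define B where "B = Bp (yc A)"
    have B: "B = (1 / (retract A \<bullet> B0)) *\<^sub>R retract A"
      unfolding B_def by (rule Bp_yc[OF D(1-4)])
    have "ER (ucoord A) (retract A)"
      using A(2) collar_interior_iff[OF D(1-3)] by simp
    then have "ER (ucoord A) B"
      using D(4) unfolding B by (subst ER_scaleR) (auto simp: retract_props[OF D(1-3)])
    then have cr: "crossing (\<Phi> (yc A) $ 1) (\<Phi> (yc A) $ 2) (c - \<epsilon> * ucoord A)"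
      using ER[OF D(6,5)] by (simp add: B_def)
    note uf = unflatten_flatten[OF cr]
    have u: "\<epsilon> * (c - ct (H A)) = ucoord A" by (simp add: H_def uf e2)
    have p: "pair (cx (H A)) (cy (H A)) = \<Phi> (yc A)" by (simp add: H_def uf)
    have "H A \<in> W"
      unfolding W_def mem_Collect_eq u p using hom(1)[OF D(5)] D(6) retract_props(4)[OF D(1-3)] by simp
    moreover have "G (H A) = B + ucoord A *\<^sub>R tau B"
      unfolding G_def u p hom(2)[OF D(5)] B_def ..
    then have "G (H A) = (1 / (retract A \<bullet> B0)) *\<^sub>R (retract A + ucoord A *\<^sub>R tau (retract A))"
      unfolding B by (simp add: tau.scaleR scaleR_add_right mult.commute)
    then have "G (H A) = (1 / (retract A \<bullet> B0) *
        (2 * norm (pos A) * norm (neg A) / (norm (pos A) + norm (neg A)))) *\<^sub>R A"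
      unfolding retract_props(5)[OF D(1-3)] by simp
    moreover have "norm (pos A) + norm (neg A) \<noteq> 0"
      using D by (simp add: add_nonneg_eq_0_iff)
    ultimately show "H A \<in> W \<and> (\<exists>r. r \<noteq> 0 \<and> G (H A) = r *\<^sub>R A)"
      using D by (intro conjI exI[of _ "1 / (retract A \<bullet> B0) *
        (2 * norm (pos A) * norm (neg A) / (norm (pos A) + norm (neg A)))"]) auto
  next
    fix w assume w: "w \<in> W" "G w \<in> C"
    define y where "y = k' (pair (cx w) (cy w))"
    define u where "u = \<epsilon> * (c - ct w)"
    have y: "y \<in> U" "\<Phi> y = pair (cx w) (cy w)"
      using w(1) hom' by (auto simp: W_def y_def)
    have u: "\<bar>u - u0\<bar> < \<delta>" "\<bar>u\<bar> < 1" "c - \<epsilon> * u = ct w"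
      using w(1) by (auto simp: W_def u_def e2)
    have Gw: "G w = 1 *\<^sub>R (Bp y + u *\<^sub>R tau (Bp y))"
      by (simp add: G_def y_def u_def)
    have ERw: "ER u (Bp y)"
      using ER[OF u(1) y(1)] crossing_unflatten[of w] by (simp add: y(2) u(3))
    have "cclass (G w) \<in> collar"
      unfolding Gw scaleR_one by (rule ER_collar[OF Bp_V Bp_nonzero det_Bp ERw])
    moreover have "cclass (G w) \<in> fixed_locus J"
      unfolding fixed_locus_eq using CD(1,2)[OF w(2)] by (auto simp: pos_simps)
    moreover have "H (G w) = w"
    proof -
      note rc = retract_collar[OF det_Bp Bp_nonzero u(2) one_neq_zero Gw]
      have "u\<^sup>2 < 1" using u(2) by (simp add: abs_square_less_1)
      then have "\<bar>1\<bar> * 1 * (1 - u\<^sup>2) * norm (neg (Bp y)) \<noteq> 0"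
        using norm_pos_singular[OF det_Bp Bp_nonzero, of y] by simp
      then have "yc (G w) = y"
        unfolding yc_def rc(2) by (simp add: Bp_inner)
      then show ?thesis
        unfolding H_def rc(1) by (simp add: y(2) u(3) flatten_unflatten)
    qed
    ultimately show "cclass (G w) \<in> fixed_locus J \<inter> collar \<and> H (G w) = w" by simp
  qed (use A0 in \<open>auto simp: fixed_locus_eq pos_simps intro: Cop\<close>)
qed

end

context diagram
begin

lemma surface_interior:
  assumes "A \<in> V" "pos A \<noteq> 0" "neg A \<noteq> 0" "cclass A \<in> collar"
  shows "surface_near (fixed_locus J \<inter> collar) (cclass A)"
proof -
  note rp = retract_props[OF assms(1-3)]
  define B where "B = (1 / norm (retract A)) *\<^sub>R retract A"
  have B: "B \<in> V" "norm B = 1" "det B = 0"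
    using rp det_cscale[of "of_real (1 / norm (retract A))" "retract A"]
    unfolding cscale_of_real B_def by (simp_all add: V_scaleR)
  have fc: "finite {B, tau B}" "card {B, tau B} < dim V" "{B, tau B} \<subseteq> V"
    using B by (auto simp: dim_V card_insert_if V_tau)
  obtain e1 where e1: "e1 \<in> V" "norm e1 = 1" "\<And>c. c \<in> {B, tau B} \<Longrightarrow> e1 \<bullet> c = 0"
    by (rule orthonormal_extend[OF subspace_V fc]) (rule that)
  have fc: "finite {B, tau B, e1}" "card {B, tau B, e1} < dim V" "{B, tau B, e1} \<subseteq> V"
    using B e1 by (auto simp: dim_V card_insert_if V_tau)
  obtain e2 where e2: "e2 \<in> V" "norm e2 = 1" "\<And>c. c \<in> {B, tau B, e1} \<Longrightarrow> e2 \<bullet> c = 0"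
    by (rule orthonormal_extend[OF subspace_V fc]) (rule that)
  interpret collar_frame J d \<gamma> f B e1 e2
    by unfold_locales (use B e1 e2 in \<open>auto simp: inner_commute[of e1 e2]\<close>)
  show ?thesis
    using chart_frame[OF assms] rp(3) by (simp add: B_def)
qed

end

section \<open>Charts at unitary points\<close>

text \<open>Squaring gives \<open>(h\<^sup>2 - \<nu>\<^sup>2) * x\<^sup>2 = \<nu>\<^sup>2 *
  z\<^sup>2\<close>, and the signs of \<open>\<rho>\<close> and \<open>z\<close> select one root.
  The solution stays continuous through \<open>\<rho> = 0\<close>.\<close>

lemma graph_equation:
  fixes h \<nu> x z \<rho> :: real
  assumes "\<bar>\<nu>\<bar> < h" "0 \<le> z" "0 \<le> \<rho>" "\<rho>\<^sup>2 = x\<^sup>2 + z\<^sup>2"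
  shows "h * x + \<nu> * \<rho> = 0 \<longleftrightarrow> x = - \<nu> * z / sqrt (h\<^sup>2 - \<nu>\<^sup>2)"
proof -
  define r where "r = sqrt (h\<^sup>2 - \<nu>\<^sup>2)"
  have "\<nu>\<^sup>2 < h\<^sup>2" using assms(1) by (metis abs_le_square_iff abs_of_pos abs_ge_zero le_less_trans not_le)
  then have r: "r > 0" "r\<^sup>2 = h\<^sup>2 - \<nu>\<^sup>2" by (simp_all add: r_def)
  have h: "h > 0" using assms(1) by linarith
  show ?thesis
    unfolding r_def[symmetric]
  proof
    assume e: "h * x + \<nu> * \<rho> = 0"
    then have hx: "h * x = - \<nu> * \<rho>" by simp
    have "(h * x)\<^sup>2 = (\<nu> * \<rho>)\<^sup>2" unfolding hx by simp
    then have "h\<^sup>2 * x\<^sup>2 = \<nu>\<^sup>2 * (x\<^sup>2 + z\<^sup>2)" by (simp add: power_mult_distrib assms(4))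
    then have "(r * x)\<^sup>2 = (\<nu> * z)\<^sup>2"
      by (simp add: power_mult_distrib r(2) algebra_simps)
    then consider "r * x = - (\<nu> * z)" | "r * x = \<nu> * z"
      by (auto simp: power2_eq_iff)
    then have "r * x = - \<nu> * z"
    proof cases
      \<comment> \<open>The other root has the wrong sign and survives only at \<open>x = 0\<close>,
        where the two agree.\<close>
      case 2
      have "h * r * x\<^sup>2 = (h * x) * (r * x)" by (simp add: power2_eq_square)
      also have "\<dots> = - (\<nu>\<^sup>2 * (\<rho> * z))"
        unfolding hx 2 by (simp add: power2_eq_square algebra_simps)
      also have "\<dots> \<le> 0" using assms(2,3) by simp
      finally have "h * r * x\<^sup>2 \<le> 0" .
      then have "x = 0" using h r(1) by (simp add: mult_le_0_iff zero_less_mult_iff)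
      then show ?thesis using 2 by simp
    qed simp
    then show "x = - \<nu> * z / r" using r(1) by (simp add: field_simps)
  next
    assume x: "x = - \<nu> * z / r"
    have "\<rho>\<^sup>2 = \<nu>\<^sup>2 * z\<^sup>2 / r\<^sup>2 + z\<^sup>2"
      by (simp add: assms(4) x power_divide power_mult_distrib)
    also have "\<dots> = (\<nu>\<^sup>2 + r\<^sup>2) * z\<^sup>2 / r\<^sup>2"
      using r(1) by (simp add: add_divide_distrib distrib_right)
    also have "\<dots> = (h * z / r)\<^sup>2"
      by (simp add: r(2) power_divide power_mult_distrib)
    finally have "\<rho> = h * z / r"
      using assms(2,3) h r(1) by (simp add: power2_eq_iff_nonneg)
    then show "h * x + \<nu> * \<rho> = 0" by (simp add: x)
  qed
qed

text \<open>Elliptic coordinates with foci at 1 and -1: half the sum and half the difference of the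
  distances to the foci.\<close>

definition ell_sum :: "real \<Rightarrow> real \<Rightarrow> real" where
  "ell_sum a z = (sqrt ((a + 1)\<^sup>2 + z) + sqrt ((a - 1)\<^sup>2 + z)) / 2"

definition ell_diff :: "real \<Rightarrow> real \<Rightarrow> real" where
  "ell_diff a z = (sqrt ((a + 1)\<^sup>2 + z) - sqrt ((a - 1)\<^sup>2 + z)) / 2"

text \<open>The argument \<open>z\<close> is the square of the second coordinate. With
  \<open>cosh t\<close> for the sum and \<open>cos \<theta>\<close> for the difference, the
  identities read \<open>a = cosh t * cos \<theta>\<close> and
  \<open>z = (sinh t * sin \<theta>)\<^sup>2\<close>; the last bound is the triangle inequality for
  foci at distance 2.\<close>

lemma ell_props:
  assumes "0 \<le> z"
  shows "ell_sum a z * ell_diff a z = a" "((ell_sum a z)\<^sup>2 - 1) * (1 - (ell_diff a z)\<^sup>2) = z"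
    "1 \<le> ell_sum a z" "\<bar>ell_diff a z\<bar> \<le> 1"
proof -
  define p where "p = sqrt ((a + 1)\<^sup>2 + z)"
  define q where "q = sqrt ((a - 1)\<^sup>2 + z)"
  have p: "p\<^sup>2 = (a + 1)\<^sup>2 + z" "p \<ge> \<bar>a + 1\<bar>"
    using assms by (simp_all add: p_def real_le_rsqrt)
  have q: "q\<^sup>2 = (a - 1)\<^sup>2 + z" "q \<ge> \<bar>a - 1\<bar>"
    using assms by (simp_all add: q_def real_le_rsqrt)
  have s: "ell_sum a z = (p + q) / 2" "ell_diff a z = (p - q) / 2"
    by (simp_all add: ell_sum_def ell_diff_def p_def q_def)
  have "(p + q) * (p - q) = 4 * a"
    using p(1) q(1) by (simp add: power2_eq_square algebra_simps)
  then show m: "ell_sum a z * ell_diff a z = a" by (simp add: s)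
  have "(ell_sum a z)\<^sup>2 + (ell_diff a z)\<^sup>2 = (p\<^sup>2 + q\<^sup>2) / 2"
    by (simp add: s power2_eq_square field_simps)
  also have "\<dots> = a\<^sup>2 + 1 + z"
    unfolding p q by (simp add: power2_eq_square field_simps)
  finally have "(ell_sum a z)\<^sup>2 + (ell_diff a z)\<^sup>2 = (ell_sum a z * ell_diff a z)\<^sup>2 + 1 + z"
    by (simp add: m)
  then show e: "((ell_sum a z)\<^sup>2 - 1) * (1 - (ell_diff a z)\<^sup>2) = z"
    by (simp add: power_mult_distrib algebra_simps)
  show g: "1 \<le> ell_sum a z"
    using p(2) q(2) by (simp add: s)
  have "p \<le> q + 2"
  proof (rule power2_le_imp_le)
    have "a - 1 \<le> q" using q(2) by linarith
    then show "p\<^sup>2 \<le> (q + 2)\<^sup>2"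
      unfolding p(1) using q(1) by (simp add: power2_eq_square algebra_simps)
  qed (use q(2) in linarith)
  moreover have "q \<le> p + 2"
  proof (rule power2_le_imp_le)
    have "- a - 1 \<le> p" using p(2) by linarith
    then show "q\<^sup>2 \<le> (p + 2)\<^sup>2"
      unfolding q(1) using p(1) by (simp add: power2_eq_square algebra_simps)
  qed (use p(2) in linarith)
  ultimately show "\<bar>ell_diff a z\<bar> \<le> 1" by (simp add: s abs_le_iff)
qed

text \<open>With \<open>s = sqrt (1 + \<rho>\<^sup>2)\<close> the radicands become
  \<open>(s + c)\<^sup>2\<close> and \<open>(s - c)\<^sup>2\<close>; \<open>\<rho>\<close> plays the
  part of \<open>sinh t\<close>.\<close>

lemma ell_inverse:
  assumes "0 \<le> \<rho>" "\<bar>c\<bar> \<le> 1" "z = \<rho>\<^sup>2 * (1 - c\<^sup>2)"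
  shows "ell_sum (c * sqrt (1 + \<rho>\<^sup>2)) z = sqrt (1 + \<rho>\<^sup>2)" "ell_diff (c * sqrt (1 + \<rho>\<^sup>2)) z = c"
proof -
  define s where "s = sqrt (1 + \<rho>\<^sup>2)"
  have s: "s\<^sup>2 = 1 + \<rho>\<^sup>2" "s \<ge> 1" by (simp_all add: s_def)
  have z: "z = (s\<^sup>2 - 1) * (1 - c\<^sup>2)" by (simp add: assms(3) s)
  have "(c * s + 1)\<^sup>2 + z = (s + c)\<^sup>2" "(c * s - 1)\<^sup>2 + z = (s - c)\<^sup>2"
    unfolding z by (simp_all add: power2_eq_square algebra_simps)
  moreover have "0 \<le> s + c" "0 \<le> s - c" using s(2) assms(2) by linarith+
  ultimately show "ell_sum (c * sqrt (1 + \<rho>\<^sup>2)) z = sqrt (1 + \<rho>\<^sup>2)" "ell_diff (c * sqrt (1 + \<rho>\<^sup>2)) z = c"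
    unfolding s_def[symmetric] by (simp_all add: ell_sum_def ell_diff_def)
qed

context real_structure
begin

text \<open>The odd function \<open>\<nu>\<close> singles out one representative of each class, so
  \<open>G\<close> can return that matrix itself.\<close>

lemma normalized_chart:
  fixes H :: "M2 \<Rightarrow> real^2" and G :: "real^2 \<Rightarrow> M2" and \<nu> :: "M2 \<Rightarrow> real"
  assumes X: "X \<subseteq> fixed_locus J"
    and C: "openin (top_of_set V) C" "\<And>A r. A \<in> C \<Longrightarrow> r \<noteq> 0 \<Longrightarrow> r *\<^sub>R A \<in> C"
    and A0: "A0 \<in> C" "cclass A0 \<in> X"
    and H: "continuous_on C H" "\<And>A r. A \<in> C \<Longrightarrow> r \<noteq> 0 \<Longrightarrow> H (r *\<^sub>R A) = H A"
    and \<nu>: "\<And>A. A \<in> C \<Longrightarrow> A \<noteq> 0 \<and> \<nu> A \<noteq> 0" "\<And>A r. A \<in> C \<Longrightarrow> r \<noteq> 0 \<Longrightarrow> \<nu> (r *\<^sub>R A) = r * \<nu> A"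
    and G: "open W" "continuous_on W G" "G ` W \<subseteq> V"
    and HX: "\<And>A. A \<in> C \<Longrightarrow> \<nu> A = 1 \<Longrightarrow> cclass A \<in> X \<Longrightarrow> H A \<in> W \<and> G (H A) = A"
    and GX: "\<And>w. w \<in> W \<Longrightarrow> G w \<in> C \<Longrightarrow> cclass (G w) \<in> X \<and> H (G w) = w"
  shows "surface_near X (cclass A0)"
  unfolding surface_near_def
proof (rule chart[OF X C(1) _ C(2) A0 H G])
  fix A assume A: "A \<in> C" "cclass A \<in> X"
  define r where "r = inverse (\<nu> A)"
  have r: "r \<noteq> 0" "r *\<^sub>R A \<in> C" "\<nu> (r *\<^sub>R A) = 1" "cclass (r *\<^sub>R A) \<in> X" "H (r *\<^sub>R A) = H A"
    using A \<nu>(1)[OF A(1)] C(2)[OF A(1)] \<nu>(2)[OF A(1)] H(2)[OF A(1)] by (simp_all add: r_def cclass_scaleR)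
  then show "H A \<in> W \<and> (\<exists>r. r \<noteq> 0 \<and> G (H A) = r *\<^sub>R A)"
    using HX[OF r(2-4)] by auto
qed (use \<nu>(1) GX in auto)

end

text \<open>The two kinds of unitary points differ by the exchange of the eigenspaces of \<open>tau\<close>;
  \<open>N\<close> denotes the projection to the eigenspace that contains the point.\<close>

locale unitary_frame = diagram +
  fixes P N :: "M2 \<Rightarrow> M2" and A0 :: M2
  assumes swap: "P = pos \<and> N = neg \<or> P = neg \<and> N = pos"
    and odd: "odd d"
    and A0: "A0 \<in> V" "A0 \<noteq> 0" "P A0 = 0" "cclass A0 \<in> collar"
begin

lemma PN: "P A + N A = A" "P (P A) = P A" "N (N A) = N A" "P (N A) = 0" "N (P A) = 0"
  using swap pos_neg(1)[of A] by (auto simp: add.commute)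

lemma linear_P: "linear P" and linear_N: "linear N"
  using swap linear_pos linear_neg by auto

lemmas P_simps = linear_add[OF linear_P] linear_scale[OF linear_P] linear_diff[OF linear_P] linear_0[OF linear_P]
lemmas N_simps = linear_add[OF linear_N] linear_scale[OF linear_N] linear_diff[OF linear_N] linear_0[OF linear_N]

lemma V_PN: "A \<in> V \<Longrightarrow> P A \<in> V" "A \<in> V \<Longrightarrow> N A \<in> V"
  using swap V_pos V_neg by auto

lemma PN_inner: "P A \<bullet> B = A \<bullet> P B" "N A \<bullet> B = A \<bullet> N B"
  using swap inner_pos by auto

lemma PN_orth: "P A \<bullet> N B = 0" "N A \<bullet> P B = 0"
  by (simp_all add: PN_inner PN)

lemma continuous_on_PN [continuous_intros]:
  "continuous_on S h \<Longrightarrow> continuous_on S (\<lambda>x. P (h x))"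
  "continuous_on S h \<Longrightarrow> continuous_on S (\<lambda>x. N (h x))"
  using swap continuous_on_pos continuous_on_neg by auto

lemma P_0_iff: "P A = 0 \<longleftrightarrow> N A = A"
  using PN[of A] by (metis add_0 add_cancel_right_left)

lemma collar_iff_P0:
  assumes "A \<in> V" "A \<noteq> 0" "P A = 0"
  shows "cclass A \<in> collar \<longleftrightarrow> (\<exists>Y\<in>V. P Y = Y \<and> norm Y \<le> norm A \<and> F 0 (A + Y) = 0)"
  using swap
proof
  assume s: "P = pos \<and> N = neg"
  then have "tau A = - A" using assms pos_eq_iff(4) by simp
  then show ?thesis using collar_neg_iff[OF assms(1,2)] odd s by (simp add: pos_eq_iff)
next
  assume s: "P = neg \<and> N = pos"
  then have "tau A = A" using assms pos_eq_iff(2) by simp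
  then show ?thesis using collar_pos_iff[OF assms(1,2)] odd s by (simp add: pos_eq_iff)
qed

text \<open>The gradient of the linear form on \<open>V\<close>: averaging with \<open>J\<close>
  projects the gradient on the whole space to \<open>V\<close>.\<close>

definition M :: M2 where
  "M = (1/2) *\<^sub>R (adjoint (\<lambda>X. Re (F 0 X)) 1 + J (adjoint (\<lambda>X. Re (F 0 X)) 1))"

definition m :: M2 where "m = P M"
definition n :: M2 where "n = N M"

lemma M_V: "M \<in> V"
  by (simp add: M_def V_def scaleR add add.commute)

lemma mn_V: "m \<in> V" "n \<in> V"
  by (simp_all add: m_def n_def V_PN M_V)

lemma PN_mn: "P m = m" "N m = 0" "N n = n" "P n = 0"
  by (simp_all add: m_def n_def PN)

lemma F0_inner: "A \<in> V \<Longrightarrow> Re (F 0 A) = A \<bullet> M"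
proof -
  assume A: "A \<in> V"
  have "linear (\<lambda>X. Re (F 0 X))" using F0_linear[OF odd] by (simp add: linear_iff)
  then have "A \<bullet> adjoint (\<lambda>X. Re (F 0 X)) 1 = Re (F 0 A)"
    by (simp add: adjoint_works)
  moreover have "A \<bullet> J X = A \<bullet> X" for X
    using A inner_flip[of A X] by (simp add: V_def)
  ultimately show ?thesis
    by (simp add: M_def inner_add_right)
qed

lemma M_split: "A \<bullet> M = A \<bullet> m + A \<bullet> n"
  using PN(1)[of M] by (simp add: m_def n_def flip: inner_add_right)

lemma F0_zero_iff: "A \<in> V \<Longrightarrow> F 0 A = 0 \<longleftrightarrow> A \<bullet> m + A \<bullet> n = 0"
  using Im_F[of 0 A] by (simp add: complex_eq_iff F0_inner M_split)

lemma smooth_F0: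
  assumes "B \<noteq> 0" "det B = 0" "F 0 B = 0" shows "\<exists>X\<in>tangent_quadric B. F 0 X \<noteq> 0"
proof -
  have "smooth_curve (F 0)"
    using prim degrees[of 0] unfolding primitive_data_def F_def by blast
  moreover have "bounded_linear (F 0)"
    using F0_linear[OF odd] by (simp add: linear_conv_bounded_linear)
  then have "frechet_derivative (F 0) (at B) = F 0"
    by (intro frechet_derivative_at[symmetric] bounded_linear_imp_has_derivative)
  ultimately show ?thesis
    using assms unfolding smooth_curve_def by metis
qed

text \<open>If \<open>m\<close> and \<open>n\<close> had the same norm, the plane section would be tangent to the quadric.\<close>

lemma norm_mn: "norm m \<noteq> norm n"
proof
  assume eq: "norm m = norm n"
  have M0: "M \<bullet> tau M = 0"
    using inner_tau[of M] eq swap by (auto simp: m_def n_def)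
  have van: "F 0 X = 0" if X: "X \<bullet> M = 0" "X \<bullet> cscale \<i> M = 0" for X
  proof -
    obtain X1 X2 where X12: "X1 \<in> V" "X2 \<in> V" "X = X1 + cscale \<i> X2" by (rule V_decompose)
    have "X1 \<bullet> M = 0" "X2 \<bullet> M = 0"
      using X V_inner_ii[OF X12(1) M_V] V_inner_ii[OF X12(2) M_V]
      by (simp_all add: X12(3) inner_add_left inner_ii inner_ii_flip)
    then have "F 0 X1 = 0" "F 0 X2 = 0"
      using X12 by (simp_all add: F0_zero_iff M_split)
    then show ?thesis
      using F0_linear[OF odd] by (simp add: X12(3) linear_add F_cscale)
  qed
  show False
  proof (cases "M = 0")
    case True
    define B :: M2 where "B = axis 1 (axis 1 1)"
    have "B \<noteq> 0" "det B = 0"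
      by (auto simp: B_def det_2 axis_def M2_eq_iff)
    moreover have "F 0 X = 0" for X using van[of X] by (simp add: True linear_0[OF linear_cscale])
    ultimately show False using smooth_F0[of B] by simp
  next
    case False
    \<comment> \<open>\<open>tau M\<close> is the point of tangency: by \<open>M0\<close> it is
      singular and on the plane, and its tangent space to the quadric lies in the kernel of the
      linear form.\<close>
    have tM: "tau M \<in> V" by (simp add: V_tau M_V)
    have "det (tau M) = 0"
      using M0 det_V_eq_0[OF M_V] by (simp add: det_tau)
    moreover have "F 0 (tau M) = 0"
      using M0 F0_zero_iff[OF tM] by (simp add: inner_commute flip: M_split)
    ultimately obtain X where X: "X \<in> tangent_quadric (tau M)" "F 0 X \<noteq> 0"
      using smooth_F0[of "tau M"] False by auto
    then have "X \<bullet> M = 0" "X \<bullet> cscale \<i> M = 0"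
      by (auto simp: tangent_quadric_def frechet_derivative_det complex_eq_iff)
    then show False using van X(2) by blast
  qed
qed

text \<open>For \<open>t = norm (P A) / norm (N A)\<close> below 1 one has
  \<open>\<bar>ucoord A\<bar> = (1 - t) / (1 + t)\<close>, so \<open>t < \<delta>\<close> says
  \<open>lev 1 < \<bar>ucoord A\<bar>\<close>: no critical level separates \<open>A\<close> from the
  unitary matrices.\<close>

definition \<delta> :: real where "\<delta> = (1 - lev 1) / (1 + lev 1)"

lemma delta_pos: "0 < \<delta>"
  using lev_Suc_less[of 0] lev_bounds(1)[of 1] by (simp add: \<delta>_def lev_def[of 0])

text \<open>For \<open>P A \<noteq> 0\<close> only the interval of index 0 is met, and the equation
  is the linear form at \<open>retract A\<close>. For \<open>P A = 0\<close> the required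
  \<open>Y\<close> in the image of \<open>P\<close> satisfies
  \<open>Y \<bullet> m = - (A \<bullet> n)\<close> and \<open>norm Y \<le> norm A\<close>, which is
  solvable exactly under the Cauchy-Schwarz bound.\<close>

lemma collar_iff_near:
  assumes "A \<in> V" "norm (P A) < \<delta> * norm (N A)"
  shows "cclass A \<in> collar \<longleftrightarrow>
    P A \<noteq> 0 \<and> norm (N A) * (A \<bullet> m) + norm (P A) * (A \<bullet> n) = 0 \<or>
    P A = 0 \<and> \<bar>A \<bullet> n\<bar> \<le> norm m * norm (N A)"
proof (cases "P A = 0")
  case True
  then have NA: "N A = A" by (simp add: P_0_iff)
  have A: "A \<noteq> 0" using assms(2) True delta_pos by (auto simp: N_simps P_simps)
  have Am: "A \<bullet> m = 0" using True PN_inner(1)[of A M] by (simp add: m_def)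
  have "(\<exists>Y\<in>V. P Y = Y \<and> norm Y \<le> norm A \<and> F 0 (A + Y) = 0) \<longleftrightarrow> \<bar>A \<bullet> n\<bar> \<le> norm m * norm A"
  proof
    assume "\<exists>Y\<in>V. P Y = Y \<and> norm Y \<le> norm A \<and> F 0 (A + Y) = 0"
    then obtain Y where Y: "Y \<in> V" "P Y = Y" "norm Y \<le> norm A" "F 0 (A + Y) = 0" by blast
    have "Y \<bullet> n = 0" using Y(2) PN_inner(1)[of Y n] by (simp add: PN_mn)
    then have "A \<bullet> n = - (Y \<bullet> m)"
      using Y(4) F0_zero_iff[OF V_add[OF assms(1) Y(1)]] Am by (simp add: inner_add_left)
    then have "\<bar>A \<bullet> n\<bar> \<le> norm Y * norm m"
      using Cauchy_Schwarz_ineq2[of Y m] by simp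
    also have "\<dots> \<le> norm A * norm m" using Y(3) by (intro mult_right_mono) auto
    finally show "\<bar>A \<bullet> n\<bar> \<le> norm m * norm A" by (simp add: mult.commute)
  next
    assume le: "\<bar>A \<bullet> n\<bar> \<le> norm m * norm A"
    \<comment> \<open>The shortest solution, a multiple of \<open>m\<close>. For
      \<open>m = 0\<close> it is 0, and the bound then gives
      \<open>A \<bullet> n = 0\<close>.\<close>
    define Y where "Y = (- (A \<bullet> n) / (norm m)\<^sup>2) *\<^sub>R m"
    have "Y \<in> V" "P Y = Y"
      unfolding Y_def by (rule V_scaleR[OF mn_V(1)]) (simp only: P_simps(2) PN_mn)
    moreover have "norm Y \<le> norm A"
    proof (cases "m = 0")
      case False
      then have "norm Y = \<bar>A \<bullet> n\<bar> / norm m" by (simp add: Y_def power2_eq_square)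
      then show ?thesis using le False by (simp add: divide_le_eq mult.commute)
    qed (simp add: Y_def)
    moreover have "F 0 (A + Y) = 0"
    proof -
      have "m \<bullet> n = 0" by (simp add: m_def n_def PN_orth)
      moreover have "m \<noteq> 0 \<or> A \<bullet> n = 0" using le by auto
      ultimately have "(A + Y) \<bullet> m + (A + Y) \<bullet> n = 0"
        using Am by (auto simp: Y_def inner_add_left inner_diff_left dot_square_norm)
      then show ?thesis using F0_zero_iff[OF V_add[OF assms(1) \<open>Y \<in> V\<close>]] by simp
    qed
    ultimately show "\<exists>Y\<in>V. P Y = Y \<and> norm Y \<le> norm A \<and> F 0 (A + Y) = 0" by blast
  qed
  then show ?thesis
    using collar_iff_P0[OF assms(1) A True] True NA by simp
next
  case False
  have NA: "N A \<noteq> 0" using assms(2) by auto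
  have pn: "pos A \<noteq> 0" "neg A \<noteq> 0" using swap False NA by auto
  have R: "retract A = norm (N A) *\<^sub>R P A + norm (P A) *\<^sub>R N A"
    using swap by (auto simp: retract_def add.commute)
  have "\<bar>ucoord A\<bar> = \<bar>norm (N A) - norm (P A)\<bar> / (norm (N A) + norm (P A))"
    using swap by (auto simp: ucoord_def add.commute abs_minus_commute)
  moreover have l: "lev 1 < 1" "0 \<le> lev 1" using lev_Suc_less[of 0] lev_bounds(1) by (simp_all add: lev_def[of 0])
  then have "norm (P A) * (1 + lev 1) < (1 - lev 1) * norm (N A)"
    using assms(2) by (simp add: \<delta>_def field_simps)
  then have "lev 1 * (norm (N A) + norm (P A)) < \<bar>norm (N A) - norm (P A)\<bar>"
    by (simp add: algebra_simps)
  then have "lev 1 < \<bar>norm (N A) - norm (P A)\<bar> / (norm (N A) + norm (P A))"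
    using NA by (simp add: less_divide_eq add_pos_nonneg)
  ultimately have "lev (Suc 0) < \<bar>ucoord A\<bar>" by simp
  then have "ER (ucoord A) (retract A) \<longleftrightarrow> Re (F 0 (retract A)) = 0"
    using retract_props(4)[OF assms(1) pn] by (intro ER_between_levels) (auto simp: lev_def[of 0])
  moreover have "Re (F 0 (retract A)) = norm (N A) * (A \<bullet> m) + norm (P A) * (A \<bullet> n)"
    using F0_inner[OF retract_props(1)[OF assms(1) pn]]
    by (simp add: R M_split inner_add_left PN_inner PN_mn)
  ultimately show ?thesis
    using collar_interior_iff[OF assms(1) pn] False by simp
qed

definition q0 :: M2 where "q0 = (1 / norm A0) *\<^sub>R A0"

lemma q0: "q0 \<in> V" "norm q0 = 1" "P q0 = 0" "N q0 = q0" "q0 \<bullet> q0 = 1" "A0 = norm A0 *\<^sub>R q0"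
  using A0 by (simp_all add: q0_def V_scaleR P_simps P_0_iff[symmetric] dot_square_norm power2_eq_square)

lemma NA0: "N A0 = A0"
  using A0(3) P_0_iff by blast

lemma A0_n: "\<bar>q0 \<bullet> n\<bar> \<le> norm m"
  using collar_iff_near[OF A0(1)] A0 delta_pos by (simp add: NA0 q0_def abs_mult field_simps)

lemma fixed_class: "A \<in> V \<Longrightarrow> A \<noteq> 0 \<Longrightarrow> cclass A \<in> fixed_locus J"
  by (auto simp: fixed_locus_eq)

lemma inner_q0_P: "q0 \<bullet> P X = 0" "P X \<bullet> q0 = 0"
  using PN_inner(1)[of q0 X] PN_inner(1)[of X q0] q0 by simp_all

text \<open>In the slice \<open>A \<bullet> q0 = 1\<close> of \<open>V\<close> a point is given by
  its component \<open>x\<close> along \<open>g\<close> and a vector of the plane orthogonal to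
  \<open>g\<close> and \<open>q0\<close>. The hypotheses on \<open>h\<close> say that the diagram is
  the graph \<open>x = h\<close> there, within \<open>C'\<close> and the range of
  \<open>collar_iff_near\<close>.\<close>

lemma chart_center:
  assumes g: "g \<in> V" "norm g = 1" "g \<bullet> q0 = 0"
    and C': "open C'" "A0 \<in> C'" "\<And>A r. A \<in> C' \<Longrightarrow> r \<noteq> 0 \<Longrightarrow> r *\<^sub>R A \<in> C'"
    and h: "\<And>Y. Y \<in> V \<Longrightarrow> Y \<bullet> g = 0 \<Longrightarrow> Y \<bullet> q0 = 0 \<Longrightarrow> q0 + Y \<in> W' \<Longrightarrow> h (q0 + Y) *\<^sub>R g + (q0 + Y) \<in> C' \<Longrightarrow>
        norm (P (h (q0 + Y) *\<^sub>R g + (q0 + Y))) < \<delta> * norm (N (h (q0 + Y) *\<^sub>R g + (q0 + Y))) \<Longrightarrow>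
        cclass (h (q0 + Y) *\<^sub>R g + (q0 + Y)) \<in> collar"
    and h': "\<And>x Y. Y \<in> V \<Longrightarrow> Y \<bullet> g = 0 \<Longrightarrow> Y \<bullet> q0 = 0 \<Longrightarrow> x *\<^sub>R g + (q0 + Y) \<in> C' \<Longrightarrow>
        norm (P (x *\<^sub>R g + (q0 + Y))) < \<delta> * norm (N (x *\<^sub>R g + (q0 + Y))) \<Longrightarrow>
        cclass (x *\<^sub>R g + (q0 + Y)) \<in> collar \<Longrightarrow> q0 + Y \<in> W' \<and> x = h (q0 + Y)"
    and W': "open W'" "continuous_on W' h"
  shows "surface_near (fixed_locus J \<inter> collar) (cclass A0)"
proof -
  have fc: "finite {g, q0}" "card {g, q0} < dim V" "{g, q0} \<subseteq> V"
    using g q0 by (auto simp: dim_V card_insert_if)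
  obtain e1 where e1: "e1 \<in> V" "norm e1 = 1" "\<And>c. c \<in> {g, q0} \<Longrightarrow> e1 \<bullet> c = 0"
    by (rule orthonormal_extend[OF subspace_V fc]) (rule that)
  have fc: "finite {g, q0, e1}" "card {g, q0, e1} < dim V" "{g, q0, e1} \<subseteq> V"
    using g q0 e1 by (auto simp: dim_V card_insert_if)
  obtain e2 where e2: "e2 \<in> V" "norm e2 = 1" "\<And>c. c \<in> {g, q0, e1} \<Longrightarrow> e2 \<bullet> c = 0"
    by (rule orthonormal_extend[OF subspace_V fc]) (rule that)
  have i1: "e1 \<bullet> g = 0" "e1 \<bullet> q0 = 0" "e2 \<bullet> g = 0" "e2 \<bullet> q0 = 0" "e2 \<bullet> e1 = 0" "e1 \<bullet> e1 = 1" "e2 \<bullet> e2 = 1"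
    using e1(2,3) e2(2,3) by (simp_all add: norm_eq_1)
  then have i2: "e1 \<bullet> e2 = 0" "g \<bullet> e1 = 0" "g \<bullet> e2 = 0" "q0 \<bullet> e1 = 0" "q0 \<bullet> e2 = 0" "q0 \<bullet> g = 0"
    using g(3) by (metis inner_commute)+
  note i = i1 i2
  have expand: "X = (X \<bullet> g) *\<^sub>R g + (X \<bullet> q0) *\<^sub>R q0 + (X \<bullet> e1) *\<^sub>R e1 + (X \<bullet> e2) *\<^sub>R e2" if "X \<in> V" for X
    using that e1 e2 g q0 i by (intro orthonormal_expand[OF subspace_V dim_V]) simp_all
  define Y where "Y w = w$1 *\<^sub>R e1 + w$2 *\<^sub>R e2" for w :: "real^2"
  have Y: "Y w \<in> V" "Y w \<bullet> g = 0" "Y w \<bullet> q0 = 0" "Y w \<bullet> e1 = w$1" "Y w \<bullet> e2 = w$2" for w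
    using e1 e2 i by (simp_all add: Y_def V_add V_scaleR inner_add_left)
  have cY: "continuous_on S Y" for S
    unfolding Y_def[abs_def] by (intro continuous_intros)
  define C where "C = V \<inter> {A. A \<bullet> q0 \<noteq> 0 \<and> norm (P A) < \<delta> * norm (N A)} \<inter> C'"
  have Cop: "openin (top_of_set V) C"
    unfolding C_def Int_assoc
    by (intro openin_open_Int open_Int C' open_Collect_conj open_Collect_neq open_Collect_less continuous_intros)
  define H where "H A = pair ((A \<bullet> e1) / (A \<bullet> q0)) ((A \<bullet> e2) / (A \<bullet> q0))" for A
  define W where "W = {w. q0 + Y w \<in> W'}"
  have "open ((\<lambda>w. q0 + Y w) -` W')"
    using continuous_on_open_vimage[of UNIV "\<lambda>w. q0 + Y w"] W'(1) cY by (simp add: continuous_on_add)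
  then have W: "open W" by (simp add: W_def vimage_def)
  define G where "G w = h (q0 + Y w) *\<^sub>R g + (q0 + Y w)" for w
  have Gi: "G w \<bullet> q0 = 1" "G w \<bullet> e1 = w$1" "G w \<bullet> e2 = w$2" for w
    using Y[of w] g(3) q0 i by (simp_all add: G_def inner_add_left)
  show ?thesis
  proof (rule normalized_chart[where C = C and H = H and \<nu> = "\<lambda>A. A \<bullet> q0" and G = G and W = W, OF _ Cop])
    show "r *\<^sub>R A \<in> C" if "A \<in> C" "r \<noteq> 0" for A r
      using that C'(3) by (auto simp: C_def V_scaleR P_simps N_simps mult.left_commute)
    show "A0 \<in> C"
      using A0 C'(2) delta_pos NA0 q0 by (simp add: C_def q0_def dot_square_norm)
    show "cclass A0 \<in> fixed_locus J \<inter> collar" using A0 fixed_class by simp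
    show "continuous_on C H"
      unfolding H_def by (intro continuous_intros) (auto simp: C_def)
    show "continuous_on W G"
      unfolding G_def by (intro continuous_intros cY continuous_on_compose2[OF W'(2)]) (auto simp: W_def)
    show "G ` W \<subseteq> V"
      using g q0 Y by (auto simp: G_def V_add V_scaleR)
    show "cclass (G w) \<in> fixed_locus J \<inter> collar \<and> H (G w) = w" if "w \<in> W" "G w \<in> C" for w
    proof -
      have "cclass (G w) \<in> collar"
        using h[OF Y(1,2,3), of w] that by (simp add: W_def C_def G_def)
      moreover have "G w \<noteq> 0" using Gi(1)[of w] by auto
      ultimately show ?thesis
        using that fixed_class[of "G w"] by (simp add: C_def H_def Gi)
    qed
    show "H A \<in> W \<and> G (H A) = A" if A: "A \<in> C" "A \<bullet> q0 = 1" "cclass A \<in> fixed_locus J \<inter> collar" for A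
    proof -
      have "A \<in> V" using A by (simp add: C_def)
      have e: "A = (A \<bullet> g) *\<^sub>R g + (q0 + Y (H A))"
        using expand[OF \<open>A \<in> V\<close>] A(2) by (simp add: Y_def H_def add.assoc)
      have "q0 + Y (H A) \<in> W' \<and> A \<bullet> g = h (q0 + Y (H A))"
        using h'[OF Y(1,2,3), of "A \<bullet> g" "H A"] A unfolding e[symmetric] by (simp add: C_def)
      then show ?thesis using e by (simp add: W_def G_def)
    qed
  qed (use W in \<open>auto simp: C_def H_def\<close>)
qed

text \<open>For \<open>m = 0\<close> both alternatives of \<open>collar_iff_near\<close> reduce to
  \<open>A \<bullet> n = 0\<close>, a plane because \<open>norm_mn\<close> gives
  \<open>n \<noteq> 0\<close>.\<close>

lemma surface_m_zero:
  assumes "m = 0" shows "surface_near (fixed_locus J \<inter> collar) (cclass A0)"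
proof -
  have n: "n \<noteq> 0" using norm_mn assms by auto
  have qn: "q0 \<bullet> n = 0" using A0_n assms by simp
  define g where "g = (1 / norm n) *\<^sub>R n"
  have g: "g \<in> V" "norm g = 1" "g \<bullet> q0 = 0" "n = norm n *\<^sub>R g"
    using n qn by (simp_all add: g_def mn_V V_scaleR inner_commute)
  have crit: "cclass A \<in> collar \<longleftrightarrow> A \<bullet> n = 0"
    if "A \<in> V" "norm (P A) < \<delta> * norm (N A)" for A
    using collar_iff_near[OF that] assms by auto
  have inn: "(x *\<^sub>R g + (q0 + Y)) \<bullet> n = norm n * x" if "Y \<bullet> g = 0" for x Y
  proof -
    have "(x *\<^sub>R g + (q0 + Y)) \<bullet> g = x"
      using g that q0 by (simp add: inner_add_left inner_commute[of q0 g] dot_square_norm)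
    then show ?thesis by (subst g(4)) simp
  qed
  show ?thesis
  proof (rule chart_center[OF g(1-3) open_UNIV, where h = "\<lambda>_. 0" and W' = UNIV])
    fix Y assume Y: "Y \<in> V" "Y \<bullet> g = 0" "norm (P (0 *\<^sub>R g + (q0 + Y))) < \<delta> * norm (N (0 *\<^sub>R g + (q0 + Y)))"
    show "cclass (0 *\<^sub>R g + (q0 + Y)) \<in> collar"
      using crit[of "0 *\<^sub>R g + (q0 + Y)"] Y inn[OF Y(2), of 0] q0(1) V_add by simp
  next
    fix x Y assume Y: "Y \<in> V" "Y \<bullet> g = 0" "norm (P (x *\<^sub>R g + (q0 + Y))) < \<delta> * norm (N (x *\<^sub>R g + (q0 + Y)))"
      "cclass (x *\<^sub>R g + (q0 + Y)) \<in> collar"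
    then show "q0 + Y \<in> UNIV \<and> x = 0"
      using crit[of "x *\<^sub>R g + (q0 + Y)"] inn[OF Y(2), of x] g(1) q0(1) n by (simp add: V_add V_scaleR)
  qed auto
qed

text \<open>The strict bound is open and contains the inequality at \<open>P A = 0\<close>, so near
  \<open>A0\<close> the equation alone describes the diagram. \<open>graph_equation\<close> solves
  it for the component along \<open>m\<close>, with \<open>\<rho> = norm (P A)\<close>.\<close>

lemma surface_graph:
  assumes "\<bar>q0 \<bullet> n\<bar> < norm m" shows "surface_near (fixed_locus J \<inter> collar) (cclass A0)"
proof -
  have m: "m \<noteq> 0" using assms by auto
  define g where "g = (1 / norm m) *\<^sub>R m"
  have "m \<bullet> q0 = 0" unfolding m_def by (rule inner_q0_P)
  then have g: "g \<in> V" "norm g = 1" "g \<bullet> q0 = 0" "m = norm m *\<^sub>R g" "P g = g" "N g = 0"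
    using m by (simp_all add: g_def mn_V V_scaleR PN_mn P_simps N_simps)
  define C' where "C' = {A. \<bar>A \<bullet> n\<bar> < norm m * norm (N A)}"
  define h where "h A = - (A \<bullet> n) * norm (P A) / sqrt ((norm m * norm (N A))\<^sup>2 - (A \<bullet> n)\<^sup>2)" for A
  have crit: "cclass (x *\<^sub>R g + Z) \<in> collar \<longleftrightarrow> x = h Z"
    and C'_iff: "x *\<^sub>R g + Z \<in> C' \<longleftrightarrow> Z \<in> C'"
    if Z: "x *\<^sub>R g + Z \<in> V" "Z \<bullet> g = 0" "x *\<^sub>R g + Z \<in> C' \<or> Z \<in> C'"
      "norm (P (x *\<^sub>R g + Z)) < \<delta> * norm (N (x *\<^sub>R g + Z))" for x Z
  proof -
    let ?A = "x *\<^sub>R g + Z"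
    have NA: "N ?A = N Z" and PA: "P ?A = x *\<^sub>R g + P Z"
      using g by (simp_all add: N_simps P_simps)
    have gn: "g \<bullet> n = 0" using PN_inner(1)[of g n] g(5) by (simp add: PN_mn)
    have An: "?A \<bullet> n = Z \<bullet> n" by (simp add: inner_add_left gn)
    show C: "?A \<in> C' \<longleftrightarrow> Z \<in> C'" by (simp add: C'_def NA An)
    then have lt: "\<bar>Z \<bullet> n\<bar> < norm m * norm (N Z)" using Z(3) by (auto simp: C'_def)
    have Pg: "P Z \<bullet> g = 0" using PN_inner(1)[of Z g] g(5) Z(2) by simp
    have gg: "g \<bullet> g = 1" using g(2) by (simp add: norm_eq_1)
    have rho: "(norm (P ?A))\<^sup>2 = x\<^sup>2 + (norm (P Z))\<^sup>2"
      unfolding PA power2_norm_eq_inner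
      using Pg gg by (simp add: inner_add_left inner_add_right inner_commute[of g "P Z"] power2_eq_square)
    have Am: "?A \<bullet> m = norm m * x"
    proof -
      have "?A \<bullet> (norm m *\<^sub>R g) = norm m * x" using gg Z(2) by (simp add: inner_add_left)
      then show ?thesis using g(4) by simp
    qed
    have "cclass ?A \<in> collar \<longleftrightarrow> (norm m * norm (N Z)) * x + (Z \<bullet> n) * norm (P ?A) = 0"
    proof (cases "P ?A = 0")
      case True
      then have "x = 0" using rho by (simp add: add_nonneg_eq_0_iff)
      then show ?thesis
        using collar_iff_near[OF Z(1,4)] True lt by (simp add: NA An)
    next
      case False
      then show ?thesis
        using collar_iff_near[OF Z(1,4)] by (simp add: NA An Am mult_ac)
    qed
    also have "\<dots> \<longleftrightarrow> x = h Z"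
      unfolding h_def using lt rho by (intro graph_equation) auto
    finally show "cclass ?A \<in> collar \<longleftrightarrow> x = h Z" .
  qed
  have C'op: "open C'"
    unfolding C'_def by (intro open_Collect_less continuous_intros)
  have qg: "(q0 + Y) \<bullet> g = 0" if "Y \<bullet> g = 0" for Y
    using that g(3) by (simp add: inner_add_left inner_commute[of q0 g])
  show ?thesis
  proof (rule chart_center[OF g(1-3) C'op, where h = h and W' = C'])
    show "A0 \<in> C'"
    proof -
      have "A0 \<bullet> n = norm A0 * (q0 \<bullet> n)" using A0(2) by (simp add: q0_def)
      then show ?thesis using assms A0(2) by (simp add: C'_def NA0 abs_mult mult.commute)
    qed
    show "r *\<^sub>R A \<in> C'" if "A \<in> C'" "r \<noteq> 0" for A r
      using that by (simp add: C'_def N_simps abs_mult mult.left_commute)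
    show "continuous_on C' h"
      unfolding h_def[abs_def]
    proof (intro continuous_intros ballI)
      fix A assume "A \<in> C'"
      then have "(A \<bullet> n)\<^sup>2 < (norm m * norm (N A))\<^sup>2"
        using power_strict_mono[of "\<bar>A \<bullet> n\<bar>" "norm m * norm (N A)" 2] by (simp add: C'_def)
      then show "sqrt ((norm m * norm (N A))\<^sup>2 - (A \<bullet> n)\<^sup>2) \<noteq> 0" by simp
    qed
  next
    fix Y assume Y: "Y \<in> V" "Y \<bullet> g = 0" "q0 + Y \<in> C'"
      "norm (P (h (q0 + Y) *\<^sub>R g + (q0 + Y))) < \<delta> * norm (N (h (q0 + Y) *\<^sub>R g + (q0 + Y)))"
    show "cclass (h (q0 + Y) *\<^sub>R g + (q0 + Y)) \<in> collar"
      using crit[of "h (q0 + Y)" "q0 + Y"] Y qg g(1) q0(1) by (simp add: V_add V_scaleR)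
  next
    fix x Y assume Y: "Y \<in> V" "Y \<bullet> g = 0" "x *\<^sub>R g + (q0 + Y) \<in> C'"
      "norm (P (x *\<^sub>R g + (q0 + Y))) < \<delta> * norm (N (x *\<^sub>R g + (q0 + Y)))"
      "cclass (x *\<^sub>R g + (q0 + Y)) \<in> collar"
    show "q0 + Y \<in> C' \<and> x = h (q0 + Y)"
      using crit[of x "q0 + Y"] C'_iff[of x "q0 + Y"] Y qg g(1) q0(1) by (simp add: V_add V_scaleR)
  qed (rule C'op)
qed

end

context unitary_frame
begin

text \<open>With \<open>norm (N A) = 1\<close>, \<open>c = - (A \<bullet> b) / \<kappa>\<close> and
  \<open>\<rho> = norm (P A)\<close> the equation becomes \<open>A \<bullet> a = c * \<rho>\<close>.
  For \<open>\<rho> > 0\<close> this makes \<open>c\<close> a cosine; for \<open>\<rho> = 0\<close>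
  it is limited only by \<open>\<bar>c\<bar> \<le> 1\<close>. The chart has elliptic sum
  \<open>sqrt (1 + \<rho>\<^sup>2)\<close> and difference \<open>c\<close>.\<close>

lemma surface_elliptic:
  assumes "\<bar>q0 \<bullet> n\<bar> = norm m" "m \<noteq> 0"
  shows "surface_near (fixed_locus J \<inter> collar) (cclass A0)"
proof -
  have le: "norm m \<le> norm n"
    using Cauchy_Schwarz_ineq2[of q0 n] assms(1) q0(2) by simp
  then have lt: "norm m < norm n" using norm_mn by simp
  have n0: "n \<noteq> 0" using lt by auto
  define a where "a = (1 / norm m) *\<^sub>R m"
  define b where "b = (1 / norm n) *\<^sub>R n"
  have a: "a \<in> V" "norm a = 1" "P a = a" "N a = 0" and m_eq: "m = norm m *\<^sub>R a"
    using assms(2) by (simp_all add: a_def mn_V V_scaleR PN_mn P_simps N_simps)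
  have b: "b \<in> V" "norm b = 1" "P b = 0" "N b = b" and n_eq: "n = norm n *\<^sub>R b"
    using n0 by (simp_all add: b_def mn_V V_scaleR PN_mn P_simps N_simps)
  \<comment> \<open>\<open>v\<close> is the direction of \<open>q0\<close> orthogonal to
    \<open>n\<close>, nonzero since \<open>norm m < norm n\<close> keeps \<open>q0\<close> off the
    line of \<open>n\<close>. The normalisation determines the component along \<open>v\<close> from
    the others and makes it positive.\<close>
  define v0 where "v0 = q0 - (q0 \<bullet> b) *\<^sub>R b"
  have qb: "\<bar>q0 \<bullet> b\<bar> < 1"
    using assms(1) lt n0 by (simp add: b_def)
  have bb: "b \<bullet> b = 1" using b(2) by (simp add: norm_eq_1)
  have v0q: "v0 \<bullet> q0 = 1 - (q0 \<bullet> b)\<^sup>2"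
    by (simp add: v0_def inner_diff_left q0(5) inner_commute[of b q0] power2_eq_square)
  have v0p: "v0 \<bullet> q0 > 0"
    unfolding v0q using qb by (simp add: abs_square_less_1)
  then have v00: "v0 \<noteq> 0" by auto
  define v where "v = (1 / norm v0) *\<^sub>R v0"
  have "N v0 = v0" "P v0 = 0" "v0 \<in> V" "v0 \<bullet> b = 0"
    using q0(1-4) b bb by (simp_all add: v0_def N_simps P_simps V_diff V_scaleR inner_diff_left)
  then have v: "v \<in> V" "norm v = 1" "P v = 0" "N v = v" "v \<bullet> b = 0" "q0 \<bullet> v > 0"
    using v00 v0p by (simp_all add: v_def V_scaleR P_simps N_simps inner_commute[of q0])
  have ab: "a \<bullet> b = 0" using PN_inner(1)[of a b] a b by simp
  have av: "a \<bullet> v = 0" using PN_inner(1)[of a v] a v by simp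
  have bv: "b \<bullet> v = 0" using v(5) by (simp add: inner_commute[of b])
  have fc: "finite {a, b, v}" "card {a, b, v} < dim V" "{a, b, v} \<subseteq> V"
    using a b v by (auto simp: dim_V card_insert_if)
  obtain e where e: "e \<in> V" "norm e = 1" "\<And>c. c \<in> {a, b, v} \<Longrightarrow> e \<bullet> c = 0"
    by (rule orthonormal_extend[OF subspace_V fc]) (rule that)
  have e': "e \<bullet> a = 0" "e \<bullet> b = 0" "e \<bullet> v = 0" using e(3) by simp_all
  have e'': "a \<bullet> e = 0" "b \<bullet> e = 0" "v \<bullet> e = 0" using e' by (metis inner_commute)+
  have un: "a \<bullet> a = 1" "v \<bullet> v = 1" "e \<bullet> e = 1" using a v e by (simp_all add: norm_eq_1)
  have i: "b \<bullet> a = 0" "v \<bullet> a = 0" using ab av by (metis inner_commute)+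
  note inners = ab av bv e' e'' un bb i v(5)
  have expand: "X = (X \<bullet> a) *\<^sub>R a + (X \<bullet> b) *\<^sub>R b + (X \<bullet> v) *\<^sub>R v + (X \<bullet> e) *\<^sub>R e" if "X \<in> V" for X
    using that a b v e inners by (intro orthonormal_expand[OF subspace_V dim_V]) simp_all
  \<comment> \<open>The fourth basis vector lies in the image of \<open>P\<close>
    (\<open>s = 1\<close>) or of \<open>N\<close> (\<open>s = 0\<close>). In the second case the
    elliptic coordinates degenerate: the sum is \<open>max 1 \<bar>w$1\<bar>\<close> and the
    difference is \<open>w$1\<close> clipped to the interval from -1 to 1.\<close>
  define s where "s = P e \<bullet> e"
  have Pe: "P e = s *\<^sub>R e"
    using expand[OF V_PN(1)[OF e(1)]] PN_inner(1)[of e a] PN_inner(1)[of e b] PN_inner(1)[of e v] a b v e'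
    by (simp add: s_def)
  have "P (P e) = P e" by (rule PN)
  then have "s *\<^sub>R s *\<^sub>R e = s *\<^sub>R e" by (simp add: Pe P_simps)
  then have "(s * s - s) *\<^sub>R e = 0" by (simp add: scaleR_diff_left)
  then have ss: "s * s = s" using e(2) by auto
  then have s01: "s = 0 \<or> s = 1" by (auto simp: algebra_simps)
  have Ne: "N e = (1 - s) *\<^sub>R e"
    using PN(1)[of e] Pe by (metis add_diff_cancel_left' scaleR_diff_left scaleR_one)
  define \<kappa> where "\<kappa> = norm m / norm n"
  have k: "0 < \<kappa>" "\<kappa> < 1" "norm m = \<kappa> * norm n" using lt assms(2) n0 by (simp_all add: \<kappa>_def)
  define E where "E x y c z = x *\<^sub>R a + y *\<^sub>R b + c *\<^sub>R v + z *\<^sub>R e" for x y c z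
  have E_V: "E x y c z \<in> V" for x y c z
    using a b v e by (simp add: E_def V_add V_scaleR)
  have E_inner: "E x y c z \<bullet> a = x" "E x y c z \<bullet> b = y" "E x y c z \<bullet> v = c" "E x y c z \<bullet> e = z" for x y c z
    by (simp_all add: E_def inner_add_left inners)
  have E_eta: "E (X \<bullet> a) (X \<bullet> b) (X \<bullet> v) (X \<bullet> e) = X" if "X \<in> V" for X
    using expand[OF that] by (simp add: E_def)
  have PE: "P (E x y c z) = x *\<^sub>R a + (s * z) *\<^sub>R e"
    and NE: "N (E x y c z) = y *\<^sub>R b + c *\<^sub>R v + ((1 - s) * z) *\<^sub>R e" for x y c z
    using a b v by (simp_all add: E_def P_simps N_simps Pe Ne mult.commute)
  have nPE: "(norm (P (E x y c z)))\<^sup>2 = x\<^sup>2 + s * z\<^sup>2" for x y c z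
    unfolding PE power2_norm_eq_inner using s01
    by (auto simp: inner_add_left inner_add_right inners power2_eq_square)
  have nNE: "(norm (N (E x y c z)))\<^sup>2 = y\<^sup>2 + c\<^sup>2 + (1 - s) * z\<^sup>2" for x y c z
    unfolding NE power2_norm_eq_inner using s01
    by (auto simp: inner_add_left inner_add_right inners power2_eq_square)
  have crit: "cclass A \<in> collar \<longleftrightarrow> \<kappa> * norm (N A) * (A \<bullet> a) + norm (P A) * (A \<bullet> b) = 0 \<and>
      (P A = 0 \<longrightarrow> \<bar>A \<bullet> b\<bar> \<le> \<kappa> * norm (N A))"
    if A: "A \<in> V" "norm (P A) < \<delta> * norm (N A)" for A
  proof -
    have Am: "A \<bullet> m = \<kappa> * norm n * (A \<bullet> a)" "A \<bullet> n = norm n * (A \<bullet> b)"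
      using m_eq n_eq k(3) by (metis inner_scaleR_right)+
    have "norm (N A) * (A \<bullet> m) + norm (P A) * (A \<bullet> n) =
        norm n * (\<kappa> * norm (N A) * (A \<bullet> a) + norm (P A) * (A \<bullet> b))"
      by (simp add: Am algebra_simps)
    then have 1: "norm (N A) * (A \<bullet> m) + norm (P A) * (A \<bullet> n) = 0 \<longleftrightarrow>
        \<kappa> * norm (N A) * (A \<bullet> a) + norm (P A) * (A \<bullet> b) = 0"
      using n0 by simp
    have "\<bar>A \<bullet> n\<bar> \<le> norm m * norm (N A) \<longleftrightarrow> norm n * \<bar>A \<bullet> b\<bar> \<le> norm n * (\<kappa> * norm (N A))"
      by (simp add: Am k(3) abs_mult mult_ac)
    then have 2: "\<bar>A \<bullet> n\<bar> \<le> norm m * norm (N A) \<longleftrightarrow> \<bar>A \<bullet> b\<bar> \<le> \<kappa> * norm (N A)"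
      using n0 by simp
    have 3: "A \<bullet> a = 0" if "P A = 0"
      using PN_inner(1)[of A a] a(3) that by simp
    show ?thesis
      unfolding collar_iff_near[OF A] 1 2 using 3 by auto
  qed
  define C where "C = V \<inter> {A. A \<bullet> v \<noteq> 0 \<and> norm (P A) < \<delta> * norm (N A)}"
  define H where "H A = pair (- (sgn (A \<bullet> v) * (A \<bullet> b) / (\<kappa> * norm (N A))) * sqrt (1 + (norm (P A))\<^sup>2 / (norm (N A))\<^sup>2))
      (sgn (A \<bullet> v) * (A \<bullet> e) / norm (N A))" for A
  define Z where "Z w = s * (w$2)\<^sup>2" for w :: "real^2"
  define D where "D w = ell_diff (w$1) (Z w)" for w
  \<comment> \<open>\<open>R\<close> recovers \<open>\<rho>\<close> from the elliptic sum;
    \<open>T\<close> is the square of the component along \<open>v\<close> that is forced by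
    \<open>norm (N A) = 1\<close>.\<close>
  define R where "R w = sqrt ((ell_sum (w$1) (Z w))\<^sup>2 - 1)" for w
  define T where "T w = 1 - (\<kappa> * D w)\<^sup>2 - (1 - s) * (w$2)\<^sup>2" for w
  define G where "G w = E (D w * R w) (- \<kappa> * D w) (sqrt (T w)) (w$2)" for w
  have Z0: "0 \<le> Z w" for w using s01 by (auto simp: Z_def)
  have cZ: "continuous_on S Z" for S
    unfolding Z_def[abs_def] by (intro continuous_intros)
  have cD: "continuous_on S D" for S
    unfolding D_def[abs_def] ell_diff_def by (intro continuous_intros cZ) auto
  have cR: "continuous_on S R" for S
    unfolding R_def[abs_def] ell_sum_def by (intro continuous_intros cZ) auto
  have cT: "continuous_on S T" for S
    unfolding T_def[abs_def] by (intro continuous_intros cD)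
  note ep = ell_props[OF Z0]
  have R: "0 \<le> R w" "(R w)\<^sup>2 = (ell_sum (w$1) (Z w))\<^sup>2 - 1" for w
    using ep(3)[of "w$1" w] by (simp_all add: R_def)
  show ?thesis
  proof (rule normalized_chart[where C = C and H = H and \<nu> = "\<lambda>A. sgn (A \<bullet> v) * norm (N A)"
        and G = G and W = "{w. 0 < T w}"])
    show "openin (top_of_set V) C"
      unfolding C_def
      by (intro openin_open_Int open_Collect_conj open_Collect_neq open_Collect_less continuous_intros)
    show "r *\<^sub>R A \<in> C" if "A \<in> C" "r \<noteq> 0" for A r
      using that by (auto simp: C_def V_scaleR P_simps N_simps mult.left_commute)
    show "A0 \<in> C"
      using A0 delta_pos NA0 v(6) by (subst C_def) (simp add: q0_def zero_less_divide_iff)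
    show "cclass A0 \<in> fixed_locus J \<inter> collar" using A0 fixed_class by simp
    have NC: "N A \<noteq> 0" "A \<bullet> v \<noteq> 0" "A \<in> V" "norm (P A) < \<delta> * norm (N A)" if "A \<in> C" for A
      using that by (auto simp: C_def)
    show "continuous_on C H"
      unfolding H_def using NC(1,2) k(1) by (intro continuous_intros) auto
    show "H (r *\<^sub>R A) = H A" if "A \<in> C" "r \<noteq> 0" for A r
    proof -
      have r: "sgn (r * x) * (r * y) / (\<bar>r\<bar> * z) = sgn x * y / z" for x y z :: real
        using that(2) by (cases "0 < r") (simp_all add: sgn_mult)
      have r': "sgn (r * x) * (r * y) / (c * (\<bar>r\<bar> * z)) = sgn x * y / (c * z)" for x y c z :: real
        using r[of x y "c * z"] by (simp add: mult.left_commute)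
      show ?thesis
        using that(2) by (simp add: H_def P_simps N_simps r r' power_mult_distrib)
    qed
    show "A \<noteq> 0 \<and> sgn (A \<bullet> v) * norm (N A) \<noteq> 0" if "A \<in> C" for A
      using NC[OF that] by (auto simp: sgn_zero_iff)
    show "sgn ((r *\<^sub>R A) \<bullet> v) * norm (N (r *\<^sub>R A)) = r * (sgn (A \<bullet> v) * norm (N A))" if "r \<noteq> 0" for A r
      using that by (cases "0 < r") (simp_all add: N_simps sgn_mult)
    show "open {w. 0 < T w}"
      by (intro open_Collect_less continuous_intros cT)
    show "continuous_on {w. 0 < T w} G"
      unfolding G_def E_def by (intro continuous_intros cD cR cT)
    show "G ` {w. 0 < T w} \<subseteq> V" by (auto simp: G_def E_V)
  next
    fix w assume w: "w \<in> {w. 0 < T w}" "G w \<in> C"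
    have nN: "norm (N (G w)) = 1"
    proof -
      have "(norm (N (G w)))\<^sup>2 = 1"
        unfolding G_def nNE using w(1) by (simp add: T_def power_mult_distrib)
      then show ?thesis by (simp add: power2_eq_1_iff) (metis norm_ge_zero neg_0_le_iff_le not_one_le_zero)
    qed
    have nP: "norm (P (G w)) = R w"
    proof -
      have "(R w)\<^sup>2 * (1 - (D w)\<^sup>2) = s * (w$2)\<^sup>2"
        using ep(2)[of "w$1" w] by (simp add: R(2) D_def Z_def[of w])
      then have "(norm (P (G w)))\<^sup>2 = (R w)\<^sup>2"
        unfolding G_def nPE by (simp add: power_mult_distrib algebra_simps)
      then show ?thesis using R(1) by (simp add: power2_eq_iff_nonneg)
    qed
    have GV: "G w \<in> V" "norm (P (G w)) < \<delta> * norm (N (G w))" using w(2) by (auto simp: C_def)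
    have "cclass (G w) \<in> collar"
      unfolding crit[OF GV] nN nP using ep(4)[of "w$1" w] k(1)
      by (simp add: G_def E_inner abs_mult D_def)
    moreover have "G w \<noteq> 0" using nN by (auto simp: N_simps)
    moreover have "H (G w) = w"
    proof -
      have "sgn (G w \<bullet> v) = 1" using w(1) by (simp add: G_def E_inner)
      moreover have "sqrt (1 + (R w)\<^sup>2) = ell_sum (w$1) (Z w)"
        using ep(3)[of "w$1" w] by (simp add: R)
      moreover have "D w * ell_sum (w$1) (Z w) = w$1"
        using ep(1)[of "w$1" w] by (simp add: D_def mult.commute)
      moreover have "G w \<bullet> b = - \<kappa> * D w" "G w \<bullet> e = w$2" by (simp_all add: G_def E_inner)
      ultimately show ?thesis
        using k(1) by (simp add: H_def nN nP pair_eq_iff)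
    qed
    ultimately show "cclass (G w) \<in> fixed_locus J \<inter> collar \<and> H (G w) = w"
      using fixed_class[OF GV(1)] by simp
  next
    fix A assume A: "A \<in> C" "sgn (A \<bullet> v) * norm (N A) = 1" "cclass A \<in> fixed_locus J \<inter> collar"
    have AV: "A \<in> V" "norm (P A) < \<delta> * norm (N A)" using A(1) by (auto simp: C_def)
    have "norm (N A) \<noteq> - 1" using norm_ge_zero[of "N A"] by linarith
    then have sg: "sgn (A \<bullet> v) = 1" "norm (N A) = 1"
      using A(2) by (auto simp: sgn_if split: if_splits)
    then have pos: "A \<bullet> v > 0" by (simp add: sgn_1_pos)
    define \<rho> where "\<rho> = norm (P A)"
    define c where "c = - (A \<bullet> b) / \<kappa>"
    have Ab: "A \<bullet> b = - \<kappa> * c" using k(1) by (simp add: c_def)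
    have nP: "\<rho>\<^sup>2 = (A \<bullet> a)\<^sup>2 + s * (A \<bullet> e)\<^sup>2"
      unfolding \<rho>_def by (subst E_eta[OF AV(1), symmetric], subst nPE) simp
    have nN: "(A \<bullet> b)\<^sup>2 + (A \<bullet> v)\<^sup>2 + (1 - s) * (A \<bullet> e)\<^sup>2 = 1"
      using nNE[of "A \<bullet> a" "A \<bullet> b" "A \<bullet> v" "A \<bullet> e"] E_eta[OF AV(1)] sg(2) by simp
    have cr: "\<kappa> * (A \<bullet> a) + \<rho> * (A \<bullet> b) = 0" "P A = 0 \<Longrightarrow> \<bar>A \<bullet> b\<bar> \<le> \<kappa>"
      using A(3) crit[OF AV] sg(2) by (simp_all add: \<rho>_def)
    have "\<kappa> * (A \<bullet> a) = \<kappa> * (c * \<rho>)" using cr(1) by (simp add: Ab mult.commute)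
    then have Aa: "A \<bullet> a = c * \<rho>" using k(1) by simp
    have c1: "\<bar>c\<bar> \<le> 1"
    proof (cases "P A = 0")
      case True
      then show ?thesis using cr(2) k(1) by (simp add: Ab abs_mult)
    next
      case False
      then have "\<rho> > 0" by (simp add: \<rho>_def)
      have "(A \<bullet> a)\<^sup>2 \<le> \<rho>\<^sup>2" using nP s01 by auto
      then have "c\<^sup>2 * \<rho>\<^sup>2 \<le> 1 * \<rho>\<^sup>2" by (simp add: Aa power_mult_distrib)
      then have "c\<^sup>2 \<le> 1" using \<open>\<rho> > 0\<close> by (simp only: mult_le_cancel_right) auto
      then show ?thesis by (simp add: abs_square_le_1)
    qed
    have H2: "H A $ 2 = A \<bullet> e" by (simp add: H_def sg)
    have H1: "H A $ 1 = c * sqrt (1 + \<rho>\<^sup>2)" by (simp add: H_def sg c_def \<rho>_def)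
    have ZH: "Z (H A) = \<rho>\<^sup>2 * (1 - c\<^sup>2)"
      using nP by (simp add: Z_def H2 Aa power_mult_distrib algebra_simps)
    note ei = ell_inverse[OF _ c1 ZH]
    have \<rho>0: "0 \<le> \<rho>" by (simp add: \<rho>_def)
    have DH: "D (H A) = c" unfolding D_def H1 by (rule ei(2)[OF \<rho>0])
    have RH: "R (H A) = \<rho>" unfolding R_def H1 ei(1)[OF \<rho>0] using \<rho>0 by simp
    have TH: "T (H A) = (A \<bullet> v)\<^sup>2"
      using nN by (simp add: T_def DH H2 Ab power_mult_distrib)
    have "G (H A) = A"
      unfolding G_def DH RH TH H2 using pos E_eta[OF AV(1)] by (simp add: Aa Ab)
    then show "H A \<in> {w. 0 < T w} \<and> G (H A) = A"
      using pos by (simp add: TH)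
  qed auto
qed

lemma surface_unitary: "surface_near (fixed_locus J \<inter> collar) (cclass A0)"
  using A0_n surface_m_zero surface_graph surface_elliptic by (cases "m = 0") fastforce+

end

section \<open>All real points and the closure of the real locus\<close>

context diagram
begin

lemma surface_collar:
  assumes "p \<in> fixed_locus J \<inter> collar"
  shows "surface_near (fixed_locus J \<inter> collar) p"
proof -
  obtain A where A: "A \<in> V" "A \<noteq> 0" "p = cclass A" "cclass A \<in> collar"
    using assms by (auto simp: fixed_locus_eq)
  consider "pos A = 0" | "neg A = 0" | "pos A \<noteq> 0" "neg A \<noteq> 0" by blast
  then show ?thesis
  proof cases
    case 1
    then have "tau A = - A" by (simp add: pos_eq_iff)
    then have "odd d" using collar_neg_iff[OF A(1,2)] A(4) by simp
    then interpret unitary_frame J d \<gamma> f pos neg A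
      using A 1 by unfold_locales auto
    show ?thesis unfolding A(3) by (rule surface_unitary)
  next
    case 2
    then have "tau A = A" by (simp add: pos_eq_iff)
    then have "odd d" using collar_pos_iff[OF A(1,2)] A(4) by simp
    then interpret unitary_frame J d \<gamma> f neg pos A
      using A 2 by unfold_locales auto
    show ?thesis unfolding A(3) by (rule surface_unitary)
  next
    case 3
    then show ?thesis unfolding A(3) using surface_interior A by blast
  qed
qed

lemma real_points_closure:
  "top_of_set (fixed_locus J) closure_of {p \<in> primitive_diagram d \<gamma> f. involution_of J p = p}
    = fixed_locus J \<inter> collar"
proof -
  have "{p \<in> primitive_diagram d \<gamma> f. involution_of J p = p} = fixed_locus J \<inter> collar"
    by (auto simp: primitive_diagram_eq fixed_locus_def)
  moreover have "closedin (top_of_set (fixed_locus J)) (fixed_locus J \<inter> collar)"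
    by (rule closedin_closed_Int[OF closed_collar])
  ultimately show ?thesis by (simp add: closure_of_eq)
qed

end

theorem theorem2:
  fixes d :: nat
    and \<gamma> :: "nat \<Rightarrow> real"
    and f :: "nat \<Rightarrow> complex^2^2 \<Rightarrow> complex"
    and J :: "complex^2^2 \<Rightarrow> complex^2^2"
  assumes "d \<ge> 1"
    and "J \<in> {entry_conj, conj_transpose_adj, conj_transpose}"
    and "primitive_data d \<gamma> f"
    and "real_data J d f"
  shows "topological_surface
           (top_of_set (top_of_set (fixed_locus J)
              closure_of {p \<in> primitive_diagram d \<gamma> f. involution_of J p = p}))"
proof -
  interpret real_structure J using assms(2) by (rule real_structureI)
  interpret diagram J d \<gamma> f using assms by unfold_locales
  show ?thesis
    unfolding real_points_closure topological_surface_def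
    using surface_collar second_countable_cp3 Hausdorff_cp3 unfolding surface_near_def by simp
qed

end
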